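(* Let $1<p<\infty$. Assume that $$\sup_n\left|w_{n+1}\frac{a_{n+1}}{a_n}\right|<\infty,\qquad\limsup_n\left|\frac{b_n}{a_{n+1}}\right|<1,\qquad\lim_n\left|w_{n+1}\frac{b_n}{a_n}-w_n\frac{b_{n-1}}{a_{n-1}}\right|=0.$$ Then $B_w$ has hypercyclic subspaces in $\ell^p_{a,b}$ if and only if $$\sup_n|w_1w_2\cdots w_na_n|=\infty\quad\text{and}\quad\sup_{n\ge1}\left(\inf_{k\ge1}\left|(w_{k+1}w_{k+2}\cdots w_{k+n})\frac{a_{k+n}}{a_k}\right|\right)^{1/n}\le1.$$
   Context: $\mathbb{D}$ is the open unit disc in $\mathbb{C}$. $a=(a_n)_{n\ge0}$ and $b=(b_n)_{n\ge0}$ are complex sequences with $a_n\ne0$ for all $n$, and $f_n(z)=(a_n+b_nz)z^n$, $n\ge0$. For $1\le p<\infty$, $\ell^p_{a,b}$ is the Banach space of analytic functions on $\mathbb{D}$ of the form $f=\sum_{n\ge0}\lambda_nf_n$ with $(\lambda_n)\in\ell^p$, normed by $\|f\|=(\sum_n|\lambda_n|^p)^{1/p}$ (so $\{f_n\}$ is a normalized Schauder basis equivalent to the standard basis of $\ell^p$, and an orthonormal basis when $p=2$). Standing assumption: the set $\{z\in\mathbb{C}:\sum_n((|a_n|+|b_n|)|z|^n)^q<\infty\}$ (with $1/p+1/q=1$) and the sets $\{z\in\mathbb{C}:\sup_n(|a_n|+|b_n|)|z|^n<\infty\}$ and $\{z\in\mathbb{C}:\sum_n(|a_n|+|b_n|)|z|^n<\infty\}$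 are all equal to $\mathbb{D}$. $w=(w_n)_{n\ge0}$ is a sequence of non-zero complex numbers, and the weighted backward shift acts on Taylor series by $B_w(\sum_{n\ge0}\lambda_nz^n)=\sum_{n\ge0}w_{n+1}\lambda_{n+1}z^n$. A vector $x$ is hypercyclic for a bounded operator $T$ on a separable Banach space $X$ if $\{x,Tx,T^2x,\dots\}$ is dense in $X$. $T$ has a hypercyclic subspace if there is a closed infinite-dimensional subspace of $X$ all of whose non-zero vectors are hypercyclic for $T$. *)

theory Defs
  imports "HOL-Complex_Analysis.Complex_Analysis" "HOL-Library.Function_Algebras"
begin

section \<open>Operators on a normed space given by a carrier set\<close>

text \<open>
  The spaces \<open>\<ell>\<^sup>p\<^sub>a\<^sub>,\<^sub>b\<close> depend on the parameters \<open>p\<close>, \<open>a\<close>, \<open>b\<close>, so they cannot be types.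
  A normed space is given by a carrier set \<open>X\<close>, a norm \<open>N\<close> (relevant on \<open>X\<close> only), and a scalar
  multiplication \<open>s\<close>; the additive structure is that of the ambient type.
\<close>

definition norm_topology :: "'v::ab_group_add set \<Rightarrow> ('v \<Rightarrow> real) \<Rightarrow> 'v topology" where
  "norm_topology X N = Metric_space.mtopology X (\<lambda>x y. N (x - y))"

definition bounded_operator ::
  "('k::comm_ring_1 \<Rightarrow> 'v::ab_group_add \<Rightarrow> 'v) \<Rightarrow> 'v set \<Rightarrow> ('v \<Rightarrow> real) \<Rightarrow> ('v \<Rightarrow> 'v) \<Rightarrow> bool" where
  "bounded_operator s X N T \<longleftrightarrow>
     (\<forall>x\<in>X. T x \<in> X) \<and>
     (\<forall>x\<in>X. \<forall>y\<in>X. T (x + y) = T x + T y) \<and>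
     (\<forall>c. \<forall>x\<in>X. T (s c x) = s c (T x)) \<and>
     (\<exists>C. \<forall>x\<in>X. N (T x) \<le> C * N x)"

definition hypercyclic_vector ::
  "'v::ab_group_add set \<Rightarrow> ('v \<Rightarrow> real) \<Rightarrow> ('v \<Rightarrow> 'v) \<Rightarrow> 'v \<Rightarrow> bool" where
  "hypercyclic_vector X N T x \<longleftrightarrow>
     x \<in> X \<and> norm_topology X N closure_of (range (\<lambda>n. (T ^^ n) x)) = X"

definition finite_dimensional ::
  "('k::comm_ring_1 \<Rightarrow> 'v::ab_group_add \<Rightarrow> 'v) \<Rightarrow> 'v set \<Rightarrow> bool" where
  "finite_dimensional s M \<longleftrightarrow> (\<exists>B. finite B \<and> B \<subseteq> M \<and> M \<subseteq> module.span s B)"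

definition has_hypercyclic_subspace ::
  "('k::comm_ring_1 \<Rightarrow> 'v::ab_group_add \<Rightarrow> 'v) \<Rightarrow> 'v set \<Rightarrow> ('v \<Rightarrow> real) \<Rightarrow> ('v \<Rightarrow> 'v) \<Rightarrow> bool" where
  "has_hypercyclic_subspace s X N T \<longleftrightarrow>
     bounded_operator s X N T \<and>
     (\<exists>M. M \<subseteq> X \<and> module.subspace s M \<and> closedin (norm_topology X N) M \<and>
          \<not> finite_dimensional s M \<and>
          (\<forall>x\<in>M. x \<noteq> 0 \<longrightarrow> hypercyclic_vector X N T x))"


section \<open>The spaces \<open>\<ell>\<^sup>p\<^sub>a\<^sub>,\<^sub>b\<close> and the weighted backward shift\<close>

text \<open>
  A function on the unit disc is encoded as a function on \<open>\<complex>\<close> that vanishes off the disc, so that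
  equality and the pointwise operations are those of functions on the disc.
\<close>

definition fun_scale :: "complex \<Rightarrow> (complex \<Rightarrow> complex) \<Rightarrow> (complex \<Rightarrow> complex)" where
  "fun_scale c f = (\<lambda>z. c * f z)"

definition basis_fun :: "(nat \<Rightarrow> complex) \<Rightarrow> (nat \<Rightarrow> complex) \<Rightarrow> nat \<Rightarrow> complex \<Rightarrow> complex" where
  "basis_fun a b n z = (a n + b n * z) * z ^ n"

definition lp_expansion ::
  "real \<Rightarrow> (nat \<Rightarrow> complex) \<Rightarrow> (nat \<Rightarrow> complex) \<Rightarrow> (complex \<Rightarrow> complex) \<Rightarrow> (nat \<Rightarrow> complex) \<Rightarrow> bool" where
  "lp_expansion p a b f l \<longleftrightarrow>
     summable (\<lambda>n. norm (l n) powr p) \<and>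
     (\<forall>z\<in>ball 0 1. (\<lambda>n. l n * basis_fun a b n z) sums f z)"

definition lp_ab :: "real \<Rightarrow> (nat \<Rightarrow> complex) \<Rightarrow> (nat \<Rightarrow> complex) \<Rightarrow> (complex \<Rightarrow> complex) set" where
  "lp_ab p a b =
     {f. f analytic_on ball 0 1 \<and> (\<forall>z. z \<notin> ball 0 1 \<longrightarrow> f z = 0) \<and> (\<exists>l. lp_expansion p a b f l)}"

text \<open>
  The coefficient sequence is unique when all \<open>a n\<close> are nonzero and
  \<open>\<Sum>n. ((\<bar>a n\<bar> + \<bar>b n\<bar>) * \<bar>z\<bar> ^ n) powr q\<close> converges on the disc for the conjugate exponent \<open>q\<close>:
  the series then rearranges to a power series, whose coefficients \<open>l n * a n + l (n-1) * b (n-1)\<close>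
  determine \<open>l\<close>.
\<close>

definition lp_ab_norm :: "real \<Rightarrow> (nat \<Rightarrow> complex) \<Rightarrow> (nat \<Rightarrow> complex) \<Rightarrow> (complex \<Rightarrow> complex) \<Rightarrow> real" where
  "lp_ab_norm p a b f =
     (\<Sum>n. norm ((THE l. lp_expansion p a b f l) n) powr p) powr (1 / p)"

definition weighted_backward_shift :: "(nat \<Rightarrow> complex) \<Rightarrow> (complex \<Rightarrow> complex) \<Rightarrow> (complex \<Rightarrow> complex)" where
  "weighted_backward_shift w f =
     (\<lambda>z. if z \<in> ball 0 1
          then (\<Sum>n. w (Suc n) * fps_nth (fps_expansion f 0) (Suc n) * z ^ n)
          else 0)"

end

theory Submission
  imports Defs
begin

text \<open>
  In the coordinates \<open>f = (\<Sum>n. x n * f\<^sub>n)\<close>, where \<open>f\<^sub>n = basis_fun a b n\<close>, the operator \<open>B\<^sub>w\<close> becomes \<open>T = S + K\<close>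
  on \<open>\<ell>\<^sup>p\<close>: \<open>S\<close> is the weighted backward shift with weights \<open>w (n+1) * a (n+1) / a n\<close>, and \<open>K\<close>, which
  comes from re-expanding \<open>\<gamma> n * a n * z ^ n\<close> in the basis, is compact because \<open>\<gamma> n \<longlonglongrightarrow> 0\<close>.

  If for some \<open>m\<close> all products of \<open>m\<close> consecutive weights exceed some \<open>\<rho> > 1\<close>, then \<open>T\<^sup>m\<close> expands vectors
  supported far out, and a gliding hump yields in every closed infinite-dimensional subspace a vector
  whose orbit stays away from \<open>0\<close>. Otherwise there are arbitrarily large \<open>j\<close> with
  \<open>T\<^sup>m f\<^sub>j\<close> bounded for all \<open>m\<close> up to any prescribed bound. Interleaving such \<open>j\<^sub>0 < n\<^sub>0 < j\<^sub>1 < n\<^sub>1 < \<cdots>\<close>, one perturbs the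
  \<open>f\<^sub>j\<close>, \<open>j = j\<^sub>i\<close>, by small vectors that \<open>T\<close> maps at the times \<open>n\<^sub>s\<close> to members of a dense sequence; the
  perturbed vectors span a hypercyclic subspace.
\<close>

section \<open>Sequence spaces\<close>

text \<open>Two coordinate systems are needed because each shows half of the picture. In Taylor
  coefficients every power of the shift is an explicit reweighted translation, so its kernel and a
  right inverse are known exactly, but the norm is invisible. In basis coordinates the norm is that
  of l^p, but powers of T have no closed form. The bridge is the inversion of a bidiagonal matrix
  with subdiagonal entries \<open>b k / a (k+1)\<close>; it is bounded on l^p because these ratios
  are eventually below some r < 1.

  The numbers |w_1 ... w_n a_n| bound the coordinate at 0 of any orbit, so they must be unbounded;
  conversely, large values give small preimages under the n-th power. The second condition concerns
  S alone. The difficulty in the construction is that an index can be kept slow only up to a time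
  fixed in advance, while the times with small preimages cannot be prescribed. Choosing indices and
  times alternately resolves this: at time \<open>n\<^sub>s\<close> the operator kills the f_j
  chosen before and stays bounded on the span of those chosen after.\<close>

lemma powr_convex_combination:
  fixes p :: real
  assumes p: "1 \<le> p" and "0 \<le> u" "0 \<le> v" "u + v = 1" "0 \<le> x" "0 \<le> y"
  shows "(u * x + v * y) powr p \<le> u * x powr p + v * y powr p"
proof -
  \<comment> \<open>With one argument equal to 0 the claim reduces to
    \<open>c powr p \<le> c\<close> for c in [0,1].\<close>
  have scale: "(c * z) powr p \<le> c * z powr p" if "0 \<le> c" "c \<le> 1" "0 \<le> z" for c z :: real
  proof -
    have "c powr p \<le> c"
    proof (cases "c = 0")
      case False
      with that have "c powr p \<le> c powr 1"
        using p powr_mono' [of 1 p c] by simp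
      with that show ?thesis by simp
    qed (use p in simp)
    then show ?thesis
      using that by (simp add: powr_mult mult_right_mono)
  qed
  consider "x = 0" | "y = 0" | "0 < x" "0 < y" using assms by linarith
  then show ?thesis
  proof cases
    case 3
    have u: "u = 1 - v" using assms by simp
    show ?thesis
      unfolding u using convex_onD [OF powr_convex [OF p], of v x y] assms 3 by simp
  qed (use scale [of u x] scale [of v y] assms in auto)
qed

definition lp_seq :: "real \<Rightarrow> (nat \<Rightarrow> complex) set" where
  "lp_seq p = {x. summable (\<lambda>n. norm (x n) powr p)}"

definition lp_norm :: "real \<Rightarrow> (nat \<Rightarrow> complex) \<Rightarrow> real" where
  "lp_norm p x = (\<Sum>n. norm (x n) powr p) powr (1 / p)"

text \<open>Estimates are made on finite index sets, where summability is no issue, and are carried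
  to whole sequences by \<open>lp_norm_leI\<close>.\<close>

definition lp_norm_on :: "real \<Rightarrow> nat set \<Rightarrow> (nat \<Rightarrow> complex) \<Rightarrow> real" where
  "lp_norm_on p A x = (\<Sum>n\<in>A. norm (x n) powr p) powr (1 / p)"

definition seq_scale :: "complex \<Rightarrow> (nat \<Rightarrow> complex) \<Rightarrow> (nat \<Rightarrow> complex)" where
  "seq_scale c x = (\<lambda>n. c * x n)"

lemma seq_scale_apply [simp]: "seq_scale c x n = c * x n"
  by (simp add: seq_scale_def)

lemma vector_space_seq_scale: "vector_space seq_scale"
  by unfold_locales (auto simp: fun_eq_iff algebra_simps)

lemma sum_fun_apply [simp]: "(\<Sum>i\<in>A. f i) x = (\<Sum>i\<in>A. f i x)" for f :: "'i \<Rightarrow> 'a \<Rightarrow> 'b::comm_monoid_add"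
  by (induction A rule: infinite_finite_induct) auto

locale lp_space =
  fixes p :: real
  assumes p: "1 \<le> p"
begin

lemma p_pos [simp]: "0 < p" "p \<noteq> 0" "0 \<le> p" "\<not> p < 0" "\<not> p \<le> 0"
  using p by auto

lemma powr_inverse_le_iff: "0 \<le> s \<Longrightarrow> 0 \<le> C \<Longrightarrow> s powr (1 / p) \<le> C \<longleftrightarrow> s \<le> C powr p"
  using powr_mono2 [of p "s powr (1 / p)" C] powr_mono2 [of "1 / p" s "C powr p"] by (auto simp: powr_powr)

lemma lp_norm_on_nonneg [simp]: "0 \<le> lp_norm_on p A x"
  by (simp add: lp_norm_on_def)

lemma lp_norm_nonneg [simp]: "0 \<le> lp_norm p x"
  by (simp add: lp_norm_def)

lemma lp_norm_on_powr: "lp_norm_on p A x powr p = (\<Sum>n\<in>A. norm (x n) powr p)"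
  by (simp add: lp_norm_on_def powr_powr sum_nonneg)

lemma lp_norm_on_le_iff:
  "0 \<le> C \<Longrightarrow> lp_norm_on p A x \<le> C \<longleftrightarrow> (\<Sum>n\<in>A. norm (x n) powr p) \<le> C powr p"
  unfolding lp_norm_on_def by (intro powr_inverse_le_iff sum_nonneg) auto

lemma lp_norm_on_mono:
  assumes "finite B" "A \<subseteq> B" "\<And>i. i \<in> A \<Longrightarrow> norm (x i) \<le> norm (y i)"
  shows "lp_norm_on p A x \<le> lp_norm_on p B y"
proof -
  have "(\<Sum>n\<in>A. norm (x n) powr p) \<le> (\<Sum>n\<in>A. norm (y n) powr p)"
    using assms by (intro sum_mono powr_mono2) auto
  also have "\<dots> \<le> (\<Sum>n\<in>B. norm (y n) powr p)"
    using assms by (intro sum_mono2) auto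
  finally show ?thesis
    unfolding lp_norm_on_def by (intro powr_mono2) (auto intro: sum_nonneg)
qed

lemma lp_norm_on_cong: "(\<And>i. i \<in> A \<Longrightarrow> norm (x i) = norm (y i)) \<Longrightarrow> lp_norm_on p A x = lp_norm_on p A y"
  unfolding lp_norm_on_def by simp

lemma lp_norm_on_empty [simp]: "lp_norm_on p {} x = 0"
  by (simp add: lp_norm_on_def)

lemma norm_le_lp_norm_on: "finite A \<Longrightarrow> i \<in> A \<Longrightarrow> norm (x i) \<le> lp_norm_on p A x"
  using lp_norm_on_mono [of A "{i}" x x] by (simp add: lp_norm_on_def powr_powr)

lemma lp_norm_on_eq_0: "(\<And>i. i \<in> A \<Longrightarrow> x i = 0) \<Longrightarrow> lp_norm_on p A x = 0"
  unfolding lp_norm_on_def by simp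

lemma lp_norm_on_scale: "lp_norm_on p A (\<lambda>i. c * x i) = norm c * lp_norm_on p A x"
  by (simp add: lp_norm_on_def norm_mult powr_mult powr_powr sum_nonneg flip: sum_distrib_left)

text \<open>Minkowski's inequality by convexity: with \<open>X\<close>, \<open>Y\<close> bounding the two norms,
  \<open>(x + y) / (X + Y)\<close> is a convex combination of \<open>x / X\<close> and \<open>y / Y\<close>.\<close>

lemma lp_norm_on_triangle:
  "lp_norm_on p A (\<lambda>i. x i + y i) \<le> lp_norm_on p A x + lp_norm_on p A y"
proof -
  \<comment> \<open>Strict bounds make X and Y positive, so vanishing norms need no separate case;
    \<open>field_le_epsilon\<close> removes the slack afterwards.\<close>
  have bound: "lp_norm_on p A (\<lambda>i. x i + y i) \<le> X + Y"
    if X: "lp_norm_on p A x < X" and Y: "lp_norm_on p A y < Y" for X Y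
  proof -
    have pos: "0 < X" "0 < Y"
      using X Y lp_norm_on_nonneg by (smt (verit))+
    define u v where "u = X / (X + Y)" and "v = Y / (X + Y)"
    have uv: "0 \<le> u" "0 \<le> v" "u + v = 1"
      using pos by (auto simp: u_def v_def simp flip: add_divide_distrib)
    have pt: "norm (x i + y i) powr p \<le> (X + Y) powr p * (u * (norm (x i) / X) powr p + v * (norm (y i) / Y) powr p)"
      for i
    proof -
      have "norm (x i + y i) powr p \<le> (norm (x i) + norm (y i)) powr p"
        by (intro powr_mono2) (auto simp: norm_triangle_ineq)
      also have "norm (x i) + norm (y i) = (X + Y) * (u * (norm (x i) / X) + v * (norm (y i) / Y))"
      proof -
        have "(X + Y) * (u * (norm (x i) / X)) = norm (x i)" "(X + Y) * (v * (norm (y i) / Y)) = norm (y i)"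
          using pos by (simp_all add: u_def v_def)
        then show ?thesis by (simp only: distrib_left)
      qed
      also have "\<dots> powr p = (X + Y) powr p * (u * (norm (x i) / X) + v * (norm (y i) / Y)) powr p"
        using pos uv by (intro powr_mult)
      also have "\<dots> \<le> (X + Y) powr p * (u * (norm (x i) / X) powr p + v * (norm (y i) / Y) powr p)"
        using pos uv by (intro mult_left_mono powr_convex_combination p) auto
      finally show ?thesis .
    qed
    have one: "(\<Sum>i\<in>A. (norm (z i) / Z) powr p) \<le> 1" if "lp_norm_on p A z < Z" "0 < Z" for z Z
    proof -
      have "(\<Sum>i\<in>A. norm (z i) powr p) \<le> Z powr p"
        using that lp_norm_on_le_iff [of Z A z] by simp
      then show ?thesis
        using that by (simp add: powr_divide flip: sum_divide_distrib)
    qed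
    have "(\<Sum>i\<in>A. norm (x i + y i) powr p)
        \<le> (\<Sum>i\<in>A. (X + Y) powr p * (u * (norm (x i) / X) powr p + v * (norm (y i) / Y) powr p))"
      by (intro sum_mono pt)
    also have "\<dots> = (X + Y) powr p * (u * (\<Sum>i\<in>A. (norm (x i) / X) powr p) + v * (\<Sum>i\<in>A. (norm (y i) / Y) powr p))"
      by (simp add: sum_distrib_left sum.distrib distrib_left)
    also have "\<dots> \<le> (X + Y) powr p * (u * 1 + v * 1)"
      using uv one [OF X] one [OF Y] pos by (intro mult_left_mono add_mono) auto
    finally show ?thesis
      using pos uv by (subst lp_norm_on_le_iff) auto
  qed
  show ?thesis
  proof (rule field_le_epsilon)
    fix e :: real assume "0 < e"
    then show "lp_norm_on p A (\<lambda>i. x i + y i) \<le> lp_norm_on p A x + lp_norm_on p A y + e"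
      using bound [of "lp_norm_on p A x + e / 2" "lp_norm_on p A y + e / 2"] by simp
  qed
qed

lemma lp_norm_on_sum:
  "lp_norm_on p A (\<lambda>i. \<Sum>s\<in>I. g s i) \<le> (\<Sum>s\<in>I. lp_norm_on p A (g s))"
proof (induction I rule: infinite_finite_induct)
  case (insert s I)
  then show ?case
    using lp_norm_on_triangle [of A "g s" "\<lambda>i. \<Sum>s\<in>I. g s i"] by simp
qed (simp_all add: lp_norm_on_eq_0)

lemma lp_norm_powr: "lp_norm p x powr p = (\<Sum>n. norm (x n) powr p)"
  if "x \<in> lp_seq p"
  using that by (simp add: lp_norm_def lp_seq_def powr_powr suminf_nonneg)

lemma lp_norm_on_le_lp_norm:
  assumes "x \<in> lp_seq p" "finite A"
  shows "lp_norm_on p A x \<le> lp_norm p x"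
  using assms by (subst lp_norm_on_le_iff) (auto simp: lp_norm_powr lp_seq_def intro!: sum_le_suminf)

text \<open>Partial sums of nonnegative terms increase, so one uniform bound on initial segments
  gives membership and the norm estimate together.\<close>

lemma lp_norm_leI:
  assumes "\<And>n. lp_norm_on p {..<n} x \<le> C"
  shows "x \<in> lp_seq p" "lp_norm p x \<le> C"
proof -
  have C: "0 \<le> C" using assms [of 0] by simp
  have le: "(\<Sum>k<n. norm (x k) powr p) \<le> C powr p" for n
    using assms [of n] C by (simp add: lp_norm_on_le_iff)
  have sm: "summable (\<lambda>n. norm (x n) powr p)"
    by (rule summableI_nonneg_bounded [OF _ le]) simp
  then show "x \<in> lp_seq p" by (simp add: lp_seq_def)
  have "(\<Sum>n. norm (x n) powr p) \<le> C powr p"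
    by (rule suminf_le_const [OF sm le])
  then show "lp_norm p x \<le> C"
    unfolding lp_norm_def using C sm by (subst powr_inverse_le_iff) (auto intro: suminf_nonneg)
qed

lemma norm_le_lp_norm: "x \<in> lp_seq p \<Longrightarrow> norm (x i) \<le> lp_norm p x"
  using norm_le_lp_norm_on [of "{i}" i x] lp_norm_on_le_lp_norm [of x "{i}"] by simp

lemma lp_seq_dominated:
  assumes "y \<in> lp_seq p" "0 \<le> c" "\<And>i. norm (x i) \<le> c * norm (y i)"
  shows "x \<in> lp_seq p" "lp_norm p x \<le> c * lp_norm p y"
proof -
  have "lp_norm_on p {..<n} x \<le> c * lp_norm p y" for n
  proof -
    have "lp_norm_on p {..<n} x \<le> lp_norm_on p {..<n} (\<lambda>i. of_real c * y i)"
      using assms by (intro lp_norm_on_mono) (auto simp: norm_mult)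
    also have "\<dots> = c * lp_norm_on p {..<n} y"
      using assms by (simp add: lp_norm_on_scale)
    also have "\<dots> \<le> c * lp_norm p y"
      using assms by (intro mult_left_mono lp_norm_on_le_lp_norm) auto
    finally show ?thesis .
  qed
  from lp_norm_leI [OF this] show "x \<in> lp_seq p" "lp_norm p x \<le> c * lp_norm p y" by auto
qed

lemma lp_seq_add:
  assumes "x \<in> lp_seq p" "y \<in> lp_seq p"
  shows "x + y \<in> lp_seq p" "lp_norm p (x + y) \<le> lp_norm p x + lp_norm p y"
proof -
  have "lp_norm_on p {..<n} (x + y) \<le> lp_norm p x + lp_norm p y" for n
    using lp_norm_on_triangle [of "{..<n}" x y] lp_norm_on_le_lp_norm [OF assms(1), of "{..<n}"]
      lp_norm_on_le_lp_norm [OF assms(2), of "{..<n}"] by (simp add: plus_fun_def)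
  from lp_norm_leI [OF this] show "x + y \<in> lp_seq p" "lp_norm p (x + y) \<le> lp_norm p x + lp_norm p y"
    by auto
qed

lemma lp_norm_scale: "lp_norm p (seq_scale c x) = norm c * lp_norm p x" if "x \<in> lp_seq p"
  using that unfolding lp_norm_def lp_seq_def
  by (simp add: norm_mult powr_mult suminf_mult powr_powr suminf_nonneg)

lemma lp_seq_scale: "x \<in> lp_seq p \<Longrightarrow> seq_scale c x \<in> lp_seq p"
  using lp_seq_dominated(1) [of x "norm c" "seq_scale c x"] by (simp add: norm_mult)

lemma lp_norm_uminus [simp]: "lp_norm p (- x) = lp_norm p x"
  by (simp add: lp_norm_def)

lemma lp_norm_minus_commute: "lp_norm p (x - y) = lp_norm p (y - x)"
  using lp_norm_uminus [of "x - y"] by simp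

lemma lp_seq_uminus [simp]: "- x \<in> lp_seq p \<longleftrightarrow> x \<in> lp_seq p"
  by (simp add: lp_seq_def)

lemma lp_seq_diff:
  assumes "x \<in> lp_seq p" "y \<in> lp_seq p"
  shows "x - y \<in> lp_seq p" "lp_norm p (x - y) \<le> lp_norm p x + lp_norm p y"
  using lp_seq_add [of x "- y"] assms by auto

lemma lp_norm_triangle_diff:
  assumes "x \<in> lp_seq p" "y \<in> lp_seq p" "z \<in> lp_seq p"
  shows "lp_norm p (x - z) \<le> lp_norm p (x - y) + lp_norm p (y - z)"
  using lp_seq_add(2) [of "x - y" "y - z"] assms by (simp add: lp_seq_diff)

lemma lp_norm_triangle_rev:
  assumes "x \<in> lp_seq p" "y \<in> lp_seq p"
  shows "lp_norm p x - lp_norm p y \<le> lp_norm p (x - y)"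
  using lp_seq_add(2) [of "x - y" y] assms by (simp add: lp_seq_diff)

lemma lp_seq_zero [simp]: "0 \<in> lp_seq p" "lp_norm p 0 = 0"
  by (auto simp: lp_seq_def lp_norm_def)

lemma lp_norm_eq_0_iff: "x \<in> lp_seq p \<Longrightarrow> lp_norm p x = 0 \<longleftrightarrow> x = 0"
  using norm_le_lp_norm [of x] by (auto simp: fun_eq_iff lp_norm_def)

lemma subspace_lp_seq: "module.subspace seq_scale (lp_seq p)"
proof -
  interpret vector_space seq_scale by (rule vector_space_seq_scale)
  show ?thesis by (rule subspaceI) (auto simp: lp_seq_add lp_seq_scale)
qed

text \<open>Minkowski's inequality for the decomposition into one-coordinate vectors. The crude l^1
  bound serves wherever only finitely many coordinates matter.\<close>

lemma lp_norm_le_sum: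
  assumes "\<And>i. i \<ge> n \<Longrightarrow> x i = 0"
  shows "x \<in> lp_seq p" "lp_norm p x \<le> (\<Sum>i<n. norm (x i))"
proof -
  have "lp_norm_on p {..<m} x \<le> (\<Sum>i<n. norm (x i))" for m
  proof -
    have unit: "lp_norm_on p {..<m} (\<lambda>k. if k = i then x i else 0) \<le> norm (x i)" for i
    proof -
      have "(\<Sum>k<m. norm (if k = i then x i else 0) powr p) \<le> norm (x i) powr p"
        by (simp add: if_distrib [of norm] if_distrib [of "\<lambda>t. t powr p"] sum.delta cong: if_cong)
      then show ?thesis by (subst lp_norm_on_le_iff) auto
    qed
    have "lp_norm_on p {..<m} x = lp_norm_on p {..<m} (\<lambda>k. \<Sum>i<n. if k = i then x i else 0)"
      using assms by (intro lp_norm_on_cong arg_cong [where f = norm]) (auto simp: sum.delta not_less)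
    also have "\<dots> \<le> (\<Sum>i<n. lp_norm_on p {..<m} (\<lambda>k. if k = i then x i else 0))"
      by (rule lp_norm_on_sum)
    also have "\<dots> \<le> (\<Sum>i<n. norm (x i))"
      by (intro sum_mono unit)
    finally show ?thesis .
  qed
  from lp_norm_leI [OF this] show "x \<in> lp_seq p" "lp_norm p x \<le> (\<Sum>i<n. norm (x i))" by auto
qed

text \<open>A Fatou-type principle: norms over finite sets are continuous in the coordinates, so
  coordinatewise convergence is enough. Infinite sums and limits of Cauchy sequences enter the space
  through it.\<close>

lemma lp_norm_le_limit:
  assumes conv: "\<And>i. (\<lambda>s. g s i) \<longlonglongrightarrow> x i"
    and bound: "\<And>n. \<forall>\<^sub>F s in sequentially. lp_norm_on p {..<n} (g s) \<le> C"
  shows "x \<in> lp_seq p" "lp_norm p x \<le> C"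
proof -
  have "lp_norm_on p {..<n} x \<le> C" for n
  proof (rule tendsto_upperbound)
    show "(\<lambda>s. lp_norm_on p {..<n} (g s)) \<longlonglongrightarrow> lp_norm_on p {..<n} x"
      unfolding lp_norm_on_def using conv
      by (intro tendsto_powr' tendsto_sum tendsto_norm tendsto_const) (auto intro!: always_eventually sum_nonneg)
  qed (auto simp: bound)
  from lp_norm_leI [OF this] show "x \<in> lp_seq p" "lp_norm p x \<le> C" by auto
qed

lemma lp_seq_suminf:
  assumes "\<And>s. g s \<in> lp_seq p" "summable (\<lambda>s. lp_norm p (g s))"
  shows "\<And>i. summable (\<lambda>s. g s i)" "(\<lambda>i. \<Sum>s. g s i) \<in> lp_seq p"
    "lp_norm p (\<lambda>i. \<Sum>s. g s i) \<le> (\<Sum>s. lp_norm p (g s))"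
proof -
  show sm: "summable (\<lambda>s. g s i)" for i
    by (rule summable_comparison_test' [OF assms(2), of 0]) (simp add: norm_le_lp_norm assms)
  have "lp_norm_on p {..<n} (\<lambda>i. \<Sum>s<m. g s i) \<le> (\<Sum>s. lp_norm p (g s))" for n m
  proof -
    have "lp_norm_on p {..<n} (\<lambda>i. \<Sum>s<m. g s i) \<le> (\<Sum>s<m. lp_norm_on p {..<n} (g s))"
      by (rule lp_norm_on_sum)
    also have "\<dots> \<le> (\<Sum>s<m. lp_norm p (g s))"
      by (intro sum_mono lp_norm_on_le_lp_norm assms) auto
    also have "\<dots> \<le> (\<Sum>s. lp_norm p (g s))"
      using assms by (intro sum_le_suminf) auto
    finally show ?thesis .
  qed
  note * = lp_norm_le_limit [OF summable_LIMSEQ [OF sm] always_eventually, OF allI, OF this]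
  show "(\<lambda>i. \<Sum>s. g s i) \<in> lp_seq p" "lp_norm p (\<lambda>i. \<Sum>s. g s i) \<le> (\<Sum>s. lp_norm p (g s))"
    by (fact *)+
qed

text \<open>Coordinatewise convergence is part of the conclusion because it shows that a limit keeps
  its support in a given index set.\<close>

lemma lp_seq_complete:
  assumes mem: "\<And>n. u n \<in> lp_seq p"
    and cauchy: "\<And>e. 0 < e \<Longrightarrow> \<exists>N. \<forall>m\<ge>N. \<forall>n\<ge>N. lp_norm p (u m - u n) \<le> e"
  obtains x where "x \<in> lp_seq p" "\<And>i. (\<lambda>n. u n i) \<longlonglongrightarrow> x i"
    "(\<lambda>n. lp_norm p (u n - x)) \<longlonglongrightarrow> 0"
proof -
  have "Cauchy (\<lambda>n. u n i)" for i
  proof (rule CauchyI)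
    fix e :: real assume "0 < e"
    then obtain N where N: "\<forall>m\<ge>N. \<forall>n\<ge>N. lp_norm p (u m - u n) \<le> e / 2"
      using cauchy [of "e / 2"] by auto
    have "norm (u m i - u n i) < e" if "m \<ge> N" "n \<ge> N" for m n
    proof -
      have "norm (u m i - u n i) \<le> lp_norm p (u m - u n)"
        using norm_le_lp_norm [of "u m - u n" i] mem by (simp add: lp_seq_diff)
      also have "\<dots> \<le> e / 2" using N that by blast
      finally show ?thesis using \<open>0 < e\<close> by simp
    qed
    then show "\<exists>M. \<forall>m\<ge>M. \<forall>n\<ge>M. norm (u m i - u n i) < e" by blast
  qed
  then have "\<forall>i. \<exists>l. (\<lambda>n. u n i) \<longlonglongrightarrow> l"
    by (simp add: Cauchy_convergent_iff convergent_def)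
  then obtain x where x: "\<And>i. (\<lambda>n. u n i) \<longlonglongrightarrow> x i" by metis
  have near: "u m - x \<in> lp_seq p \<and> lp_norm p (u m - x) \<le> e"
    if "\<forall>m\<ge>N. \<forall>n\<ge>N. lp_norm p (u m - u n) \<le> e" "m \<ge> N" for e m N
  proof -
    have "\<forall>\<^sub>F n in sequentially. lp_norm_on p {..<k} (u m - u n) \<le> e" for k
      using eventually_ge_at_top [of N]
    proof eventually_elim
      case (elim n)
      have "lp_norm_on p {..<k} (u m - u n) \<le> lp_norm p (u m - u n)"
        using mem by (intro lp_norm_on_le_lp_norm lp_seq_diff) auto
      also have "\<dots> \<le> e" using that elim by blast
      finally show ?case .
    qed
    moreover have "(\<lambda>n. (u m - u n) i) \<longlonglongrightarrow> (u m - x) i" for i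
      using x by (auto intro: tendsto_intros)
    ultimately show ?thesis
      using lp_norm_le_limit [of "\<lambda>n. u m - u n" "u m - x" e] by blast
  qed
  obtain N where "\<forall>m\<ge>N. \<forall>n\<ge>N. lp_norm p (u m - u n) \<le> 1" using cauchy [of 1] by auto
  from near [OF this order_refl] have "u N - x \<in> lp_seq p" by simp
  then have "x \<in> lp_seq p"
    using lp_seq_diff(1) [of "u N" "u N - x"] mem by simp
  moreover have "(\<lambda>n. lp_norm p (u n - x)) \<longlonglongrightarrow> 0"
  proof (rule LIMSEQ_I)
    fix r :: real assume "0 < r"
    then obtain N where N: "\<forall>m\<ge>N. \<forall>n\<ge>N. lp_norm p (u m - u n) \<le> r / 2"
      using cauchy [of "r / 2"] by auto
    show "\<exists>no. \<forall>n\<ge>no. norm (lp_norm p (u n - x) - 0) < r"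
    proof (intro exI allI impI)
      fix n assume "N \<le> n"
      with near [OF N] \<open>0 < r\<close> show "norm (lp_norm p (u n - x) - 0) < r" by force
    qed
  qed
  ultimately show ?thesis using that x by blast
qed

lemma lp_norm_tail:
  assumes "x \<in> lp_seq p" "0 < e"
  obtains N where "\<And>A. finite A \<Longrightarrow> A \<subseteq> {N..} \<Longrightarrow> lp_norm_on p A x \<le> e"
proof -
  have "summable (\<lambda>n. norm (x n) powr p)"
    using assms by (simp add: lp_seq_def)
  then obtain N where N: "\<And>m n. m \<ge> N \<Longrightarrow> norm (\<Sum>k=m..<n. norm (x k) powr p) < e powr p"
    using assms(2) by (force simp: summable_Cauchy)
  show ?thesis
  proof (rule that)
    fix A assume A: "finite A" "A \<subseteq> {N..}"
    have "A \<subseteq> {N..<Suc (Max A)}"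
      using A by (auto simp: less_Suc_eq_le)
    then have "(\<Sum>k\<in>A. norm (x k) powr p) \<le> (\<Sum>k=N..<Suc (Max A). norm (x k) powr p)"
      by (intro sum_mono2) auto
    also have "\<dots> \<le> e powr p"
      using N [of N "Suc (Max A)"] by (auto simp: abs_less_iff intro: less_imp_le)
    finally show "lp_norm_on p A x \<le> e"
      using assms by (subst lp_norm_on_le_iff) auto
  qed
qed

lemma lp_norm_truncate:
  assumes "x \<in> lp_seq p" "0 < e"
  obtains N where "\<And>M. N \<le> M \<Longrightarrow> lp_norm p (\<lambda>i. if i < M then 0 else x i) \<le> e"
proof -
  obtain N where N: "\<And>A. finite A \<Longrightarrow> A \<subseteq> {N..} \<Longrightarrow> lp_norm_on p A x \<le> e"
    using lp_norm_tail [OF assms] by blast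
  show ?thesis
  proof (rule that, rule lp_norm_leI)
    fix M n assume "N \<le> M"
    have "lp_norm_on p {..<n} (\<lambda>i. if i < M then 0 else x i) = lp_norm_on p ({..<n} \<inter> {M..}) x"
      unfolding lp_norm_on_def by (intro arg_cong2 [where f = "(powr)"] sum.mono_neutral_cong_right) auto
    also have "\<dots> \<le> e" using \<open>N \<le> M\<close> by (intro N) auto
    finally show "lp_norm_on p {..<n} (\<lambda>i. if i < M then 0 else x i) \<le> e" .
  qed
qed

lemma lp_seq_shift:
  assumes "x \<in> lp_seq p"
  shows "(\<lambda>k. x (k + m)) \<in> lp_seq p" "lp_norm p (\<lambda>k. x (k + m)) \<le> lp_norm p x"
proof -
  have "lp_norm_on p {..<n} (\<lambda>k. x (k + m)) = lp_norm_on p ((\<lambda>k. k + m) ` {..<n}) x" for n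
    unfolding lp_norm_on_def by (subst sum.reindex) (auto simp: inj_on_def)
  then have "lp_norm_on p {..<n} (\<lambda>k. x (k + m)) \<le> lp_norm p x" for n
    using lp_norm_on_le_lp_norm assms by simp
  from lp_norm_leI [OF this] show "(\<lambda>k. x (k + m)) \<in> lp_seq p" "lp_norm p (\<lambda>k. x (k + m)) \<le> lp_norm p x"
    by auto
qed

lemma lp_norm_shift_eq:
  assumes "x \<in> lp_seq p" "\<And>i. i < m \<Longrightarrow> x i = 0"
  shows "lp_norm p (\<lambda>k. x (k + m)) = lp_norm p x"
  using assms unfolding lp_norm_def lp_seq_def
  by (subst suminf_split_initial_segment [where k = m and f = "\<lambda>n. norm (x n) powr p"]) auto

end

section \<open>Hypercyclic subspaces and isometries\<close>

lemma finite_dimensional_linear_image: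
  assumes s: "vector_space s" and s': "vector_space s'"
    and X: "module.subspace s X" and M: "M \<subseteq> X" and inj: "inj_on \<Phi> X"
    and add: "\<And>x y. x \<in> X \<Longrightarrow> y \<in> X \<Longrightarrow> \<Phi> (x + y) = \<Phi> x + \<Phi> y"
    and scale: "\<And>c x. x \<in> X \<Longrightarrow> \<Phi> (s c x) = s' c (\<Phi> x)"
    and fin: "finite_dimensional s' (\<Phi> ` M)"
  shows "finite_dimensional s M"
proof -
  interpret V: vector_space s by fact
  interpret V': vector_space s' by fact
  obtain B where B: "finite B" "B \<subseteq> \<Phi> ` M" "\<Phi> ` M \<subseteq> V'.span B"
    using fin by (auto simp: finite_dimensional_def)
  then obtain B0 where B0: "B0 \<subseteq> M" "finite B0" "B = \<Phi> ` B0"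
    by (metis finite_subset_image)
  \<comment> \<open>\<open>\<Phi>\<close> is linear and injective on \<open>X\<close> only, so the
    span of the preimages must lie in \<open>X\<close> before either property can be applied to
    it.\<close>
  have span_X: "V.span B0 \<subseteq> X"
    using B0 M X by (intro V.span_minimal) auto
  have "V'.subspace (\<Phi> ` V.span B0)"
  proof (rule V'.subspaceI)
    have "\<Phi> (s 0 0) = s' 0 (\<Phi> 0)"
      using X V.subspace_0 by (intro scale) auto
    then show "0 \<in> \<Phi> ` V.span B0"
      using V.span_zero [of B0] by (metis V.scale_zero_left V'.scale_zero_left imageI)
  next
    fix x y assume "x \<in> \<Phi> ` V.span B0" "y \<in> \<Phi> ` V.span B0"
    then obtain x' y' where "x = \<Phi> x'" "y = \<Phi> y'" "x' \<in> V.span B0" "y' \<in> V.span B0" by auto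
    then show "x + y \<in> \<Phi> ` V.span B0"
      using add [of x' y'] span_X V.span_add [of x' B0 y'] by (metis image_eqI subsetD)
  next
    fix c x assume "x \<in> \<Phi> ` V.span B0"
    then obtain x' where "x = \<Phi> x'" "x' \<in> V.span B0" by auto
    then show "s' c x \<in> \<Phi> ` V.span B0"
      using scale [of x' c] span_X V.span_scale [of x' B0 c] by (metis image_eqI subsetD)
  qed
  then have "V'.span B \<subseteq> \<Phi> ` V.span B0"
    unfolding B0(3) by (intro V'.span_minimal) (auto intro: V.span_base)
  with B(3) have sub: "\<Phi> ` M \<subseteq> \<Phi> ` V.span B0" by blast
  have "m \<in> V.span B0" if m: "m \<in> M" for m
  proof -
    obtain m' where "m' \<in> V.span B0" "\<Phi> m = \<Phi> m'"
      using sub m by blast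
    with inj m M span_X show ?thesis by (metis inj_onD subsetD)
  qed
  with B0 show ?thesis by (auto simp: finite_dimensional_def)
qed

text \<open>A kernel has codimension at most one: a finite set spanning it, together with any v
  where \<open>\<phi>\<close> does not vanish, would span \<open>M\<close>.\<close>

lemma infinite_dimensional_kernel:
  assumes s: "vector_space s" and M: "module.subspace s M" and inf: "\<not> finite_dimensional s M"
    and add: "\<And>x y. x \<in> M \<Longrightarrow> y \<in> M \<Longrightarrow> \<phi> (x + y) = \<phi> x + \<phi> y"
    and scale: "\<And>c x. x \<in> M \<Longrightarrow> \<phi> (s c x) = c * (\<phi> x :: 'k::field)"
  shows "module.subspace s {x \<in> M. \<phi> x = 0}" "\<not> finite_dimensional s {x \<in> M. \<phi> x = 0}"
proof -
  interpret V: vector_space s by fact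
  have \<phi>0: "\<phi> 0 = 0"
    using scale [of 0 0] V.subspace_0 [OF M] by simp
  show "V.subspace {x \<in> M. \<phi> x = 0}"
    using M add scale \<phi>0 by (intro V.subspaceI) (auto intro: V.subspace_0 V.subspace_add V.subspace_scale)
  show "\<not> finite_dimensional s {x \<in> M. \<phi> x = 0}"
  proof
    assume "finite_dimensional s {x \<in> M. \<phi> x = 0}"
    then obtain B where B: "finite B" "B \<subseteq> {x \<in> M. \<phi> x = 0}" "{x \<in> M. \<phi> x = 0} \<subseteq> V.span B"
      by (auto simp: finite_dimensional_def)
    show False
    proof (cases "\<exists>v\<in>M. \<phi> v \<noteq> 0")
      case True
      then obtain v where v: "v \<in> M" "\<phi> v \<noteq> 0" by blast
      have "x \<in> V.span (insert v B)" if "x \<in> M" for x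
      proof -
        define c where "c = \<phi> x / \<phi> v"
        have "\<phi> (x + s (- c) v) = \<phi> x + (- c) * \<phi> v"
          using that v M by (simp only: add scale V.subspace_scale)
        also have "\<dots> = 0" using v by (simp add: c_def)
        finally have "\<phi> (x + s (- c) v) = 0" .
        moreover have "x + s (- c) v \<in> M"
          by (intro V.subspace_add [OF M] V.subspace_scale [OF M] that v)
        ultimately have "x + s (- c) v \<in> V.span B"
          by (intro subsetD [OF B(3)] CollectI conjI)
        then have "x + s (- c) v \<in> V.span (insert v B)"
          by (rule subsetD [OF V.span_mono, rotated]) auto
        moreover have "s c v \<in> V.span (insert v B)"
          by (intro V.span_scale V.span_base) simp
        ultimately have "x + s (- c) v + s c v \<in> V.span (insert v B)"
          by (rule V.span_add)
        then show ?thesis by (simp add: add.assoc flip: V.scale_left_distrib)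
      qed
      then have "finite_dimensional s M"
        unfolding finite_dimensional_def using B v by (intro exI [of _ "insert v B"]) auto
      with inf show False by simp
    next
      case False
      then have "{x \<in> M. \<phi> x = 0} = M" by auto
      with B inf show False by (auto simp: finite_dimensional_def)
    qed
  qed
qed

text \<open>Each functional cuts the subspace down to a kernel that is still infinite-dimensional.
  The nonzero vectors obtained this way become the humps of \<open>gliding_hump\<close>.\<close>

lemma infinite_dimensional_common_zero:
  fixes \<phi> :: "'i \<Rightarrow> 'v::ab_group_add \<Rightarrow> 'k::field"
  assumes s: "vector_space s" and M: "module.subspace s M" and inf: "\<not> finite_dimensional s M"
    and I: "finite I"
    and add: "\<And>i x y. x \<in> M \<Longrightarrow> y \<in> M \<Longrightarrow> \<phi> i (x + y) = \<phi> i x + \<phi> i y"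
    and scale: "\<And>i c x. x \<in> M \<Longrightarrow> \<phi> i (s c x) = c * \<phi> i x"
  obtains x where "x \<in> M" "x \<noteq> 0" "\<And>i. i \<in> I \<Longrightarrow> \<phi> i x = 0"
proof -
  interpret V: vector_space s by fact
  have "V.subspace {x \<in> M. \<forall>i\<in>I. \<phi> i x = 0} \<and> \<not> finite_dimensional s {x \<in> M. \<forall>i\<in>I. \<phi> i x = 0}"
    using I
  proof induction
    case empty
    then show ?case using M inf by simp
  next
    case (insert j I)
    define M' where "M' = {x \<in> M. \<forall>i\<in>I. \<phi> i x = 0}"
    have eq: "{x \<in> M. \<forall>i\<in>insert j I. \<phi> i x = 0} = {x \<in> M'. \<phi> j x = 0}"
      unfolding M'_def by blast
    have M': "V.subspace M'" "\<not> finite_dimensional s M'"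
      using insert.IH unfolding M'_def by (auto simp only:)
    have sub: "x \<in> M" if "x \<in> M'" for x using that unfolding M'_def by simp
    have "V.subspace {x \<in> M'. \<phi> j x = 0}"
      using s M' add [OF sub sub] scale [OF sub] by (rule infinite_dimensional_kernel(1))
    moreover have "\<not> finite_dimensional s {x \<in> M'. \<phi> j x = 0}"
      using s M' add [OF sub sub] scale [OF sub] by (rule infinite_dimensional_kernel(2))
    ultimately show ?case unfolding eq ..
  qed
  then have "\<not> {x \<in> M. \<forall>i\<in>I. \<phi> i x = 0} \<subseteq> V.span {}"
    unfolding finite_dimensional_def by blast
  then obtain x where "x \<in> M" "\<forall>i\<in>I. \<phi> i x = 0" "x \<noteq> 0"
    unfolding V.span_empty by blast
  then show ?thesis using that [of x] by simp
qed

lemma bounded_operator_funpow_in: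
  "bounded_operator s X N T \<Longrightarrow> x \<in> X \<Longrightarrow> (T ^^ n) x \<in> X"
  by (induction n) (auto simp: bounded_operator_def)

text \<open>Closedness and density are put in epsilon form, so that they pass through an isometry
  without any topology; boundedness of \<open>T\<close> is kept apart.\<close>

definition hypercyclic_subspace_in ::
  "('k::comm_ring_1 \<Rightarrow> 'v::ab_group_add \<Rightarrow> 'v) \<Rightarrow> 'v set \<Rightarrow> ('v \<Rightarrow> real) \<Rightarrow> ('v \<Rightarrow> 'v) \<Rightarrow> 'v set \<Rightarrow> bool" where
  "hypercyclic_subspace_in s X N T M \<longleftrightarrow>
     M \<subseteq> X \<and> module.subspace s M \<and>
     (\<forall>y\<in>X. (\<forall>e>0. \<exists>m\<in>M. N (y - m) < e) \<longrightarrow> y \<in> M) \<and>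
     \<not> finite_dimensional s M \<and>
     (\<forall>x\<in>M. x \<noteq> 0 \<longrightarrow> (\<forall>y\<in>X. \<forall>e>0. \<exists>n. N (y - (T ^^ n) x) < e))"

lemma has_hypercyclic_subspace_iff:
  assumes "Metric_space X (\<lambda>x y. N (x - y))"
  shows "has_hypercyclic_subspace s X N T \<longleftrightarrow>
    bounded_operator s X N T \<and> (\<exists>M. hypercyclic_subspace_in s X N T M)"
proof -
  interpret Metric_space X "\<lambda>x y. N (x - y)" by fact
  have closed: "closedin (norm_topology X N) M \<longleftrightarrow> (\<forall>y\<in>X. (\<forall>e>0. \<exists>m\<in>M. N (y - m) < e) \<longrightarrow> y \<in> M)"
    if "M \<subseteq> X" for M
  proof -
    have "disjnt M (mball y e) \<longleftrightarrow> \<not> (\<exists>m\<in>M. N (y - m) < e)" if "y \<in> X" for y e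
      using that \<open>M \<subseteq> X\<close> by (auto simp: disjnt_iff)
    then have "(\<forall>y. y \<in> X - M \<longrightarrow> (\<exists>e>0. disjnt M (mball y e))) \<longleftrightarrow>
        (\<forall>y. y \<in> X - M \<longrightarrow> \<not> (\<forall>e>0. \<exists>m\<in>M. N (y - m) < e))" by simp
    also have "\<dots> \<longleftrightarrow> (\<forall>y\<in>X. (\<forall>e>0. \<exists>m\<in>M. N (y - m) < e) \<longrightarrow> y \<in> M)" by blast
    finally show ?thesis
      unfolding norm_topology_def closedin_metric using that by (simp only: simp_thms)
  qed
  have dense: "hypercyclic_vector X N T x \<longleftrightarrow> (\<forall>y\<in>X. \<forall>e>0. \<exists>n. N (y - (T ^^ n) x) < e)"
    if "bounded_operator s X N T" "x \<in> X" for x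
    unfolding hypercyclic_vector_def norm_topology_def metric_closure_of in_mball
    using that bounded_operator_funpow_in [OF that] by auto
  have eq: "M \<subseteq> X \<and> module.subspace s M \<and> closedin (norm_topology X N) M \<and> \<not> finite_dimensional s M \<and>
      (\<forall>x\<in>M. x \<noteq> 0 \<longrightarrow> hypercyclic_vector X N T x) \<longleftrightarrow> hypercyclic_subspace_in s X N T M"
    if T: "bounded_operator s X N T" for M
  proof (cases "M \<subseteq> X")
    case True
    then have "(\<forall>x\<in>M. x \<noteq> 0 \<longrightarrow> hypercyclic_vector X N T x) \<longleftrightarrow>
        (\<forall>x\<in>M. x \<noteq> 0 \<longrightarrow> (\<forall>y\<in>X. \<forall>e>0. \<exists>n. N (y - (T ^^ n) x) < e))"
      using dense [OF T] by (intro ball_cong refl imp_cong) auto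
    then show ?thesis
      unfolding hypercyclic_subspace_in_def closed [OF True] by simp
  qed (simp add: hypercyclic_subspace_in_def)
  show ?thesis
    unfolding has_hypercyclic_subspace_def using eq by (intro conj_cong refl ex_cong1)
qed

text \<open>The setting is symmetric (\<open>inverse\<close>), so hypercyclic subspaces have to be
  transported in one direction only.\<close>

locale linear_isometry =
  fixes s :: "'k::field \<Rightarrow> 'v::ab_group_add \<Rightarrow> 'v" and X and N :: "'v \<Rightarrow> real" and T
    and s' :: "'k \<Rightarrow> 'w::ab_group_add \<Rightarrow> 'w" and X' and N' :: "'w \<Rightarrow> real" and T' and \<Phi> :: "'v \<Rightarrow> 'w"
  assumes vs: "vector_space s" and vs': "vector_space s'"
    and X: "module.subspace s X" and X': "module.subspace s' X'"
    and bij: "bij_betw \<Phi> X X'"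
    and add: "\<And>x y. x \<in> X \<Longrightarrow> y \<in> X \<Longrightarrow> \<Phi> (x + y) = \<Phi> x + \<Phi> y"
    and scale: "\<And>c x. x \<in> X \<Longrightarrow> \<Phi> (s c x) = s' c (\<Phi> x)"
    and isometric: "\<And>x. x \<in> X \<Longrightarrow> N' (\<Phi> x) = N x"
    and T_in: "\<And>x. x \<in> X \<Longrightarrow> T x \<in> X"
    and intertwine: "\<And>x. x \<in> X \<Longrightarrow> T' (\<Phi> x) = \<Phi> (T x)"
begin

sublocale V: vector_space s by (rule vs)
sublocale V': vector_space s' by (rule vs')

lemma image: "\<Phi> ` X = X'"
  using bij by (simp add: bij_betw_def)

lemma inj: "inj_on \<Phi> X"
  using bij by (simp add: bij_betw_def)

lemma \<Phi>_in [simp]: "x \<in> X \<Longrightarrow> \<Phi> x \<in> X'"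
  using image by blast

lemma zero: "\<Phi> 0 = 0"
  using add [of 0 0] V.subspace_0 [OF X] by simp

lemma diff: "x \<in> X \<Longrightarrow> y \<in> X \<Longrightarrow> \<Phi> (x - y) = \<Phi> x - \<Phi> y"
  using add [of "x - y" y] V.subspace_diff [OF X] by (simp add: algebra_simps)

lemma norm_diff: "x \<in> X \<Longrightarrow> y \<in> X \<Longrightarrow> N' (\<Phi> x - \<Phi> y) = N (x - y)"
  using isometric [of "x - y"] V.subspace_diff [OF X] by (simp add: diff)

lemma funpow_in: "x \<in> X \<Longrightarrow> (T ^^ n) x \<in> X"
  by (induction n) (auto simp: T_in)

lemma intertwine_funpow: "x \<in> X \<Longrightarrow> (T' ^^ n) (\<Phi> x) = \<Phi> ((T ^^ n) x)"
  by (induction n) (auto simp: intertwine funpow_in)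

lemma bounded_operator_iff: "bounded_operator s' X' N' T' \<longleftrightarrow> bounded_operator s X N T"
proof -
  have add_iff: "T' (\<Phi> x + \<Phi> y) = T' (\<Phi> x) + T' (\<Phi> y) \<longleftrightarrow> T (x + y) = T x + T y"
    if "x \<in> X" "y \<in> X" for x y
  proof -
    have "T' (\<Phi> x + \<Phi> y) = \<Phi> (T (x + y))" "T' (\<Phi> x) + T' (\<Phi> y) = \<Phi> (T x + T y)"
      using that V.subspace_add [OF X] by (simp_all add: T_in intertwine flip: add)
    then show ?thesis
      using that inj V.subspace_add [OF X] by (metis T_in inj_on_eq_iff)
  qed
  have scale_iff: "T' (s' c (\<Phi> x)) = s' c (T' (\<Phi> x)) \<longleftrightarrow> T (s c x) = s c (T x)"
    if "x \<in> X" for c x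
  proof -
    have "T' (s' c (\<Phi> x)) = \<Phi> (T (s c x))" "s' c (T' (\<Phi> x)) = \<Phi> (s c (T x))"
      using that V.subspace_scale [OF X] by (simp_all add: T_in intertwine flip: scale)
    then show ?thesis
      using that inj V.subspace_scale [OF X] by (metis T_in inj_on_eq_iff)
  qed
  show ?thesis
    unfolding bounded_operator_def image [symmetric] ball_simps
    using add_iff scale_iff by (simp add: intertwine T_in isometric)
qed

lemma hypercyclic_subspace_image:
  assumes "hypercyclic_subspace_in s X N T M"
  shows "hypercyclic_subspace_in s' X' N' T' (\<Phi> ` M)"
proof -
  have M: "M \<subseteq> X" "V.subspace M"
    and cl: "\<And>y. y \<in> X \<Longrightarrow> \<forall>e>0. \<exists>m\<in>M. N (y - m) < e \<Longrightarrow> y \<in> M"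
    and inf: "\<not> finite_dimensional s M"
    and hc: "\<And>x y e. x \<in> M \<Longrightarrow> x \<noteq> 0 \<Longrightarrow> y \<in> X \<Longrightarrow> 0 < e \<Longrightarrow> \<exists>n. N (y - (T ^^ n) x) < e"
    using assms unfolding hypercyclic_subspace_in_def by blast+
  have in_X: "x \<in> X" if "x \<in> M" for x using that M by blast
  have "V'.subspace (\<Phi> ` M)"
  proof (rule V'.subspaceI)
    show "0 \<in> \<Phi> ` M" using zero V.subspace_0 [OF M(2)] by (metis imageI)
  next
    fix x' y' assume "x' \<in> \<Phi> ` M" "y' \<in> \<Phi> ` M"
    then obtain x y where xy: "x \<in> M" "y \<in> M" "x' = \<Phi> x" "y' = \<Phi> y" by blast
    then have "x' + y' = \<Phi> (x + y)" by (simp add: add in_X)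
    then show "x' + y' \<in> \<Phi> ` M"
      using xy V.subspace_add [OF M(2)] by blast
  next
    fix c x' assume "x' \<in> \<Phi> ` M"
    then obtain x where x: "x \<in> M" "x' = \<Phi> x" by blast
    then have "s' c x' = \<Phi> (s c x)" by (simp add: scale in_X)
    then show "s' c x' \<in> \<Phi> ` M"
      using x V.subspace_scale [OF M(2)] by blast
  qed
  moreover have "\<forall>y'\<in>X'. (\<forall>e>0. \<exists>m'\<in>\<Phi> ` M. N' (y' - m') < e) \<longrightarrow> y' \<in> \<Phi> ` M"
  proof (intro ballI impI)
    fix y' assume "y' \<in> X'" and *: "\<forall>e>0. \<exists>m'\<in>\<Phi> ` M. N' (y' - m') < e"
    then obtain y where y: "y \<in> X" "y' = \<Phi> y" using image by blast
    have "\<exists>m\<in>M. N (y - m) < e" if e: "0 < e" for e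
    proof -
      obtain m where m: "m \<in> M" "N' (\<Phi> y - \<Phi> m) < e"
        using * e y by blast
      then show ?thesis using norm_diff [OF y(1) in_X [OF m(1)]] by auto
    qed
    then show "y' \<in> \<Phi> ` M" using cl y by blast
  qed
  moreover have "\<forall>x'\<in>\<Phi> ` M. x' \<noteq> 0 \<longrightarrow> (\<forall>y'\<in>X'. \<forall>e>0. \<exists>n. N' (y' - (T' ^^ n) x') < e)"
  proof (intro ballI allI impI)
    fix x' y' and e :: real assume "x' \<in> \<Phi> ` M" "x' \<noteq> 0" "y' \<in> X'" "0 < e"
    obtain x where x: "x \<in> M" "x' = \<Phi> x" using \<open>x' \<in> \<Phi> ` M\<close> by blast
    obtain y where y: "y \<in> X" "y' = \<Phi> y" using \<open>y' \<in> X'\<close> image by blast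
    have "x \<noteq> 0" using x \<open>x' \<noteq> 0\<close> zero by metis
    then obtain n where "N (y - (T ^^ n) x) < e" using hc x y \<open>0 < e\<close> by blast
    then show "\<exists>n. N' (y' - (T' ^^ n) x') < e"
      using norm_diff [OF y(1) funpow_in [OF in_X [OF x(1)], of n]]
      unfolding x y intertwine_funpow [OF in_X [OF x(1)]] by (intro exI [of _ n]) simp
  qed
  moreover have "\<not> finite_dimensional s' (\<Phi> ` M)"
  proof
    assume fin: "finite_dimensional s' (\<Phi> ` M)"
    have "finite_dimensional s M"
      by (rule finite_dimensional_linear_image [where X = X and \<Phi> = \<Phi> and s' = s'])
        (fact vs vs' X M(1) inj fin add scale)+
    with inf show False ..
  qed
  moreover have "\<Phi> ` M \<subseteq> X'" using in_X by auto
  ultimately show ?thesis unfolding hypercyclic_subspace_in_def by (intro conjI)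
qed

lemma inverse: "linear_isometry s' X' N' T' s X N T (inv_into X \<Phi>)"
proof -
  have eq [simp]: "inv_into X \<Phi> (\<Phi> x) = x" if "x \<in> X" for x
    using that inj by simp
  show ?thesis
  proof (rule linear_isometry.intro)
    show "bij_betw (inv_into X \<Phi>) X' X"
      by (rule bij_betw_inv_into [OF bij])
    show "inv_into X \<Phi> (x' + y') = inv_into X \<Phi> x' + inv_into X \<Phi> y'" if x'y': "x' \<in> X'" "y' \<in> X'" for x' y'
    proof -
      obtain x y where "x \<in> X" "y \<in> X" "x' = \<Phi> x" "y' = \<Phi> y" using x'y' image by blast
      then show ?thesis using V.subspace_add [OF X, of x y] by (simp flip: add)
    qed
    show "inv_into X \<Phi> (s' c x') = s c (inv_into X \<Phi> x')" if x': "x' \<in> X'" for c x'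
    proof -
      obtain x where "x \<in> X" "x' = \<Phi> x" using x' image by blast
      then show ?thesis using V.subspace_scale [OF X, of x c] by (simp flip: scale)
    qed
    fix x' assume "x' \<in> X'"
    then obtain x where x: "x \<in> X" "x' = \<Phi> x" using image by blast
    then show "N (inv_into X \<Phi> x') = N' x'" "T' x' \<in> X'" "T (inv_into X \<Phi> x') = inv_into X \<Phi> (T' x')"
      by (simp_all add: isometric T_in intertwine)
  qed (fact vs vs' X X')+
qed

lemma has_hypercyclic_subspace_transfer:
  assumes "Metric_space X' (\<lambda>x y. N' (x - y))"
  shows "has_hypercyclic_subspace s' X' N' T' \<longleftrightarrow>
    bounded_operator s X N T \<and> (\<exists>M. hypercyclic_subspace_in s X N T M)"
proof -
  have "(\<exists>M. hypercyclic_subspace_in s' X' N' T' M) \<longleftrightarrow> (\<exists>M. hypercyclic_subspace_in s X N T M)"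
  proof (intro iffI; elim exE)
    fix M assume "hypercyclic_subspace_in s' X' N' T' M"
    from linear_isometry.hypercyclic_subspace_image [OF inverse this]
    show "\<exists>M. hypercyclic_subspace_in s X N T M" ..
  next
    fix M assume "hypercyclic_subspace_in s X N T M"
    from hypercyclic_subspace_image [OF this]
    show "\<exists>M. hypercyclic_subspace_in s' X' N' T' M" ..
  qed
  then show ?thesis
    unfolding has_hypercyclic_subspace_iff [OF assms] bounded_operator_iff by simp
qed

end

section \<open>The shift in coordinates\<close>

text \<open>Applies to \<open>d\<close> the inverse of the infinite bidiagonal matrix with ones on
  the diagonal and \<open>\<beta>\<close> just below it.\<close>

primrec solve_recurrence :: "(nat \<Rightarrow> complex) \<Rightarrow> (nat \<Rightarrow> complex) \<Rightarrow> nat \<Rightarrow> complex" where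
  "solve_recurrence \<beta> d 0 = d 0"
| "solve_recurrence \<beta> d (Suc k) = d (Suc k) - \<beta> k * solve_recurrence \<beta> d k"

lemma solve_recurrence_unique:
  assumes "y 0 = d 0" "\<And>k. y (Suc k) = d (Suc k) - \<beta> k * y k"
  shows "y = solve_recurrence \<beta> d"
proof
  show "y k = solve_recurrence \<beta> d k" for k by (induction k) (auto simp: assms)
qed

lemma solve_recurrence_add:
  "solve_recurrence \<beta> (\<lambda>k. d k + d' k) k = solve_recurrence \<beta> d k + solve_recurrence \<beta> d' k"
  by (induction k) (auto simp: algebra_simps)

lemma solve_recurrence_scale:
  "solve_recurrence \<beta> (\<lambda>k. c * d k) k = c * solve_recurrence \<beta> d k"
  by (induction k) (auto simp: algebra_simps)

lemma solve_recurrence_sums: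
  assumes "\<And>k. (\<lambda>s. d s k) sums D k"
  shows "(\<lambda>s. solve_recurrence \<beta> (d s) k) sums solve_recurrence \<beta> D k"
proof (induction k)
  case (Suc k)
  show ?case unfolding solve_recurrence.simps by (rule sums_diff [OF assms sums_mult [OF Suc]])
qed (simp add: assms)

text \<open>\<open>C\<close>, \<open>r\<close> and \<open>N0\<close> are witnesses for the
  hypotheses on the supremum and the limes superior; \<open>1 \<le> C\<close> makes the powers of
  \<open>C\<close> increase with the exponent.\<close>

locale shift_operator = lp_space p for p :: real +
  fixes a b w :: "nat \<Rightarrow> complex" and C r :: real and N0 :: nat
  assumes a_nonzero [simp]: "\<And>n. a n \<noteq> 0"
    and w_nonzero [simp]: "\<And>n. w n \<noteq> 0"
    and C1: "1 \<le> C" and weight_le: "\<And>n. norm (w (Suc n) * (a (Suc n) / a n)) \<le> C"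
    and r: "0 \<le> r" "r < 1" and ratio_le: "\<And>n. N0 \<le> n \<Longrightarrow> norm (b n / a (Suc n)) \<le> r"
    and defect_lim: "(\<lambda>n. norm (w (Suc (Suc n)) * (b (Suc n) / a (Suc n)) - w (Suc n) * (b n / a n))) \<longlonglongrightarrow> 0"
begin

definition \<beta> :: "nat \<Rightarrow> complex" where "\<beta> n = b n / a (Suc n)"

definition \<omega> :: "nat \<Rightarrow> complex" where "\<omega> n = w (Suc n) * (a (Suc n) / a n)"

text \<open>These numbers measure how far B_w is from a weighted shift of the basis: B_w f_k equals
  \<open>\<omega> (k-1)\<close> times f_(k-1) plus \<open>\<gamma> k * a k\<close> times z^k. For k
  = 0 the first summand is absent, which explains the value 0 in the case distinction.\<close>

definition \<gamma> :: "nat \<Rightarrow> complex" where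
  "\<gamma> k = w (Suc k) * (b k / a k) - (case k of 0 \<Rightarrow> 0 | Suc j \<Rightarrow> w (Suc j) * (b j / a j))"

definition taylor :: "(nat \<Rightarrow> complex) \<Rightarrow> nat \<Rightarrow> complex" where
  "taylor x k = a k * x k + (case k of 0 \<Rightarrow> 0 | Suc j \<Rightarrow> b j * x j)"

text \<open>Divided by \<open>a k\<close>, the system \<open>taylor x = t\<close> has unit diagonal
  and subdiagonal \<open>\<beta>\<close>, so it is solved by forward substitution for every
  \<open>t\<close>, convergent or not.\<close>

definition untaylor :: "(nat \<Rightarrow> complex) \<Rightarrow> nat \<Rightarrow> complex" where
  "untaylor t = solve_recurrence \<beta> (\<lambda>k. t k / a k)"

text \<open>B_w conjugated by \<open>taylor\<close>. Since \<open>taylor\<close> is a bijection of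
  the set of all sequences, algebraic identities for \<open>T\<close> need no membership
  assumptions.\<close>

definition T :: "(nat \<Rightarrow> complex) \<Rightarrow> nat \<Rightarrow> complex" where
  "T x = untaylor (\<lambda>k. w (Suc k) * taylor x (Suc k))"

definition S :: "(nat \<Rightarrow> complex) \<Rightarrow> nat \<Rightarrow> complex" where
  "S x k = \<omega> k * x (Suc k)"

definition K :: "(nat \<Rightarrow> complex) \<Rightarrow> nat \<Rightarrow> complex" where
  "K x = solve_recurrence \<beta> (\<lambda>k. \<gamma> k * x k)"

lemma taylor_untaylor [simp]: "taylor (untaylor t) = t"
proof
  show "taylor (untaylor t) k = t k" for k
    by (cases k) (auto simp: taylor_def untaylor_def \<beta>_def field_simps)
qed

lemma untaylor_taylor [simp]: "untaylor (taylor x) = x"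
  unfolding untaylor_def
  by (rule solve_recurrence_unique [symmetric]) (auto simp: taylor_def \<beta>_def field_simps)

lemma taylor_inject: "taylor x = taylor y \<longleftrightarrow> x = y"
  by (metis untaylor_taylor)

lemma taylor_add: "taylor (x + y) k = taylor x k + taylor y k"
  by (auto simp: taylor_def algebra_simps split: nat.split)

lemma taylor_scale: "taylor (seq_scale c x) k = c * taylor x k"
  by (auto simp: taylor_def algebra_simps split: nat.split)

lemma taylor_zero [simp]: "taylor 0 k = 0"
  by (auto simp: taylor_def split: nat.split)

text \<open>By uniqueness it suffices that \<open>S x + K x\<close> satisfies the recurrence
  defining \<open>T x\<close>. There \<open>\<beta> k * S x k\<close> contributes exactly the term
  that is subtracted in \<open>\<gamma> (Suc k)\<close>, so the two cancel.\<close>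

lemma T_eq: "T x = S x + K x"
  unfolding T_def untaylor_def
proof (rule solve_recurrence_unique [symmetric])
  show "(S x + K x) 0 = w (Suc 0) * taylor x (Suc 0) / a 0"
    by (simp add: S_def K_def \<omega>_def \<gamma>_def taylor_def field_simps)
next
  fix k
  show "(S x + K x) (Suc k) = w (Suc (Suc k)) * taylor x (Suc (Suc k)) / a (Suc k) - \<beta> k * (S x + K x) k"
  proof -
    have "\<beta> k * S x k = w (Suc k) * (b k / a k) * x (Suc k)"
      by (simp add: \<beta>_def S_def \<omega>_def)
    then show ?thesis
      by (simp add: S_def [of x "Suc k"] K_def \<omega>_def \<gamma>_def taylor_def distrib_left add_divide_distrib left_diff_distrib mult.assoc)
  qed
qed

lemma T_add: "T (x + y) = T x + T y"
  unfolding T_def untaylor_def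
  by (simp add: fun_eq_iff taylor_add distrib_left add_divide_distrib solve_recurrence_add)

lemma T_scale: "T (seq_scale c x) = seq_scale c (T x)"
  unfolding T_def untaylor_def
proof
  fix k
  have "(\<lambda>k. w (Suc k) * taylor (seq_scale c x) (Suc k) / a k) = (\<lambda>k. c * (w (Suc k) * taylor x (Suc k) / a k))"
    by (auto simp: taylor_scale)
  then show "solve_recurrence \<beta> (\<lambda>k. w (Suc k) * taylor (seq_scale c x) (Suc k) / a k) k =
      seq_scale c (solve_recurrence \<beta> (\<lambda>k. w (Suc k) * taylor x (Suc k) / a k)) k"
    by (simp only: solve_recurrence_scale seq_scale_apply)
qed

text \<open>Each coordinate of \<open>T x\<close> depends on finitely many coordinates of
  \<open>x\<close>, so coordinatewise convergence suffices and no continuity in norm is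
  needed.\<close>

lemma T_sums:
  assumes "\<And>i. (\<lambda>s. g s i) sums x i"
  shows "(\<lambda>s. T (g s) i) sums T x i"
proof -
  have "(\<lambda>s. taylor (g s) k) sums taylor x k" for k
    by (cases k) (auto simp: taylor_def intro!: sums_add sums_mult assms)
  then show ?thesis
    unfolding T_def untaylor_def by (intro solve_recurrence_sums sums_divide sums_mult)
qed

lemma funpow_T_add: "(T ^^ n) (x + y) = (T ^^ n) x + (T ^^ n) y"
  by (induction n) (simp_all only: funpow.simps o_apply id_apply T_add)

lemma funpow_T_scale: "(T ^^ n) (seq_scale c x) = seq_scale c ((T ^^ n) x)"
  by (induction n) (simp_all only: funpow.simps o_apply id_apply T_scale)

lemma funpow_T_sums:
  assumes "\<And>i. (\<lambda>s. g s i) sums x i"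
  shows "(\<lambda>s. (T ^^ n) (g s) i) sums (T ^^ n) x i"
proof (induction n arbitrary: i)
  case (Suc n)
  from T_sums [OF this] show ?case by simp
qed (simp add: assms)

lemma funpow_T_zero [simp]: "(T ^^ n) 0 = 0"
  using funpow_T_add [of n 0 0] unfolding add_0_left by (metis add_cancel_left_right)

text \<open>The solution satisfies y = d + v, where v is \<open>- \<beta> y\<close> delayed by one
  index. Beyond \<open>N0\<close> the product \<open>\<beta> y\<close> has norm at most r times that
  of y, which is absorbed into the left side; the finitely many earlier entries cost the constant
  \<open>A\<close>. This gives \<open>R = (1 + A) / (1 - r)\<close>.\<close>

lemma solve_recurrence_bound:
  obtains R where "1 \<le> R"
    "\<And>d. d \<in> lp_seq p \<Longrightarrow> solve_recurrence \<beta> d \<in> lp_seq p \<and> lp_norm p (solve_recurrence \<beta> d) \<le> R * lp_norm p d"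
proof -
  \<comment> \<open>Below \<open>N0\<close> the ratios may be large, but each single coordinate of
    the solution is a bounded functional of \<open>d\<close>, by induction along the
    recurrence.\<close>
  have head: "\<exists>H\<ge>0. \<forall>d\<in>lp_seq p. norm (solve_recurrence \<beta> d k) \<le> H * lp_norm p d" for k
  proof (induction k)
    case 0
    then show ?case using norm_le_lp_norm by (intro exI [of _ 1]) auto
  next
    case (Suc k)
    then obtain H where H: "H \<ge> 0" "\<And>d. d \<in> lp_seq p \<Longrightarrow> norm (solve_recurrence \<beta> d k) \<le> H * lp_norm p d" by blast
    have "norm (solve_recurrence \<beta> d (Suc k)) \<le> (1 + norm (\<beta> k) * H) * lp_norm p d" if d: "d \<in> lp_seq p" for d
    proof -
      have "norm (solve_recurrence \<beta> d (Suc k)) \<le> norm (d (Suc k)) + norm (\<beta> k) * norm (solve_recurrence \<beta> d k)"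
        using norm_triangle_ineq4 [of "d (Suc k)" "\<beta> k * solve_recurrence \<beta> d k"] by (simp add: norm_mult)
      also have "\<dots> \<le> lp_norm p d + norm (\<beta> k) * (H * lp_norm p d)"
        using d by (intro add_mono mult_left_mono norm_le_lp_norm H) auto
      finally show ?thesis by (simp add: algebra_simps)
    qed
    then show ?case using H(1) by (intro exI [of _ "1 + norm (\<beta> k) * H"]) auto
  qed
  then obtain H where H: "\<And>k. H k \<ge> (0::real)"
    "\<And>k d. d \<in> lp_seq p \<Longrightarrow> norm (solve_recurrence \<beta> d k) \<le> H k * lp_norm p d" by metis
  define A where "A = (\<Sum>j<N0. norm (\<beta> j) * H j)"
  have A: "0 \<le> A" unfolding A_def using H(1) by (intro sum_nonneg) auto
  define R where "R = (1 + A) / (1 - r)"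
  have R: "1 \<le> R" using A r by (simp add: R_def field_simps)
  have bound: "lp_norm_on p {..<n} (solve_recurrence \<beta> d) \<le> R * lp_norm p d" if d: "d \<in> lp_seq p" for d n
  proof -
    define y where "y = solve_recurrence \<beta> d"
    define u where "u = (\<lambda>j. \<beta> j * y j)"
    define v where "v = (\<lambda>k. case k of 0 \<Rightarrow> 0 | Suc j \<Rightarrow> - u j)"
    have y: "y = (\<lambda>k. d k + v k)"
    proof
      show "y k = d k + v k" for k by (cases k) (auto simp: y_def v_def u_def)
    qed
    have "(\<Sum>k<n. norm (v k) powr p) \<le> (\<Sum>k<n. norm (u k) powr p)"
    proof (cases n)
      case (Suc m)
      then have "(\<Sum>k<n. norm (v k) powr p) = (\<Sum>k<m. norm (u k) powr p)"
        by (simp add: sum.lessThan_Suc_shift v_def del: sum.lessThan_Suc)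
      then show ?thesis using Suc by simp
    qed simp
    then have vu: "lp_norm_on p {..<n} v \<le> lp_norm_on p {..<n} u"
      by (subst lp_norm_on_le_iff) (auto simp: lp_norm_on_powr)
    define u1 where "u1 = (\<lambda>j. if j < N0 then u j else 0)"
    define u2 where "u2 = (\<lambda>j. if j < N0 then 0 else u j)"
    have "lp_norm_on p {..<n} u = lp_norm_on p {..<n} (\<lambda>j. u1 j + u2 j)"
      by (intro lp_norm_on_cong) (auto simp: u1_def u2_def)
    also have "\<dots> \<le> lp_norm_on p {..<n} u1 + lp_norm_on p {..<n} u2"
      by (rule lp_norm_on_triangle)
    also have "lp_norm_on p {..<n} u1 \<le> A * lp_norm p d"
    proof -
      have "lp_norm_on p {..<n} u1 \<le> lp_norm p u1"
        by (intro lp_norm_on_le_lp_norm lp_norm_le_sum(1) [of N0]) (auto simp: u1_def)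
      also have "\<dots> \<le> (\<Sum>j<N0. norm (u1 j))"
        by (intro lp_norm_le_sum(2)) (auto simp: u1_def)
      also have "\<dots> \<le> (\<Sum>j<N0. norm (\<beta> j) * (H j * lp_norm p d))"
        using d by (intro sum_mono) (auto simp: u1_def u_def y_def norm_mult intro!: mult_left_mono H)
      finally show ?thesis by (simp add: A_def sum_distrib_right mult.assoc)
    qed
    also have "lp_norm_on p {..<n} u2 \<le> r * lp_norm_on p {..<n} y"
    proof -
      have "lp_norm_on p {..<n} u2 \<le> lp_norm_on p {..<n} (\<lambda>j. of_real r * y j)"
        using r ratio_le [folded \<beta>_def] by (intro lp_norm_on_mono) (auto simp: u2_def u_def norm_mult intro!: mult_right_mono)
      then show ?thesis using r lp_norm_on_scale [of "{..<n}" "of_real r" y] by simp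
    qed
    finally have u: "lp_norm_on p {..<n} u \<le> A * lp_norm p d + r * lp_norm_on p {..<n} y" by simp
    have "lp_norm_on p {..<n} y \<le> lp_norm_on p {..<n} d + lp_norm_on p {..<n} v"
      unfolding y by (rule lp_norm_on_triangle)
    also have "\<dots> \<le> lp_norm p d + (A * lp_norm p d + r * lp_norm_on p {..<n} y)"
      using d vu u by (intro add_mono lp_norm_on_le_lp_norm) auto
    \<comment> \<open>The absorption is done on an initial segment, where the norm of y is known to
      be finite.\<close>
    finally have "(1 - r) * lp_norm_on p {..<n} y \<le> (1 + A) * lp_norm p d"
      by (simp add: algebra_simps)
    then show ?thesis using r by (simp add: R_def y_def field_simps)
  qed
  show ?thesis
    by (rule that [of R]) (auto simp: R intro: lp_norm_leI [OF bound])
qed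

definition R :: real where
  "R = (SOME R. 1 \<le> R \<and> (\<forall>d\<in>lp_seq p. solve_recurrence \<beta> d \<in> lp_seq p \<and>
     lp_norm p (solve_recurrence \<beta> d) \<le> R * lp_norm p d))"

lemma R: "1 \<le> R" "d \<in> lp_seq p \<Longrightarrow> solve_recurrence \<beta> d \<in> lp_seq p"
  "d \<in> lp_seq p \<Longrightarrow> lp_norm p (solve_recurrence \<beta> d) \<le> R * lp_norm p d"
proof -
  have "\<exists>R. 1 \<le> R \<and> (\<forall>d\<in>lp_seq p. solve_recurrence \<beta> d \<in> lp_seq p \<and>
      lp_norm p (solve_recurrence \<beta> d) \<le> R * lp_norm p d)"
    using solve_recurrence_bound by metis
  from someI_ex [OF this, folded R_def]
  show "1 \<le> R" "d \<in> lp_seq p \<Longrightarrow> solve_recurrence \<beta> d \<in> lp_seq p"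
    "d \<in> lp_seq p \<Longrightarrow> lp_norm p (solve_recurrence \<beta> d) \<le> R * lp_norm p d" by auto
qed

lemma \<gamma>_tendsto: "\<gamma> \<longlonglongrightarrow> 0"
proof -
  have "(\<lambda>n. \<gamma> (Suc n)) \<longlonglongrightarrow> 0"
    using defect_lim unfolding tendsto_norm_zero_iff by (simp add: \<gamma>_def)
  then show ?thesis by (rule LIMSEQ_imp_Suc)
qed

text \<open>The bound \<open>e\<close> is required only on the support of \<open>x\<close>. A bound
  for all of \<open>\<gamma>\<close> gives boundedness of \<open>K\<close>; support far out allows
  \<open>e\<close> to be as small as desired, and this is the form in which compactness is
  used.\<close>

lemma K_bound:
  assumes x: "x \<in> lp_seq p" and e: "0 \<le> e" "\<And>k. x k \<noteq> 0 \<Longrightarrow> norm (\<gamma> k) \<le> e"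
  shows "K x \<in> lp_seq p" "lp_norm p (K x) \<le> R * e * lp_norm p x"
proof -
  have le: "norm (\<gamma> k * x k) \<le> e * norm (x k)" for k
    using e by (cases "x k = 0") (auto simp: norm_mult intro: mult_right_mono)
  note * = lp_seq_dominated [OF x e(1) le]
  show "K x \<in> lp_seq p"
    unfolding K_def using R(2) *(1) by simp
  have "lp_norm p (K x) \<le> R * lp_norm p (\<lambda>k. \<gamma> k * x k)"
    unfolding K_def using R(3) *(1) by simp
  also have "\<dots> \<le> R * (e * lp_norm p x)"
    using R(1) *(2) by (intro mult_left_mono) auto
  finally show "lp_norm p (K x) \<le> R * e * lp_norm p x" by simp
qed

lemma S_bound:
  assumes x: "x \<in> lp_seq p"
  shows "S x \<in> lp_seq p" "lp_norm p (S x) \<le> C * lp_norm p x"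
proof -
  have le: "norm (S x k) \<le> C * norm (x (k + 1))" for k
  proof -
    have "norm (S x k) = norm (w (Suc k) * (a (Suc k) / a k)) * norm (x (k + 1))"
      by (simp only: S_def \<omega>_def norm_mult Suc_eq_plus1)
    also have "\<dots> \<le> C * norm (x (k + 1))"
      by (intro mult_right_mono weight_le) simp
    finally show ?thesis .
  qed
  note * = lp_seq_dominated [OF lp_seq_shift(1) [OF x] _ le]
  show "S x \<in> lp_seq p" using * C1 by simp
  have "lp_norm p (S x) \<le> C * lp_norm p (\<lambda>k. x (k + 1))" using * C1 by simp
  also have "\<dots> \<le> C * lp_norm p x" using lp_seq_shift(2) [OF x, of 1] C1 by (intro mult_left_mono) auto
  finally show "lp_norm p (S x) \<le> C * lp_norm p x" .
qed

lemma T_bound_exists: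
  obtains L where "1 \<le> L" "\<And>x. x \<in> lp_seq p \<Longrightarrow> T x \<in> lp_seq p \<and> lp_norm p (T x) \<le> L * lp_norm p x"
proof -
  obtain G where G: "0 < G" "\<And>k. norm (\<gamma> k) \<le> G"
    using convergent_imp_Bseq [OF convergentI [OF \<gamma>_tendsto]] by (auto simp: Bseq_def)
  show ?thesis
  proof (rule that [of "C + R * G"])
    show "1 \<le> C + R * G" using C1 R(1) G(1) by (smt (verit) mult_nonneg_nonneg)
  next
    fix x assume x: "x \<in> lp_seq p"
    have K: "K x \<in> lp_seq p" "lp_norm p (K x) \<le> R * G * lp_norm p x"
      using K_bound [OF x, of G] G by auto
    show "T x \<in> lp_seq p \<and> lp_norm p (T x) \<le> (C + R * G) * lp_norm p x"
      unfolding T_eq using lp_seq_add [OF S_bound(1) [OF x] K(1)] S_bound(2) [OF x] K(2)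
      by (simp add: distrib_right)
  qed
qed

definition L :: real where
  "L = (SOME L. 1 \<le> L \<and> (\<forall>x\<in>lp_seq p. T x \<in> lp_seq p \<and> lp_norm p (T x) \<le> L * lp_norm p x))"

lemma L: "1 \<le> L" and T_in: "x \<in> lp_seq p \<Longrightarrow> T x \<in> lp_seq p"
  and T_bound: "x \<in> lp_seq p \<Longrightarrow> lp_norm p (T x) \<le> L * lp_norm p x"
proof -
  have "\<exists>L. 1 \<le> L \<and> (\<forall>x\<in>lp_seq p. T x \<in> lp_seq p \<and> lp_norm p (T x) \<le> L * lp_norm p x)"
    using T_bound_exists by metis
  from someI_ex [OF this, folded L_def]
  show "1 \<le> L" "x \<in> lp_seq p \<Longrightarrow> T x \<in> lp_seq p" "x \<in> lp_seq p \<Longrightarrow> lp_norm p (T x) \<le> L * lp_norm p x"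
    by auto
qed

lemma bounded_operator_T: "bounded_operator seq_scale (lp_seq p) (lp_norm p) T"
  unfolding bounded_operator_def using T_in T_bound T_add T_scale by blast

lemma funpow_T_in: "x \<in> lp_seq p \<Longrightarrow> (T ^^ n) x \<in> lp_seq p"
  by (induction n) (auto simp: T_in)

lemma funpow_T_bound: "x \<in> lp_seq p \<Longrightarrow> lp_norm p ((T ^^ n) x) \<le> L ^ n * lp_norm p x"
proof (induction n)
  case (Suc n)
  have "lp_norm p ((T ^^ Suc n) x) \<le> L * lp_norm p ((T ^^ n) x)"
    using T_bound [OF funpow_T_in [OF Suc.prems]] by simp
  also have "\<dots> \<le> L * (L ^ n * lp_norm p x)"
    using L Suc by (intro mult_left_mono) auto
  finally show ?case by simp
qed simp

lemma funpow_S: "(S ^^ n) x k = (\<Prod>i=k..<k+n. \<omega> i) * x (k + n)"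
proof (induction n arbitrary: k)
  case (Suc n)
  have "(S ^^ Suc n) x k = \<omega> k * ((\<Prod>i=Suc k..<Suc k+n. \<omega> i) * x (Suc k + n))"
    by (simp add: S_def Suc)
  also have "\<omega> k * ((\<Prod>i=Suc k..<Suc k+n. \<omega> i) * x (Suc k + n)) = (\<Prod>i=k..<Suc k+n. \<omega> i) * x (Suc k + n)"
    by (simp add: prod.atLeast_Suc_lessThan [of k])
  finally show ?case by simp
qed simp

lemma funpow_S_bound:
  assumes x: "x \<in> lp_seq p"
  shows "(S ^^ n) x \<in> lp_seq p \<and> lp_norm p ((S ^^ n) x) \<le> C ^ n * lp_norm p x"
proof (induction n)
  case (Suc n)
  then have "lp_norm p ((S ^^ Suc n) x) \<le> C * lp_norm p ((S ^^ n) x)"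
    using S_bound(2) by simp
  also have "\<dots> \<le> C * (C ^ n * lp_norm p x)"
    using C1 Suc by (intro mult_left_mono) auto
  finally show ?case using Suc S_bound(1) by simp
qed (simp add: x)

text \<open>\<open>K\<close> is compact, so on vectors supported far out the powers of \<open>T\<close> are close to those of the
  weighted shift \<open>S\<close>.\<close>

lemma funpow_T_near_funpow_S:
  assumes "0 < e"
  shows "\<exists>N. \<forall>x\<in>lp_seq p. (\<forall>k<N. x k = 0) \<longrightarrow> lp_norm p ((T ^^ m) x - (S ^^ m) x) \<le> e * lp_norm p x"
  using assms
proof (induction m arbitrary: e)
  case 0
  then show ?case by (auto simp: zero_fun_def [symmetric])
next
  case (Suc m)
  \<comment> \<open>The error at \<open>Suc m\<close> is \<open>T\<close> applied to the error at
    \<open>m\<close>, plus \<open>K ((S ^^ m) x)\<close>. Their factors \<open>L * e1\<close> and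
    \<open>R * e2 * C ^ m\<close> are each made equal to e/2.\<close>
  define e1 where "e1 = e / (2 * L)"
  define e2 where "e2 = e / (2 * R * C ^ m)"
  have e12: "0 < e1" "0 < e2" using Suc.prems L R(1) C1 by (auto simp: e1_def e2_def)
  obtain N1 where N1: "\<And>x. x \<in> lp_seq p \<Longrightarrow> \<forall>k<N1. x k = 0 \<Longrightarrow>
      lp_norm p ((T ^^ m) x - (S ^^ m) x) \<le> e1 * lp_norm p x"
    using Suc.IH [OF e12(1)] by blast
  obtain N2 where N2: "\<And>k. N2 \<le> k \<Longrightarrow> norm (\<gamma> k) \<le> e2"
    using LIMSEQ_D [OF \<gamma>_tendsto e12(2)] by (auto intro: less_imp_le)
  \<comment> \<open>\<open>S ^^ m\<close> moves supports down by m; the summand m in the threshold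
    keeps the support of \<open>(S ^^ m) x\<close> beyond \<open>N2\<close>.\<close>
  have "lp_norm p ((T ^^ Suc m) x - (S ^^ Suc m) x) \<le> e * lp_norm p x"
    if x: "x \<in> lp_seq p" and supp: "\<forall>k<N1 + N2 + m. x k = 0" for x
  proof -
    define y where "y = (S ^^ m) x"
    have y: "y \<in> lp_seq p" "lp_norm p y \<le> C ^ m * lp_norm p x"
      unfolding y_def using funpow_S_bound [OF x] by auto
    have d: "(T ^^ m) x - y \<in> lp_seq p" using y funpow_T_in [OF x] by (simp add: lp_seq_diff)
    have "norm (\<gamma> k) \<le> e2" if "y k \<noteq> 0" for k
    proof (rule N2, rule ccontr)
      assume "\<not> N2 \<le> k"
      then have "x (k + m) = 0" using supp by simp
      with that show False by (simp add: y_def funpow_S)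
    qed
    with y e12 have Ky: "K y \<in> lp_seq p" "lp_norm p (K y) \<le> R * e2 * lp_norm p y"
      using K_bound [OF y(1), of e2] by auto
    have "(T ^^ Suc m) x - (S ^^ Suc m) x = T ((T ^^ m) x - y) + K y"
      using T_add [of "(T ^^ m) x - y" y] T_eq [of y] by (simp add: y_def algebra_simps)
    then have "lp_norm p ((T ^^ Suc m) x - (S ^^ Suc m) x) \<le> lp_norm p (T ((T ^^ m) x - y)) + lp_norm p (K y)"
      using lp_seq_add(2) [OF T_in [OF d] Ky(1)] by simp
    also have "\<dots> \<le> L * (e1 * lp_norm p x) + R * e2 * (C ^ m * lp_norm p x)"
    proof (intro add_mono)
      have "lp_norm p (T ((T ^^ m) x - y)) \<le> L * lp_norm p ((T ^^ m) x - y)" by (rule T_bound [OF d])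
      also have "\<dots> \<le> L * (e1 * lp_norm p x)"
        unfolding y_def using L supp by (intro mult_left_mono N1 x) auto
      finally show "lp_norm p (T ((T ^^ m) x - y)) \<le> L * (e1 * lp_norm p x)" .
      show "lp_norm p (K y) \<le> R * e2 * (C ^ m * lp_norm p x)"
        using Ky(2) y(2) R(1) e12 by (smt (verit) mult_left_mono mult_nonneg_nonneg)
    qed
    also have "\<dots> = e * lp_norm p x"
    proof -
      have eq: "L * e1 = e / 2" "R * e2 * C ^ m = e / 2"
        using L R(1) C1 by (auto simp: e1_def e2_def field_simps)
      have "L * (e1 * lp_norm p x) + R * e2 * (C ^ m * lp_norm p x)
          = (L * e1) * lp_norm p x + (R * e2 * C ^ m) * lp_norm p x" by (simp only: mult.assoc)
      then show ?thesis unfolding eq by simp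
    qed
    finally show ?thesis .
  qed
  then show ?case by blast
qed

section \<open>Products of the weights and the powers of T in Taylor coefficients\<close>

definition W :: "nat \<Rightarrow> complex" where "W n = (\<Prod>i=1..n. w i)"

lemma W_nonzero [simp]: "W n \<noteq> 0"
  by (simp add: W_def)

lemma W_Suc: "W (Suc n) = w (Suc n) * W n"
  by (simp add: W_def mult.commute)

text \<open>This closed formula for powers is the reason for keeping Taylor coefficients: in basis
  coordinates \<open>K\<close> destroys any such formula.\<close>

lemma taylor_funpow_T: "taylor ((T ^^ n) x) k = taylor x (k + n) * W (k + n) / W k"
  by (induction n arbitrary: k) (auto simp: T_def W_Suc)

text \<open>The product telescopes. Questions about blocks of weights thereby become questions about
  the single sequence \<open>W n * a n\<close>.\<close>

lemma prod_\<omega>: "(\<Prod>i=k..<k+n. \<omega> i) = (W (k + n) * a (k + n)) / (W k * a k)"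
  by (induction n) (auto simp: \<omega>_def W_Suc field_simps)

lemma norm_W_Suc: "norm (W (Suc n) * a (Suc n)) \<le> C * norm (W n * a n)"
proof -
  have "W (Suc n) * a (Suc n) = \<omega> n * (W n * a n)" by (simp add: \<omega>_def W_Suc)
  then have "norm (W (Suc n) * a (Suc n)) = norm (\<omega> n) * norm (W n * a n)" by (metis norm_mult)
  also have "\<dots> \<le> C * norm (W n * a n)"
    using weight_le [of n] by (intro mult_right_mono) (auto simp: \<omega>_def)
  finally show ?thesis .
qed

text \<open>Mostly read backwards: a large value at one index forces large values at the indices
  shortly before it.\<close>

lemma norm_W_add: "norm (W (n + k) * a (n + k)) \<le> C ^ k * norm (W n * a n)"
proof (induction k)
  case (Suc k)
  have "norm (W (n + Suc k) * a (n + Suc k)) \<le> C * norm (W (n + k) * a (n + k))"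
    using norm_W_Suc [of "n + k"] by simp
  also have "\<dots> \<le> C * (C ^ k * norm (W n * a n))"
    using Suc C1 by (intro mult_left_mono) auto
  finally show ?case by simp
qed simp

end

section \<open>Obstructions to hypercyclic subspaces\<close>

context shift_operator
begin

lemma ratio_bounded: obtains Q where "0 \<le> Q" "\<And>j. norm (\<beta> j) \<le> Q"
proof (rule that [of "r + (\<Sum>j<N0. norm (\<beta> j))"])
  show "0 \<le> r + (\<Sum>j<N0. norm (\<beta> j))" using r by (simp add: sum_nonneg)
  fix j
  show "norm (\<beta> j) \<le> r + (\<Sum>j<N0. norm (\<beta> j))"
  proof (cases "j < N0")
    case True
    then have "norm (\<beta> j) \<le> (\<Sum>j<N0. norm (\<beta> j))" by (intro member_le_sum) auto
    with r show ?thesis by simp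
  next
    case False
    with ratio_le [of j] have "norm (\<beta> j) \<le> r" by (simp add: \<beta>_def)
    then show ?thesis by (smt (verit) sum_nonneg norm_ge_zero)
  qed
qed

text \<open>Coordinate 0 of \<open>(T ^^ n) x\<close> is \<open>taylor x n * W n / a 0\<close>.
  Since \<open>b (n-1)\<close> is \<open>\<beta> (n-1) * a n\<close> with bounded
  \<open>\<beta>\<close>, it is at most a constant times \<open>norm (W n * a n)\<close>. If that
  stayed below \<open>B\<close>, the orbit could not approach the multiple \<open>M + 1\<close> of
  the first basis vector.\<close>

lemma dense_orbit_imp_weights_unbounded:
  assumes x: "x \<in> lp_seq p" and dense: "\<And>y e. y \<in> lp_seq p \<Longrightarrow> 0 < e \<Longrightarrow> \<exists>n. lp_norm p (y - (T ^^ n) x) < e"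
  shows "\<exists>n. B < norm (W n * a n)"
proof (rule ccontr)
  assume "\<not> ?thesis"
  then have B: "norm (W n * a n) \<le> B" for n by (simp add: not_less)
  have B0: "0 \<le> B" using B [of 0] norm_ge_zero order_trans by blast
  obtain Q where Q: "0 \<le> Q" "\<And>j. norm (\<beta> j) \<le> Q" using ratio_bounded by blast
  define M where "M = (lp_norm p x * B + Q * B * lp_norm p x) / norm (a 0)"
  have M0: "0 \<le> M" unfolding M_def using Q B0 by (intro divide_nonneg_nonneg add_nonneg_nonneg mult_nonneg_nonneg) auto
  have le: "norm ((T ^^ n) x 0) \<le> M" for n
  proof -
    have "norm (taylor x n * W n) \<le> lp_norm p x * B + Q * B * lp_norm p x"
    proof (cases n)
      case 0
      have "norm (taylor x n * W n) = norm (x 0) * norm (W 0 * a 0)"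
        unfolding 0 by (simp add: taylor_def norm_mult)
      also have "\<dots> \<le> lp_norm p x * B" using x B by (intro mult_mono norm_le_lp_norm) auto
      finally show ?thesis using Q B0 by (smt (verit) lp_norm_nonneg mult_nonneg_nonneg)
    next
      case (Suc j)
      have "taylor x n * W n = x n * (W n * a n) + \<beta> j * (W n * a n) * x j"
        unfolding Suc by (simp add: taylor_def \<beta>_def field_simps)
      then have "norm (taylor x n * W n) \<le> norm (x n) * norm (W n * a n) + norm (\<beta> j) * norm (W n * a n) * norm (x j)"
        by (metis norm_mult norm_triangle_ineq)
      also have "\<dots> \<le> lp_norm p x * B + Q * B * lp_norm p x"
        using x Q B B0 by (intro add_mono mult_mono norm_le_lp_norm mult_nonneg_nonneg) auto
      finally show ?thesis .
    qed
    moreover have "a 0 * (T ^^ n) x 0 = taylor x n * W n"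
      using taylor_funpow_T [of n x 0] by (simp add: taylor_def W_def)
    ultimately have "norm (a 0) * norm ((T ^^ n) x 0) \<le> lp_norm p x * B + Q * B * lp_norm p x"
      by (metis norm_mult)
    then show ?thesis by (simp add: M_def field_simps)
  qed
  define y where "y = (\<lambda>i::nat. if i = 0 then complex_of_real (M + 1) else 0)"
  have y: "y \<in> lp_seq p" by (rule lp_norm_le_sum(1) [of 1]) (auto simp: y_def)
  then obtain n where n: "lp_norm p (y - (T ^^ n) x) < 1" using dense [of y 1] by auto
  have "norm (y 0) - norm ((T ^^ n) x 0) \<le> norm ((y - (T ^^ n) x) 0)"
    using norm_triangle_ineq2 [of "y 0" "(T ^^ n) x 0"] by simp
  also have "\<dots> \<le> lp_norm p (y - (T ^^ n) x)"
    by (intro norm_le_lp_norm lp_seq_diff y funpow_T_in x)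
  finally have "norm (y 0) - norm ((T ^^ n) x 0) < 1" using n by simp
  moreover have "norm (y 0) = M + 1"
    using M0 norm_of_real [of "M + 1", where 'a = complex] by (simp add: y_def del: norm_of_real)
  ultimately show False using le [of n] by simp
qed

text \<open>Far out \<open>S ^^ m\<close> expands by \<open>\<rho>\<close>, and the difference to
  \<open>T ^^ m\<close> uses up half of the surplus over 1. The factor is written as a square
  because \<open>gliding_hump\<close> spends one \<open>\<sigma>\<close> per step on summable
  coefficients and still needs the other.\<close>

lemma funpow_T_bounded_below:
  assumes m: "\<And>k. 1 \<le> k \<Longrightarrow> \<rho> \<le> norm (\<Prod>i=k..<k+m. \<omega> i)" and \<rho>: "1 < \<rho>"
  obtains N \<sigma> where "1 < \<sigma>"
    "\<And>x. x \<in> lp_seq p \<Longrightarrow> \<forall>k<N. x k = 0 \<Longrightarrow> \<sigma> * \<sigma> * lp_norm p x \<le> lp_norm p ((T ^^ m) x)"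
proof -
  define e where "e = (\<rho> - 1) / 2"
  have e: "0 < e" "1 < \<rho> - e" using \<rho> by (auto simp: e_def field_simps)
  obtain N where N: "\<And>x. x \<in> lp_seq p \<Longrightarrow> \<forall>k<N. x k = 0 \<Longrightarrow>
      lp_norm p ((T ^^ m) x - (S ^^ m) x) \<le> e * lp_norm p x"
    using funpow_T_near_funpow_S [OF e(1), of m] by blast
  show ?thesis
  \<comment> \<open>The summand m lets the shift by m preserve the norm of \<open>x\<close>; the
    summand 1 makes \<open>x m\<close> vanish, since at \<open>k = 0\<close> no bound on the product
    is assumed.\<close>
  proof (rule that [of "sqrt (\<rho> - e)" "N + m + 1"])
    show "1 < sqrt (\<rho> - e)" using e by simp
  next
    fix x assume x: "x \<in> lp_seq p" and supp: "\<forall>k<N + m + 1. x k = 0"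
    have Sx: "(S ^^ m) x \<in> lp_seq p" using funpow_S_bound [OF x] by auto
    have "norm (x (k + m)) \<le> 1 / \<rho> * norm ((S ^^ m) x k)" for k
    proof (cases "k = 0")
      case True
      then show ?thesis using supp \<rho> by simp
    next
      case False
      then have "\<rho> * norm (x (k + m)) \<le> norm ((S ^^ m) x k)"
        unfolding funpow_S norm_mult by (intro mult_right_mono m) auto
      then show ?thesis using \<rho> by (simp add: field_simps)
    qed
    then have "lp_norm p (\<lambda>k. x (k + m)) \<le> 1 / \<rho> * lp_norm p ((S ^^ m) x)"
      using \<rho> by (intro lp_seq_dominated(2) Sx) auto
    then have "\<rho> * lp_norm p x \<le> lp_norm p ((S ^^ m) x)"
      using lp_norm_shift_eq [OF x, of m] supp \<rho> by (simp add: field_simps)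
    also have "\<dots> \<le> lp_norm p ((T ^^ m) x) + lp_norm p ((T ^^ m) x - (S ^^ m) x)"
      using lp_norm_triangle_rev [OF Sx funpow_T_in [OF x, of m]] by (simp add: lp_norm_minus_commute)
    also have "\<dots> \<le> lp_norm p ((T ^^ m) x) + e * lp_norm p x"
      using N [OF x] supp by simp
    finally show "sqrt (\<rho> - e) * sqrt (\<rho> - e) * lp_norm p x \<le> lp_norm p ((T ^^ m) x)"
      using e by (simp add: algebra_simps)
  qed
qed

text \<open>A gliding hump: \<open>T\<^sup>m\<^sup>k\<close> moves \<open>u k\<close> to a block \<open>{n k..<n (Suc k)}\<close> on which the later \<open>u j\<close>
  contribute nothing and the earlier ones almost nothing.\<close>

lemma gliding_hump:
  assumes M: "M \<subseteq> lp_seq p" "module.subspace seq_scale M" "\<not> finite_dimensional seq_scale M"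
    and closed: "\<And>y. y \<in> lp_seq p \<Longrightarrow> \<forall>e>0. \<exists>v\<in>M. lp_norm p (y - v) < e \<Longrightarrow> y \<in> M"
    and \<sigma>: "1 < \<sigma>"
    and below: "\<And>x. x \<in> lp_seq p \<Longrightarrow> \<forall>k<N. x k = 0 \<Longrightarrow> \<sigma> * \<sigma> * lp_norm p x \<le> lp_norm p ((T ^^ m) x)"
  obtains x where "x \<in> M" "\<And>k. 1 / 2 \<le> lp_norm p ((T ^^ (m * k)) x)"
proof -
  interpret V: vector_space seq_scale by (rule vector_space_seq_scale)
  \<comment> \<open>The coefficients are summable, yet after k expansions the k-th hump still has
    size at least \<open>\<alpha> k * \<sigma> ^ (2 * k) = \<sigma> ^ k \<ge> 1\<close>.\<close>
  define \<alpha> where "\<alpha> = (\<lambda>k::nat. (1 / \<sigma>) ^ k)"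
  have \<alpha>: "0 < \<alpha> k" "\<alpha> k * \<sigma> ^ k = 1" for k
    using \<sigma> by (simp_all add: \<alpha>_def power_divide)
  have \<alpha>_sm: "summable \<alpha>" unfolding \<alpha>_def using \<sigma> by (intro summable_geometric) simp
  have \<alpha>_pos: "0 < suminf \<alpha>" by (rule suminf_pos [OF \<alpha>_sm \<alpha>(1)])
  \<comment> \<open>At time \<open>m * k\<close> the earlier humps leak at most
    \<open>\<alpha> j * e\<close> each into the block, and the k-th one loses at most
    \<open>\<alpha> k * e\<close> beyond it. All this adds up to at most 1/2, against a main term of
    at least 1.\<close>
  define e where "e = 1 / (2 * suminf \<alpha>)"
  have e: "0 < e" "e * suminf \<alpha> = 1 / 2" using \<alpha>_pos by (auto simp: e_def)
  define tail where "tail = (\<lambda>n (y::nat \<Rightarrow> complex) i. if i < n then 0 else y i)"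
  \<comment> \<open>A state holds the earlier humps \<open>F\<close>, the current hump
    \<open>u\<close> and the start \<open>n\<close> of its block. \<open>Q\<close> chooses the next
    start so far out that all humps so far have small tails at every time up to
    \<open>m * Suc k\<close>.\<close>
  define P :: "nat \<Rightarrow> (nat \<Rightarrow> complex) set \<times> (nat \<Rightarrow> complex) \<times> nat \<Rightarrow> bool" where
    "P = (\<lambda>k (F, u, n). finite F \<and> F \<subseteq> lp_seq p \<and> u \<in> M \<and> lp_norm p u = 1 \<and> N \<le> n \<and>
       (\<forall>i\<le>k. \<forall>l<n. (T ^^ (m * i)) u l = 0))"
  define Q :: "nat \<Rightarrow> (nat \<Rightarrow> complex) set \<times> (nat \<Rightarrow> complex) \<times> nat \<Rightarrow>
      (nat \<Rightarrow> complex) set \<times> (nat \<Rightarrow> complex) \<times> nat \<Rightarrow> bool" where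
    "Q = (\<lambda>k (F, u, n) (F', u', n'). F' = insert u F \<and> n \<le> n' \<and>
       (\<forall>v\<in>F'. \<forall>i\<le>Suc k. lp_norm p (tail n' ((T ^^ (m * i)) v)) \<le> e))"
  \<comment> \<open>The coordinates below n at the times \<open>m * i\<close>, i up to k, are
    finitely many linear functionals on \<open>M\<close>, hence have a common nonzero zero, which is
    then normalised.\<close>
  have unit: "\<exists>u\<in>M. lp_norm p u = 1 \<and> (\<forall>i\<le>k. \<forall>l<n. (T ^^ (m * i)) u l = 0)" for k n
  proof -
    obtain v where v: "v \<in> M" "v \<noteq> 0" "\<And>j. j \<in> {..k} \<times> {..<n} \<Longrightarrow> (T ^^ (m * fst j)) v (snd j) = 0"
      by (rule infinite_dimensional_common_zero [OF vector_space_seq_scale M(2,3),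
            of "{..k} \<times> {..<n}" "\<lambda>j v. (T ^^ (m * fst j)) v (snd j)"])
        (auto simp: funpow_T_add funpow_T_scale simp del: plus_fun_apply seq_scale_apply, simp_all)
    have nz: "lp_norm p v \<noteq> 0" using v M(1) lp_norm_eq_0_iff by blast
    define u where "u = seq_scale (1 / lp_norm p v) v"
    have "u \<in> M" unfolding u_def using M(2) v(1) by (rule V.subspace_scale)
    moreover have "lp_norm p u = 1"
      using nz v(1) M(1) by (auto simp: u_def lp_norm_scale norm_divide subset_iff)
    moreover have "(T ^^ (m * i)) u l = 0" if "i \<le> k" "l < n" for i l
      using v(3) [of "(i, l)"] that by (simp add: u_def funpow_T_scale del: seq_scale_apply) simp
    ultimately show ?thesis by blast
  qed
  have "\<exists>f. \<forall>k. P k (f k) \<and> Q k (f k) (f (Suc k))"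
  proof (rule dependent_nat_choice)
    obtain u where "u \<in> M" "lp_norm p u = 1" "\<forall>i\<le>0. \<forall>l<N. (T ^^ (m * i)) u l = 0"
      using unit [of 0 N] by blast
    then have "P 0 ({}, u, N)" unfolding P_def by simp
    then show "\<exists>s. P 0 s" ..
  next
    fix s k assume "P k s"
    then obtain F u n where s: "s = (F, u, n)" and F: "finite F" "F \<subseteq> lp_seq p" "u \<in> M" "N \<le> n"
      unfolding P_def by (cases s) auto
    have "\<forall>j\<in>insert u F \<times> {..Suc k}. \<exists>n0. \<forall>n'\<ge>n0. lp_norm p (tail n' ((T ^^ (m * snd j)) (fst j))) \<le> e"
    proof
      fix j assume "j \<in> insert u F \<times> {..Suc k}"
      then have "fst j \<in> lp_seq p" using F M(1) by auto
      from lp_norm_truncate [OF funpow_T_in [OF this, of "m * snd j"] e(1)]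
      show "\<exists>n0. \<forall>n'\<ge>n0. lp_norm p (tail n' ((T ^^ (m * snd j)) (fst j))) \<le> e"
        unfolding tail_def by metis
    qed
    then obtain n0 where n0: "\<And>j n'. j \<in> insert u F \<times> {..Suc k} \<Longrightarrow> n0 j \<le> n' \<Longrightarrow>
        lp_norm p (tail n' ((T ^^ (m * snd j)) (fst j))) \<le> e" by metis
    define n' where "n' = n + (\<Sum>j\<in>insert u F \<times> {..Suc k}. n0 j)"
    have n': "n0 j \<le> n'" if "j \<in> insert u F \<times> {..Suc k}" for j
      unfolding n'_def using that F(1) by (intro trans_le_add2 member_le_sum) auto
    obtain u' where u': "u' \<in> M" "lp_norm p u' = 1" "\<forall>i\<le>Suc k. \<forall>l<n'. (T ^^ (m * i)) u' l = 0"
      using unit by blast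
    have tails: "lp_norm p (tail n' ((T ^^ (m * i)) v)) \<le> e" if "v \<in> insert u F" "i \<le> Suc k" for v i
      using n0 [of "(v, i)" n'] n' [of "(v, i)"] that by simp
    have "P (Suc k) (insert u F, u', n')"
      unfolding P_def using F u' M(1) by (auto simp: n'_def)
    moreover have "Q k s (insert u F, u', n')"
      unfolding Q_def s using tails by (auto simp: n'_def)
    ultimately show "\<exists>s'. P (Suc k) s' \<and> Q k s s'" by blast
  qed
  then obtain f where f: "\<And>k. P k (f k)" "\<And>k. Q k (f k) (f (Suc k))" by blast
  define F u n where "F = (\<lambda>k. fst (f k))" and "u = (\<lambda>k. fst (snd (f k)))" and "n = (\<lambda>k. snd (snd (f k)))"
  have f_eq: "f k = (F k, u k, n k)" for k by (simp add: F_def u_def n_def)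
  have u: "u k \<in> M" "lp_norm p (u k) = 1" "N \<le> n k"
    and u0: "\<And>i l. i \<le> k \<Longrightarrow> l < n k \<Longrightarrow> (T ^^ (m * i)) (u k) l = 0" for k
    using f(1) [of k] unfolding P_def f_eq by auto
  have F: "F (Suc k) = insert (u k) (F k)" "n k \<le> n (Suc k)"
    and tail_F: "\<And>v i. v \<in> F (Suc k) \<Longrightarrow> i \<le> Suc k \<Longrightarrow> lp_norm p (tail (n (Suc k)) ((T ^^ (m * i)) v)) \<le> e" for k
    using f(2) [of k] unfolding Q_def f_eq by auto
  have u_lp: "u k \<in> lp_seq p" for k using u(1) M(1) by blast
  have u_F: "u j \<in> F k" if "j < k" for j k
    using that by (induction k) (auto simp: F less_Suc_eq)
  have tail_u: "lp_norm p (tail (n k) ((T ^^ (m * i)) (u j))) \<le> e" if "j < k" "i \<le> k" for i j k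
    using that tail_F [of "u j" "k - 1" i] u_F [OF that(1)] by (cases k) auto
  have n_mono: "n i \<le> n j" if "i \<le> j" for i j
    using F(2) that by (rule lift_Suc_mono_le)
  \<comment> \<open>Up to time \<open>m * k\<close> the images of \<open>u k\<close> vanish below
    \<open>n k\<close>, which is at least \<open>N\<close>, so \<open>below\<close> applies at each
    of the k steps.\<close>
  have grow: "\<sigma> ^ k * \<sigma> ^ k \<le> lp_norm p ((T ^^ (m * k)) (u k))" for k
  proof -
    have "\<sigma> ^ i * \<sigma> ^ i \<le> lp_norm p ((T ^^ (m * i)) (u k))" if "i \<le> k" for i
      using that
    proof (induction i)
      case 0
      then show ?case by (simp add: u)
    next
      case (Suc i)
      have "\<sigma> ^ Suc i * \<sigma> ^ Suc i = \<sigma> * \<sigma> * (\<sigma> ^ i * \<sigma> ^ i)" by simp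
      also have "\<dots> \<le> \<sigma> * \<sigma> * lp_norm p ((T ^^ (m * i)) (u k))"
        using Suc \<sigma> by (intro mult_left_mono) auto
      also have "\<dots> \<le> lp_norm p ((T ^^ m) ((T ^^ (m * i)) (u k)))"
      proof (intro below funpow_T_in u_lp allI impI)
        fix l assume "l < N"
        then show "(T ^^ (m * i)) (u k) l = 0"
          using Suc.prems u(3) [of k] by (intro u0) auto
      qed
      finally show ?case by (simp add: funpow_add)
    qed
    then show ?thesis by simp
  qed
  define g where "g = (\<lambda>k. seq_scale (\<alpha> k) (u k))"
  have g: "g k \<in> lp_seq p" "lp_norm p (g k) = \<alpha> k" for k
    using u_lp u(2) \<alpha>(1) [of k] by (auto simp: g_def lp_seq_scale lp_norm_scale)
  define x where "x = (\<lambda>i. \<Sum>k. g k i)"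
  have sm: "summable (\<lambda>k. lp_norm p (g k))" using \<alpha>_sm g by simp
  note sums = lp_seq_suminf [OF g(1) sm, folded x_def]
  have "x \<in> M"
  proof (rule closed [OF sums(2)], intro allI impI)
    fix d :: real assume "0 < d"
    then obtain K where K: "\<And>n. K \<le> n \<Longrightarrow> norm (\<Sum>i. \<alpha> (i + n)) < d"
      using suminf_exist_split [OF _ \<alpha>_sm] by blast
    have "x - (\<Sum>k<K. g k) = (\<lambda>i. \<Sum>k. g (k + K) i)"
    proof
      fix i
      show "(x - (\<Sum>k<K. g k)) i = (\<Sum>k. g (k + K) i)"
        using suminf_split_initial_segment [OF sums(1), of i K] by (simp add: x_def)
    qed
    then have "lp_norm p (x - (\<Sum>k<K. g k)) \<le> (\<Sum>k. lp_norm p (g (k + K)))"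
      using lp_seq_suminf(3) [of "\<lambda>k. g (k + K)"] g sm by (simp add: summable_ignore_initial_segment)
    also have "\<dots> < d" using K [of K] by (simp add: g abs_less_iff)
    finally have "lp_norm p (x - (\<Sum>k<K. g k)) < d" .
    moreover have "(\<Sum>k<K. g k) \<in> M"
      using M(2) u(1) by (intro V.subspace_sum) (auto simp: g_def intro: V.subspace_scale)
    ultimately show "\<exists>v\<in>M. lp_norm p (x - v) < d" by blast
  qed
  moreover have "1 / 2 \<le> lp_norm p ((T ^^ (m * k)) x)" for k
  proof -
    define D where "D = {n k..<n (Suc k)}"
    define Tk where "Tk = T ^^ (m * k)"
    have nD: "finite D" by (simp add: D_def)
    have tail_lp: "tail l (Tk (u j)) \<in> lp_seq p" for l j
      unfolding tail_def Tk_def by (rule lp_seq_dominated(1) [OF funpow_T_in [OF u_lp], of 1]) auto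
    \<comment> \<open>On the block all later humps vanish, so the series is a finite sum that can be
      solved for its k-th term.\<close>
    have Tk_sum: "of_real (\<alpha> k) * Tk (u k) i = Tk x i + (\<Sum>j<k. of_real (- \<alpha> j) * Tk (u j) i)"
      if "i \<in> D" for i
    proof -
      have Tk_x: "(\<lambda>j. Tk (g j) i) sums Tk x i"
        unfolding Tk_def x_def by (rule funpow_T_sums summable_sums sums(1))+
      have vanish: "Tk (g j) i = 0" if "j \<notin> {..<Suc k}" for j
      proof -
        have "n (Suc k) \<le> n j" using that by (intro n_mono) auto
        then have "Tk (u j) i = 0"
          unfolding Tk_def using \<open>i \<in> D\<close> that by (intro u0) (auto simp: D_def)
        then show ?thesis by (simp only: g_def Tk_def funpow_T_scale seq_scale_apply mult_zero_right)
      qed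
      have "Tk x i = (\<Sum>j<Suc k. Tk (g j) i)"
        by (rule sums_unique2 [OF Tk_x sums_finite [OF finite_lessThan vanish]])
      also have "\<dots> = (\<Sum>j<Suc k. of_real (\<alpha> j) * Tk (u j) i)"
        by (simp only: g_def Tk_def funpow_T_scale seq_scale_apply)
      finally show ?thesis by (simp add: sum_negf)
    qed
    have early: "lp_norm_on p D (Tk (u j)) \<le> e" if "j < k" for j
    proof -
      have "lp_norm_on p D (Tk (u j)) \<le> lp_norm_on p D (tail (n k) (Tk (u j)))"
        using nD by (intro lp_norm_on_mono) (auto simp: D_def tail_def)
      also have "\<dots> \<le> lp_norm p (tail (n k) (Tk (u j)))"
        by (intro lp_norm_on_le_lp_norm tail_lp nD)
      also have "\<dots> \<le> e" unfolding Tk_def using that by (intro tail_u) auto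
      finally show ?thesis .
    qed
    have "lp_norm p (Tk (u k)) \<le> lp_norm_on p D (Tk (u k)) + e"
    proof (rule lp_norm_leI(2))
      fix l
      have "lp_norm_on p {..<l} (Tk (u k)) =
          lp_norm_on p {..<l} (\<lambda>i. (if i < n (Suc k) then Tk (u k) i else 0) + tail (n (Suc k)) (Tk (u k)) i)"
        by (intro lp_norm_on_cong) (auto simp: tail_def)
      also have "\<dots> \<le> lp_norm_on p {..<l} (\<lambda>i. if i < n (Suc k) then Tk (u k) i else 0) +
          lp_norm_on p {..<l} (tail (n (Suc k)) (Tk (u k)))"
        by (rule lp_norm_on_triangle)
      also have "lp_norm_on p {..<l} (\<lambda>i. if i < n (Suc k) then Tk (u k) i else 0) = lp_norm_on p ({..<l} \<inter> D) (Tk (u k))"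
        unfolding lp_norm_on_def using u0 [of k k]
        by (intro arg_cong2 [where f = "(powr)"] sum.mono_neutral_cong_right) (auto simp: D_def Tk_def simp flip: not_less)
      also have "\<dots> \<le> lp_norm_on p D (Tk (u k))" using nD by (intro lp_norm_on_mono) auto
      also have "lp_norm_on p {..<l} (tail (n (Suc k)) (Tk (u k))) \<le> lp_norm p (tail (n (Suc k)) (Tk (u k)))"
        by (intro lp_norm_on_le_lp_norm tail_lp) simp
      also have "\<dots> \<le> e" unfolding Tk_def by (intro tail_u) auto
      finally show "lp_norm_on p {..<l} (Tk (u k)) \<le> lp_norm_on p D (Tk (u k)) + e" by simp
    qed
    then have "\<sigma> ^ k * \<sigma> ^ k - e \<le> lp_norm_on p D (Tk (u k))"
      using grow [of k] by (simp add: Tk_def)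
    then have "\<alpha> k * (\<sigma> ^ k * \<sigma> ^ k - e) \<le> \<alpha> k * lp_norm_on p D (Tk (u k))"
      using \<alpha>(1) [of k] by (intro mult_left_mono) auto
    also have "\<dots> = lp_norm_on p D (\<lambda>i. of_real (\<alpha> k) * Tk (u k) i)"
      using \<alpha>(1) [of k] by (simp add: lp_norm_on_scale)
    also have "\<dots> = lp_norm_on p D (\<lambda>i. Tk x i + (\<Sum>j<k. of_real (- \<alpha> j) * Tk (u j) i))"
      using Tk_sum by (intro lp_norm_on_cong arg_cong [where f = norm])
    also have "\<dots> \<le> lp_norm_on p D (Tk x) + lp_norm_on p D (\<lambda>i. \<Sum>j<k. of_real (- \<alpha> j) * Tk (u j) i)"
      by (rule lp_norm_on_triangle)
    also have "lp_norm_on p D (Tk x) \<le> lp_norm p (Tk x)"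
      using nD sums(2) unfolding Tk_def by (intro lp_norm_on_le_lp_norm funpow_T_in)
    also have "lp_norm_on p D (\<lambda>i. \<Sum>j<k. of_real (- \<alpha> j) * Tk (u j) i) \<le> (\<Sum>j<k. \<alpha> j * e)"
    proof (rule order_trans [OF lp_norm_on_sum sum_mono])
      fix j assume "j \<in> {..<k}"
      then show "lp_norm_on p D (\<lambda>i. of_real (- \<alpha> j) * Tk (u j) i) \<le> \<alpha> j * e"
        unfolding lp_norm_on_scale using \<alpha>(1) [of j] early [of j] by simp
    qed
    finally have "\<alpha> k * (\<sigma> ^ k * \<sigma> ^ k - e) \<le> lp_norm p (Tk x) + (\<Sum>j<k. \<alpha> j * e)" by simp
    moreover have "1 \<le> \<alpha> k * (\<sigma> ^ k * \<sigma> ^ k)"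
    proof -
      have eq: "\<alpha> k * (\<sigma> ^ k * \<sigma> ^ k) = \<sigma> ^ k"
        using \<alpha>(2) [of k] by (metis mult.assoc mult_1)
      show ?thesis unfolding eq using \<sigma> by (intro one_le_power) simp
    qed
    moreover have "(\<Sum>j<k. \<alpha> j * e) + \<alpha> k * e \<le> 1 / 2"
    proof -
      have "(\<Sum>j<k. \<alpha> j * e) + \<alpha> k * e = e * (\<Sum>j<Suc k. \<alpha> j)"
        unfolding sum.lessThan_Suc distrib_left sum_distrib_left by (simp only: mult.commute)
      also have "\<dots> \<le> e * suminf \<alpha>"
        using \<alpha>(1) \<alpha>_sm e by (intro mult_left_mono sum_le_suminf) (auto intro: less_imp_le)
      finally show ?thesis using e by simp
    qed
    ultimately have "1 / 2 \<le> lp_norm p (Tk x)"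
      unfolding right_diff_distrib by linarith
    then show ?thesis by (simp add: Tk_def)
  qed
  ultimately show ?thesis using that by blast
qed

text \<open>\<open>gliding_hump\<close> controls the orbit at multiples of m only. Any other time is
  at most m steps before the next multiple, and in those steps norms grow by at most
  \<open>L ^ m\<close>; so an orbit point of norm below \<open>1 / (2 * L ^ m)\<close> would force a
  norm below 1/2 at that multiple.\<close>

lemma no_hypercyclic_subspace:
  assumes m: "\<And>k. 1 \<le> k \<Longrightarrow> \<rho> \<le> norm (\<Prod>i=k..<k+m. \<omega> i)" "1 \<le> m" and \<rho>: "1 < \<rho>"
  shows "\<not> hypercyclic_subspace_in seq_scale (lp_seq p) (lp_norm p) T M"
proof
  assume H: "hypercyclic_subspace_in seq_scale (lp_seq p) (lp_norm p) T M"
  obtain \<sigma> N where \<sigma>: "1 < \<sigma>"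
    "\<And>x. x \<in> lp_seq p \<Longrightarrow> \<forall>k<N. x k = 0 \<Longrightarrow> \<sigma> * \<sigma> * lp_norm p x \<le> lp_norm p ((T ^^ m) x)"
    by (rule funpow_T_bounded_below [OF m(1) \<rho>]) (assumption, rule that)
  have M: "M \<subseteq> lp_seq p" "module.subspace seq_scale M" "\<not> finite_dimensional seq_scale M"
    and closed: "\<And>y. y \<in> lp_seq p \<Longrightarrow> \<forall>e>0. \<exists>v\<in>M. lp_norm p (y - v) < e \<Longrightarrow> y \<in> M"
    and dense: "\<And>x y e. x \<in> M \<Longrightarrow> x \<noteq> 0 \<Longrightarrow> y \<in> lp_seq p \<Longrightarrow> 0 < e \<Longrightarrow> \<exists>n. lp_norm p (y - (T ^^ n) x) < e"
    using H by (simp_all add: hypercyclic_subspace_in_def)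
  obtain x where x: "x \<in> M" "\<And>k. 1 / 2 \<le> lp_norm p ((T ^^ (m * k)) x)"
    by (rule gliding_hump [OF M closed \<sigma>]) (assumption | rule that)+
  have x_lp: "x \<in> lp_seq p" using M x(1) by blast
  have "x \<noteq> 0"
  proof
    assume "x = 0"
    with x(2) [of 0] show False by simp
  qed
  moreover have "0 < 1 / (2 * L ^ m)" using L by simp
  ultimately obtain n where "lp_norm p (0 - (T ^^ n) x) < 1 / (2 * L ^ m)"
    using dense [OF x(1) _ lp_seq_zero(1)] by blast
  then have n: "lp_norm p ((T ^^ n) x) < 1 / (2 * L ^ m)"
    using lp_norm_minus_commute [of 0 "(T ^^ n) x"] by simp
  define l where "l = m - n mod m"
  have "n mod m < m" using m(2) by simp
  moreover have "n = m * (n div m) + n mod m" by simp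
  moreover have "m * Suc (n div m) = m + m * (n div m)" by simp
  ultimately have l: "l + n = m * Suc (n div m)" "l \<le> m"
    unfolding l_def by linarith+
  have "1 / 2 \<le> lp_norm p ((T ^^ l) ((T ^^ n) x))"
    using x(2) [of "Suc (n div m)"] unfolding l(1) [symmetric] by (simp add: funpow_add)
  also have "\<dots> \<le> L ^ l * lp_norm p ((T ^^ n) x)"
    by (intro funpow_T_bound funpow_T_in x_lp)
  also have "\<dots> \<le> L ^ m * lp_norm p ((T ^^ n) x)"
    using L l by (intro mult_right_mono power_increasing) auto
  also have "\<dots> < L ^ m * (1 / (2 * L ^ m))"
    using n L by (intro mult_strict_left_mono) auto
  also have "\<dots> = 1 / 2" using L by simp
  finally show False by simp
qed

end

section \<open>Vectors with slowly growing orbits\<close>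

context shift_operator
begin

text \<open>If every far out index \<open>j\<close> had some \<open>m \<le> M\<close> with \<open>\<bar>\<omega> (j - m) \<cdots> \<omega> (j - 1)\<bar> > 2\<close>, chaining these
  steps downwards from \<open>k + n\<close> to \<open>k\<close> would make all long products of weights large.\<close>

lemma weight_products_grow:
  assumes step: "\<And>j. K0 \<le> j \<Longrightarrow> \<exists>m\<le>M. m \<le> j \<and> 2 * norm (W (j - m) * a (j - m)) < norm (W j * a j)"
  obtains n where "1 \<le> n" "\<And>k. 2 * norm (W k * a k) \<le> norm (W (k + n) * a (k + n))"
proof -
  define q where "q = (\<lambda>j. norm (W j * a j))"
  have q_pos: "0 < q j" for j by (simp add: q_def)
  have M: "1 \<le> M"
  proof (rule ccontr)
    assume "\<not> 1 \<le> M"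
    obtain m where m: "m \<le> M" "2 * q (K0 - m) < q K0"
      using step [of K0] by (auto simp: q_def)
    have "m = 0" using m(1) \<open>\<not> 1 \<le> M\<close> by simp
    with m(2) q_pos [of K0] show False by simp
  qed
  \<comment> \<open>Every downward step has length at most M and gains a factor 2, which is a gain
    of at least \<open>\<theta>\<close> per index.\<close>
  define \<theta> where "\<theta> = root M 2"
  have \<theta>: "1 < \<theta>" "\<theta> ^ M = 2" using M by (simp_all add: \<theta>_def)
  \<comment> \<open>The last step may jump below k; \<open>C ^ M\<close> pays for climbing back to k
    from its endpoint and for the partial step.\<close>
  have grow: "\<theta> ^ (j - k) * q k \<le> C ^ M * q j" if K0: "K0 \<le> k" and k_le: "k \<le> j" for j k
    using k_le
  proof (induction j rule: less_induct)
    case (less j)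
    obtain m where m: "m \<le> M" "m \<le> j" "2 * q (j - m) < q j"
      using step [of j] K0 less.prems by (auto simp: q_def)
    have m0: "m \<noteq> 0" using m(3) q_pos [of j] by (intro notI) simp
    show ?case
    proof (cases "k \<le> j - m")
      case True
      have "\<theta> ^ (j - k) * q k = \<theta> ^ m * (\<theta> ^ (j - m - k) * q k)"
        using True m by (simp flip: power_add mult.assoc)
      also have "\<dots> \<le> \<theta> ^ m * (C ^ M * q (j - m))"
        using True m m0 \<theta> by (intro mult_left_mono less.IH) auto
      also have "\<dots> \<le> 2 * (C ^ M * q (j - m))"
        using \<theta> m C1 q_pos [of "j - m"] power_increasing [of m M \<theta>] by (intro mult_right_mono) auto
      also have "\<dots> = C ^ M * (2 * q (j - m))" by simp
      also have "\<dots> \<le> C ^ M * q j" using C1 m by (intro mult_left_mono) auto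
      finally show ?thesis .
    next
      case False
      have "q k \<le> C ^ (k - (j - m)) * q (j - m)"
        using norm_W_add [of "j - m" "k - (j - m)"] False by (simp add: q_def)
      also have "\<dots> \<le> C ^ M * q (j - m)"
        using C1 False less.prems m q_pos [of "j - m"] by (intro mult_right_mono power_increasing) auto
      finally have k: "q k \<le> C ^ M * q (j - m)" .
      have "\<theta> ^ (j - k) \<le> \<theta> ^ M" using False m \<theta> by (intro power_increasing) auto
      then have "\<theta> ^ (j - k) * q k \<le> 2 * (C ^ M * q (j - m))"
        unfolding \<theta>(2) using k q_pos [of k] by (intro mult_mono) auto
      also have "\<dots> = C ^ M * (2 * q (j - m))" by simp
      also have "\<dots> \<le> C ^ M * q j" using C1 m by (intro mult_left_mono) auto
      finally show ?thesis .
    qed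
  qed
  \<comment> \<open>Steps are available only from \<open>K0\<close> on. For smaller k the value
    \<open>q k\<close> is replaced by its bound \<open>D * q K0\<close>.\<close>
  define D where "D = (\<Sum>i\<le>K0. q i / q K0)"
  have D: "q i \<le> D * q K0" if "i \<le> K0" for i
  proof -
    have "q i / q K0 \<le> D"
      unfolding D_def using that q_pos less_imp_le by (intro member_le_sum) (auto intro!: divide_nonneg_nonneg)
    then show ?thesis using q_pos [of K0] by (simp add: field_simps)
  qed
  have D1: "1 \<le> D" using D [of K0] q_pos [of K0] by simp
  obtain n0 where n0: "2 * C ^ M * D < \<theta> ^ n0" using real_arch_pow [OF \<theta>(1)] by blast
  show ?thesis
  \<comment> \<open>\<open>n0\<close> lets the growth beat \<open>2 * C ^ M * D\<close>. The summand
    \<open>K0\<close> leaves at least n0 indices above \<open>K0\<close> even when k is below it,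
    and the summand 1 ensures \<open>1 \<le> n\<close>.\<close>
  proof (rule that [of "n0 + K0 + 1"])
    fix k
    define n where "n = n0 + K0 + 1"
    have "\<theta> ^ n0 * q k \<le> D * (C ^ M * q (k + n))"
    proof (cases "K0 \<le> k")
      case True
      have "\<theta> ^ n0 * q k \<le> \<theta> ^ (k + n - k) * q k"
        using \<theta> q_pos [of k] by (intro mult_right_mono power_increasing) (auto simp: n_def)
      also have "\<dots> \<le> C ^ M * q (k + n)" using True by (intro grow) auto
      also have "\<dots> \<le> D * (C ^ M * q (k + n))" using D1 C1 q_pos [of "k + n"] by simp
      finally show ?thesis .
    next
      case False
      have "\<theta> ^ n0 * q k \<le> \<theta> ^ (k + n - K0) * (D * q K0)"
        using \<theta> q_pos [of k] False by (intro mult_mono power_increasing D) (auto simp: n_def)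
      also have "\<dots> = D * (\<theta> ^ (k + n - K0) * q K0)" by simp
      also have "\<dots> \<le> D * (C ^ M * q (k + n))" using D1 by (intro mult_left_mono grow) (auto simp: n_def)
      finally show ?thesis .
    qed
    moreover have "2 * C ^ M * D * q k \<le> \<theta> ^ n0 * q k"
      using n0 q_pos [of k] by (intro mult_right_mono) auto
    ultimately have "(C ^ M * D) * (2 * q k) \<le> (C ^ M * D) * q (k + n)"
      by (simp add: mult_ac)
    moreover have "0 < C ^ M * D" using C1 D1 by simp
    ultimately show "2 * norm (W k * a k) \<le> norm (W (k + (n0 + K0 + 1)) * a (k + (n0 + K0 + 1)))"
      by (simp only: mult_le_cancel_left_pos n_def q_def)
  qed simp
qed

text \<open>\<open>S ^^ n\<close> maps the unit vector at j to this product times the unit vector at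
  \<open>j - n\<close>, so j is slow when that vector is at most doubled in norm.\<close>

definition slow_indices :: "nat \<Rightarrow> nat set" where
  "slow_indices n = {j. n \<le> j \<and> norm (\<Prod>i=j-n..<j. \<omega> i) \<le> 2}"

lemma norm_prod_\<omega>: "n \<le> j \<Longrightarrow> norm (\<Prod>i=j-n..<j. \<omega> i) = norm (W j * a j) / norm (W (j - n) * a (j - n))"
  using prod_\<omega> [of "j - n" n] by (simp only: le_add_diff_inverse2 norm_divide)

text \<open>If no such j existed, \<open>weight_products_grow\<close> would give an n for which all
  products of n consecutive weights are at least 2, against the assumption on the infimum. Starting
  at \<open>K0 + M\<close> guarantees \<open>m \<le> j\<close>, so failing to be slow really means a
  large product.\<close>

lemma slow_indices_infinite:
  assumes "\<And>n. 1 \<le> n \<Longrightarrow> (INF k\<in>{1..}. norm (\<Prod>i=k..<k+n. \<omega> i)) \<le> 1"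
  shows "\<exists>j\<ge>K0. \<forall>m\<le>M. j \<in> slow_indices m"
proof (rule ccontr)
  assume *: "\<not> ?thesis"
  have "\<exists>m\<le>M. m \<le> j \<and> 2 * norm (W (j - m) * a (j - m)) < norm (W j * a j)" if j: "K0 + M \<le> j" for j
  proof -
    obtain m where m: "m \<le> M" "j \<notin> slow_indices m"
      using * j by (metis add_leD1)
    then have "2 < norm (W j * a j) / norm (W (j - m) * a (j - m))"
      using j by (simp add: slow_indices_def norm_prod_\<omega> not_le del: norm_mult)
    then show ?thesis using m j by (intro exI [of _ m]) (simp add: field_simps)
  qed
  then obtain n where n: "1 \<le> n" "\<And>k. 2 * norm (W k * a k) \<le> norm (W (k + n) * a (k + n))"
    by (rule weight_products_grow) (assumption, rule that)
  have "2 \<le> (INF k\<in>{1..}. norm (\<Prod>i=k..<k+n. \<omega> i))"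
  proof (rule cINF_greatest)
    fix k
    have "0 < norm (W k * a k)" by simp
    then show "2 \<le> norm (\<Prod>i=k..<k+n. \<omega> i)"
      unfolding prod_\<omega> norm_divide using n(2) [of k] by (simp only: pos_le_divide_eq)
  qed auto
  with assms [OF n(1)] show False by simp
qed

text \<open>The constant is 2 + 1: \<open>S ^^ n\<close> at most doubles the norm, by comparison
  coordinate by coordinate, and far out \<open>T ^^ n\<close> differs from it by at most the norm of
  \<open>x\<close>. The bound covers all sequences supported on slow indices, not just single basis
  vectors.\<close>

lemma funpow_T_bound_slow:
  shows "\<exists>N. \<forall>x\<in>lp_seq p. (\<forall>j. x j \<noteq> 0 \<longrightarrow> N \<le> j \<and> j \<in> slow_indices n) \<longrightarrow>
    lp_norm p ((T ^^ n) x) \<le> 3 * lp_norm p x"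
proof -
  obtain N where N: "\<And>x. x \<in> lp_seq p \<Longrightarrow> \<forall>k<N. x k = 0 \<Longrightarrow>
      lp_norm p ((T ^^ n) x - (S ^^ n) x) \<le> 1 * lp_norm p x"
    using funpow_T_near_funpow_S [of 1 n] by auto
  have "lp_norm p ((T ^^ n) x) \<le> 3 * lp_norm p x"
    if x: "x \<in> lp_seq p" and supp: "\<forall>j. x j \<noteq> 0 \<longrightarrow> N \<le> j \<and> j \<in> slow_indices n" for x
  proof -
    have "norm ((S ^^ n) x k) \<le> 2 * norm (x (k + n))" for k
    proof (cases "x (k + n) = 0")
      case False
      then have "k + n \<in> slow_indices n" using supp by blast
      then have "norm (\<Prod>i=k..<k+n. \<omega> i) \<le> 2" by (simp add: slow_indices_def)
      then show ?thesis unfolding funpow_S norm_mult by (intro mult_right_mono) auto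
    qed (simp add: funpow_S)
    then have "lp_norm p ((S ^^ n) x) \<le> 2 * lp_norm p (\<lambda>k. x (k + n))"
      by (intro lp_seq_dominated(2) lp_seq_shift(1) x) auto
    also have "\<dots> \<le> 2 * lp_norm p x" using lp_seq_shift(2) [OF x] by simp
    finally have S: "lp_norm p ((S ^^ n) x) \<le> 2 * lp_norm p x" .
    have "\<forall>k<N. x k = 0" using supp not_le by blast
    from N [OF x this] have "lp_norm p ((T ^^ n) x - (S ^^ n) x) \<le> lp_norm p x" by simp
    moreover have "lp_norm p ((T ^^ n) x) - lp_norm p ((S ^^ n) x) \<le> lp_norm p ((T ^^ n) x - (S ^^ n) x)"
      using funpow_S_bound [OF x] by (intro lp_norm_triangle_rev funpow_T_in x) auto
    ultimately show ?thesis using S by simp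
  qed
  then show ?thesis by blast
qed

text \<open>An exact right inverse of \<open>T ^^ m\<close>: Taylor coefficients move up by m and
  the weights are divided out. Inverting \<open>S\<close> instead would leave an error caused by
  \<open>K\<close>.\<close>

definition shift_right :: "nat \<Rightarrow> (nat \<Rightarrow> complex) \<Rightarrow> nat \<Rightarrow> complex" where
  "shift_right m y = untaylor (\<lambda>k. if k < m then 0 else taylor y (k - m) * W (k - m) / W k)"

lemma shift_right_0 [simp]: "shift_right 0 y = y"
  by (simp add: shift_right_def)

lemma funpow_T_shift_right:
  assumes "n \<le> m"
  shows "(T ^^ n) (shift_right m y) = shift_right (m - n) y"
proof -
  have "taylor ((T ^^ n) (shift_right m y)) k = taylor (shift_right (m - n) y) k" for k
    using assms by (auto simp: taylor_funpow_T shift_right_def less_diff_conv)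
  then have "taylor ((T ^^ n) (shift_right m y)) = taylor (shift_right (m - n) y)" by (rule ext)
  then show ?thesis by (simp only: taylor_inject)
qed

text \<open>The vector may use f_(d-1), which has a term of degree d; hence the strict inequality
  \<open>d < n\<close>.\<close>

lemma funpow_T_eq_0:
  assumes "\<And>k. d \<le> k \<Longrightarrow> y k = 0" "d < n"
  shows "(T ^^ n) y = 0"
proof -
  have "taylor y (k + n) = 0" for k
    using assms by (auto simp: taylor_def split: nat.split)
  then have "taylor ((T ^^ n) y) k = taylor 0 k" for k
    by (simp add: taylor_funpow_T)
  then have "taylor ((T ^^ n) y) = taylor 0" by (rule ext)
  then show ?thesis by (simp only: taylor_inject)
qed

text \<open>After division by \<open>a\<close>, the shifted Taylor coefficients sit at m, ..., m + d
  with the numbers \<open>W (m + k) * a (m + k)\<close> in the denominators. Unboundedness makes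
  only one value large; placing it at the top index m + d makes the d preceding values large too, at
  a loss of at most \<open>C ^ d\<close>.\<close>

lemma shift_right_small:
  assumes unbounded: "\<And>B. \<exists>n. B < norm (W n * a n)"
    and y: "\<And>k. d \<le> k \<Longrightarrow> y k = 0" and e: "0 < e"
  shows "\<exists>m\<ge>m0. shift_right m y \<in> lp_seq p \<and> lp_norm p (shift_right m y) \<le> e"
proof -
  define A where "A = (\<Sum>k\<le>d. norm (taylor y k * W k))"
  have A0: "0 \<le> A" by (simp add: A_def sum_nonneg)
  \<comment> \<open>Chosen so that \<open>R * (A / B) \<le> e\<close>; the summand 1 keeps
    \<open>B\<close> positive when \<open>A\<close> is 0.\<close>
  define B where "B = R * (A + 1) / e"
  have B0: "0 < B" using R(1) A0 e by (simp add: B_def)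
  \<comment> \<open>\<open>c\<close> dominates all values up to \<open>m0 + d\<close>, so a value
    exceeding it must occur at a later index.\<close>
  define c where "c = (\<Sum>i\<le>m0 + d. norm (W i * a i))"
  obtain N where N: "c + B * C ^ d < norm (W N * a N)" using unbounded by blast
  have N_ge: "m0 + d < N"
  proof (rule ccontr)
    assume "\<not> m0 + d < N"
    then have "norm (W N * a N) \<le> c"
      unfolding c_def by (intro member_le_sum) auto
    moreover have "0 \<le> B * C ^ d" using B0 C1 by simp
    ultimately show False using N by simp
  qed
  define m where "m = N - d"
  have m: "m0 \<le> m" "m + d = N" using N_ge by (auto simp: m_def)
  have large: "B \<le> norm (W (m + k) * a (m + k))" if "k \<le> d" for k
  proof -
    have "B * C ^ d \<le> norm (W N * a N)"
      using N sum_nonneg [of "{..m0 + d}" "\<lambda>i. norm (W i * a i)"] by (simp add: c_def)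
    also have "\<dots> \<le> C ^ (d - k) * norm (W (m + k) * a (m + k))"
      using norm_W_add [of "m + k" "d - k"] that m by simp
    also have "\<dots> \<le> C ^ d * norm (W (m + k) * a (m + k))"
      using C1 by (intro mult_right_mono power_increasing) auto
    finally show ?thesis using C1 by (simp add: mult.commute [of B])
  qed
  define z where "z = (\<lambda>k. (if k < m then 0 else taylor y (k - m) * W (k - m) / W k) / a k)"
  have tay: "taylor y k = 0" if "d < k" for k
    using y that by (auto simp: taylor_def split: nat.split)
  have z0: "z k = 0" if "m + d + 1 \<le> k" for k
    using that tay [of "k - m"] by (auto simp: z_def)
  have z: "z \<in> lp_seq p" "lp_norm p z \<le> (\<Sum>i<m + d + 1. norm (z i))"
    using lp_norm_le_sum [of "m + d + 1" z, OF z0] by blast+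
  have "(\<Sum>i<m + d + 1. norm (z i)) = (\<Sum>k\<le>d. norm (z (m + k)))"
  proof -
    have "(\<Sum>i<m + d + 1. norm (z i)) = (\<Sum>i\<in>(\<lambda>k. m + k) ` {..d}. norm (z i))"
    proof (rule sum.mono_neutral_right)
      show "\<forall>i\<in>{..<m + d + 1} - (\<lambda>k. m + k) ` {..d}. norm (z i) = 0"
      proof
        fix i assume i: "i \<in> {..<m + d + 1} - (\<lambda>k. m + k) ` {..d}"
        have "i < m"
        proof (rule ccontr)
          assume "\<not> i < m"
          moreover have "i < m + d + 1" using i by simp
          ultimately have "i = m + (i - m)" "i - m \<in> {..d}" by auto
          then show False using i by blast
        qed
        then show "norm (z i) = 0" by (simp add: z_def)
      qed
    qed auto
    then show ?thesis by (simp add: sum.reindex)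
  qed
  also have "\<dots> \<le> (\<Sum>k\<le>d. norm (taylor y k * W k) / B)"
  proof (rule sum_mono)
    fix k assume "k \<in> {..d}"
    then have "norm (taylor y k * W k) / norm (W (m + k) * a (m + k)) \<le> norm (taylor y k * W k) / B"
      using B0 by (intro divide_left_mono large mult_pos_pos) auto
    then show "norm (z (m + k)) \<le> norm (taylor y k * W k) / B"
      by (simp add: z_def norm_divide norm_mult)
  qed
  also have "\<dots> = A / B" by (simp add: A_def sum_divide_distrib)
  finally have "lp_norm p z \<le> A / B" using z(2) by simp
  then have "R * lp_norm p z \<le> R * (A / B)" using R(1) by (intro mult_left_mono) auto
  also have "\<dots> = A / (A + 1) * e" using R(1) A0 e by (simp add: B_def)
  also have "\<dots> \<le> e" using A0 e by (simp add: field_simps)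
  finally have "R * lp_norm p z \<le> e" .
  moreover have "shift_right m y = solve_recurrence \<beta> z"
    by (simp add: shift_right_def untaylor_def z_def)
  ultimately show ?thesis using R(2,3) [OF z(1)] m(1) by (intro exI [of _ m]) auto
qed

end

text \<open>Finite lists over a countable dense set of scalars, padded by zeros and numbered through
  the countability of lists. Truncation and rounding cost e/3 each. Finite support makes these
  vectors accessible to \<open>shift_right_small\<close> and \<open>funpow_T_eq_0\<close>.\<close>

lemma dense_finitely_supported_sequence:
  assumes "1 \<le> p"
  obtains D :: "nat \<Rightarrow> nat \<Rightarrow> complex" and d :: "nat \<Rightarrow> nat"
  where "\<And>i k. d i \<le> k \<Longrightarrow> D i k = 0"
    "\<And>x e. x \<in> lp_seq p \<Longrightarrow> 0 < e \<Longrightarrow> \<exists>i. lp_norm p (x - D i) < e"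
proof -
  interpret lp_space p by (unfold_locales) fact
  obtain Q :: "complex set" where Q: "countable Q" "\<And>X. open X \<Longrightarrow> X \<noteq> {} \<Longrightarrow> \<exists>q\<in>Q. q \<in> X"
    using countable_dense_setE by blast
  have Q_ne: "Q \<noteq> {}" using Q(2) [of UNIV] by auto
  define q where "q = from_nat_into Q"
  have q: "\<exists>i. norm (z - q i) < e" if e: "0 < e" for z e
  proof -
    obtain y where "y \<in> Q" "y \<in> ball z e"
      using Q(2) [of "ball z e"] e by auto
    moreover obtain i where "y = q i"
      using \<open>y \<in> Q\<close> Q(1) Q_ne by (metis q_def from_nat_into_surj)
    ultimately show ?thesis by (auto simp: dist_norm)
  qed
  define D where "D = (\<lambda>i k. let l = (from_nat i :: nat list) in if k < length l then q (l ! k) else 0)"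
  show ?thesis
  proof (rule that [of "\<lambda>i. length (from_nat i :: nat list)" D])
    fix x and e :: real assume x: "x \<in> lp_seq p" and e: "0 < e"
    obtain N where N: "lp_norm p (\<lambda>i. if i < N then 0 else x i) \<le> e / 3"
      using lp_norm_truncate [OF x, of "e / 3"] e by auto
    have "\<exists>i. norm (x k - q i) < e / (3 * (real N + 1))" for k
      using e by (intro q) simp
    then obtain c where c: "\<And>k. norm (x k - q (c k)) < e / (3 * (real N + 1))" by metis
    define l where "l = map c [0..<N]"
    define h where "h = (\<lambda>k. if k < N then x k - q (c k) else 0)"
    have h: "h \<in> lp_seq p" "lp_norm p h \<le> (\<Sum>k<N. norm (h k))"
      using lp_norm_le_sum [of N h] by (auto simp: h_def)
    note h(2)
    also have "(\<Sum>k<N. norm (h k)) \<le> (\<Sum>k<N. e / (3 * (real N + 1)))"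
      using c by (intro sum_mono) (auto simp: h_def intro: less_imp_le)
    also have "\<dots> \<le> e / 3" using e by (simp add: field_simps)
    finally have h_le: "lp_norm p h \<le> e / 3" .
    have t: "(\<lambda>i. if i < N then 0 else x i) \<in> lp_seq p"
      by (rule lp_seq_dominated(1) [OF x, of 1]) auto
    have "x - D (to_nat l) = (\<lambda>i. if i < N then 0 else x i) + h"
      by (auto simp: D_def l_def h_def fun_eq_iff)
    then have "lp_norm p (x - D (to_nat l)) \<le> lp_norm p (\<lambda>i. if i < N then 0 else x i) + lp_norm p h"
      using lp_seq_add(2) [OF t h(1)] by simp
    also have "\<dots> < e" using N h_le e by simp
    finally show "\<exists>i. lp_norm p (x - D i) < e" ..
  qed (simp add: D_def Let_def)
qed

section \<open>Construction of a hypercyclic subspace\<close>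

text \<open>Unit vectors are independent because the k-th coordinate vanishes on the span of the
  others.\<close>

lemma infinite_dimensional_seq:
  assumes "infinite J" and unit: "\<And>k. k \<in> J \<Longrightarrow> (\<lambda>i. if i = k then 1 else 0) \<in> X"
  shows "\<not> finite_dimensional seq_scale X"
proof
  interpret V: vector_space seq_scale by (rule vector_space_seq_scale)
  assume "finite_dimensional seq_scale X"
  then obtain B where B: "finite B" "X \<subseteq> V.span B" by (auto simp: finite_dimensional_def)
  define e where "e = (\<lambda>k i::nat. if i = k then 1 else (0::complex))"
  have e_inj: "inj_on e J"
  proof (rule inj_onI)
    fix k l assume "e k = e l"
    then have "e k k = e l k" by simp
    then show "k = l" by (simp add: e_def split: if_splits)
  qed
  have "V.independent (e ` J)"
    unfolding V.dependent_def
  proof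
    assume "\<exists>x\<in>e ` J. x \<in> V.span (e ` J - {x})"
    then obtain k where k: "e k \<in> V.span (e ` J - {e k})" by blast
    have "V.subspace {x. x k = 0}" by (rule V.subspaceI) auto
    moreover have "e ` J - {e k} \<subseteq> {x. x k = 0}" by (auto simp: e_def)
    ultimately have "V.span (e ` J - {e k}) \<subseteq> {x. x k = 0}" by (intro V.span_minimal)
    with k show False by (auto simp: e_def)
  qed
  moreover have "e ` J \<subseteq> V.span B" using unit B(2) by (auto simp: e_def)
  ultimately have "finite (e ` J)" using V.independent_span_bound [OF B(1)] by blast
  with e_inj assms(1) show False using finite_imageD by blast
qed

context shift_operator
begin

text \<open>The subspace is the image of \<open>X\<close>, the sequences supported on the chosen
  indices, under \<open>A x = x + V x\<close>, where V adds \<open>x (j (\<iota> s))\<close> times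
  the correction \<open>g s\<close> for every s. At time \<open>n s\<close> the part x becomes
  small, corrections before s are killed, the s-th becomes \<open>D (\<tau> s)\<close> and later
  ones are still small. So the orbit of \<open>A x\<close> is then close to
  \<open>x (j (\<iota> s))\<close> times \<open>D (\<tau> s)\<close>.\<close>

lemma hypercyclic_subspace_exists:
  assumes unbounded: "\<And>B. \<exists>n. B < norm (W n * a n)"
    and slow: "\<And>n. 1 \<le> n \<Longrightarrow> (INF k\<in>{1..}. norm (\<Prod>i=k..<k+n. \<omega> i)) \<le> 1"
  shows "\<exists>M. hypercyclic_subspace_in seq_scale (lp_seq p) (lp_norm p) T M"
proof -
  interpret V: vector_space seq_scale by (rule vector_space_seq_scale)
  obtain D :: "nat \<Rightarrow> nat \<Rightarrow> complex" and d :: "nat \<Rightarrow> nat"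
    where D0: "\<And>i k. d i \<le> k \<Longrightarrow> D i k = 0"
      and D: "\<And>x e. x \<in> lp_seq p \<Longrightarrow> 0 < e \<Longrightarrow> \<exists>i. lp_norm p (x - D i) < e"
    using dense_finitely_supported_sequence [OF p] by metis
  obtain Nf where Nf: "\<And>n x. x \<in> lp_seq p \<Longrightarrow> \<forall>j. x j \<noteq> 0 \<longrightarrow> Nf n \<le> j \<and> j \<in> slow_indices n \<Longrightarrow>
      lp_norm p ((T ^^ n) x) \<le> 3 * lp_norm p x"
    using funpow_T_bound_slow by metis
  define good where "good = (\<lambda>n. {j. Nf n \<le> j \<and> j \<in> slow_indices n})"
  have good_bound: "lp_norm p ((T ^^ n) x) \<le> 3 * lp_norm p x"
    if "x \<in> lp_seq p" "\<And>j. x j \<noteq> 0 \<Longrightarrow> j \<in> good n" for x n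
    using that Nf [of x n] by (simp add: good_def)
  have good_ex: "\<exists>j>n. \<forall>m\<le>n. j \<in> good m" for n
  proof -
    obtain j where j: "Suc n + (\<Sum>m\<le>n. Nf m) \<le> j" "\<forall>m\<le>n. j \<in> slow_indices m"
      using slow_indices_infinite [OF slow] by blast
    have "Nf m \<le> j" if "m \<le> n" for m
      using member_le_sum [of m "{..n}" Nf] that j(1) by simp
    with j show ?thesis by (intro exI [of _ j]) (auto simp: good_def)
  qed
  \<comment> \<open>s encodes a coordinate \<open>\<iota> s\<close>, a dense vector
    \<open>\<tau> s\<close> and a free third entry, so that every pair occurs for arbitrarily large
    s.\<close>
  define \<iota> where "\<iota> = (\<lambda>s. fst (prod_decode s))"
  define \<tau> where "\<tau> = (\<lambda>s. fst (prod_decode (snd (prod_decode s))))"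
  \<comment> \<open>\<open>j + 2 \<le> n\<close> because f_j has degree at most j + 1 and has to be
    killed at time n. In \<open>Q\<close>, the gap \<open>d (\<tau> s)\<close> lets time n' kill the
    s-th correction, and the factor \<open>L ^ n\<close> keeps the next correction small at time n
    and at all earlier times.\<close>
  define P :: "nat \<Rightarrow> nat \<times> nat \<Rightarrow> bool" where
    "P = (\<lambda>s (j, n). j + 2 \<le> n \<and> shift_right n (D (\<tau> s)) \<in> lp_seq p \<and>
       lp_norm p (shift_right n (D (\<tau> s))) \<le> (1/4) ^ Suc s)"
  define Q :: "nat \<Rightarrow> nat \<times> nat \<Rightarrow> nat \<times> nat \<Rightarrow> bool" where
    "Q = (\<lambda>s (j, n) (j', n'). n < j' \<and> (\<forall>m\<le>n. j' \<in> good m) \<and> n + d (\<tau> s) < n' \<and>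
       L ^ n * lp_norm p (shift_right n' (D (\<tau> (Suc s)))) \<le> (1/4) ^ Suc (Suc s))"
  have small: "\<exists>m\<ge>m0. shift_right m (D i) \<in> lp_seq p \<and> lp_norm p (shift_right m (D i)) \<le> e" if "0 < e" for i m0 e
    by (rule shift_right_small [OF unbounded _ that, of "d i"]) (rule D0)
  have "\<exists>f. \<forall>s. P s (f s) \<and> Q s (f s) (f (Suc s))"
  proof (rule dependent_nat_choice)
    obtain n where "2 \<le> n" "shift_right n (D (\<tau> 0)) \<in> lp_seq p \<and> lp_norm p (shift_right n (D (\<tau> 0))) \<le> 1/4"
      using small [of "1/4" 2 "\<tau> 0"] by auto
    then have "P 0 (0, n)" by (simp add: P_def)
    then show "\<exists>x. P 0 x" ..
  next
    fix x s assume "P s x"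
    obtain j n where x: "x = (j, n)" by (cases x)
    obtain j' where j': "n < j'" "\<forall>m\<le>n. j' \<in> good m" using good_ex by blast
    have pos: "0 < (1/4) ^ Suc (Suc s) / L ^ n" using L by simp
    obtain n' where n': "j' + 2 + n + d (\<tau> s) + 1 \<le> n'" "shift_right n' (D (\<tau> (Suc s))) \<in> lp_seq p"
        "lp_norm p (shift_right n' (D (\<tau> (Suc s)))) \<le> (1/4) ^ Suc (Suc s) / L ^ n"
      using small [OF pos] by blast
    have Ln: "1 \<le> L ^ n" using L by (intro one_le_power)
    then have "0 < L ^ n" by simp
    have le: "L ^ n * lp_norm p (shift_right n' (D (\<tau> (Suc s)))) \<le> (1/4) ^ Suc (Suc s)"
      using n'(3) unfolding pos_le_divide_eq [OF \<open>0 < L ^ n\<close>] by (simp only: mult.commute)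
    moreover have "lp_norm p (shift_right n' (D (\<tau> (Suc s)))) \<le> L ^ n * lp_norm p (shift_right n' (D (\<tau> (Suc s))))"
      using Ln mult_right_mono [OF Ln lp_norm_nonneg [of "shift_right n' (D (\<tau> (Suc s)))"]] by simp
    ultimately have "P (Suc s) (j', n')" "Q s x (j', n')"
      unfolding P_def Q_def x using n' j' by auto
    then show "\<exists>y. P (Suc s) y \<and> Q s x y" by blast
  qed
  then obtain f where f: "\<And>s. P s (f s)" "\<And>s. Q s (f s) (f (Suc s))" by blast
  define j n where "j = (\<lambda>s. fst (f s))" and "n = (\<lambda>s. snd (f s))"
  have f_eq: "f s = (j s, n s)" for s by (simp add: j_def n_def)
  define Y where "Y = (\<lambda>s. D (\<tau> s))"
  define g where "g = (\<lambda>s. shift_right (n s) (Y s))"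
  have jn: "j s + 2 \<le> n s" and g: "g s \<in> lp_seq p" "lp_norm p (g s) \<le> (1/4) ^ Suc s" for s
    using f(1) [of s] unfolding P_def f_eq by (simp_all add: g_def Y_def)
  have nj: "n s < j (Suc s)" and good: "\<And>m. m \<le> n s \<Longrightarrow> j (Suc s) \<in> good m"
    and nd: "n s + d (\<tau> s) < n (Suc s)" and Lg: "L ^ n s * lp_norm p (g (Suc s)) \<le> (1/4) ^ Suc (Suc s)" for s
    using f(2) [of s] unfolding Q_def f_eq by (simp_all add: g_def Y_def)
  have n_mono: "n s \<le> n t" if "s \<le> t" for s t
    using lift_Suc_mono_le [of n, OF _ that] nd by (meson add_leD1 less_imp_le)
  have n_ge: "s \<le> n s" for s
  proof (induction s)
    case (Suc s)
    then show ?case using nd [of s] by simp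
  qed simp
  have j_less: "j s < j (Suc s)" for s using jn [of s] nj [of s] by simp
  have j_mono: "strict_mono j" using j_less by (rule strict_mono_Suc_iff [THEN iffD2, rule_format])
  have n_less_j: "n s < j t" if "s < t" for s t
    using that nj [of s] strict_mono_less_eq [OF j_mono, of "Suc s" t] by simp
  have Tg_less: "(T ^^ n s) (g t) = 0" if "t < s" for s t
  proof -
    have "n t + d (\<tau> t) < n s" using nd [of t] n_mono [of "Suc t" s] that by simp
    then have "(T ^^ (n s - n t)) (Y t) = 0"
      by (intro funpow_T_eq_0 [of "d (\<tau> t)"]) (auto simp: Y_def D0)
    moreover have "(T ^^ n s) (g t) = (T ^^ (n s - n t)) ((T ^^ n t) (g t))"
    proof -
      have "n s = (n s - n t) + n t" using n_mono [of t s] that by simp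
      then show ?thesis by (metis funpow_add o_apply)
    qed
    ultimately show ?thesis by (simp add: g_def funpow_T_shift_right)
  qed
  have Tg_eq: "(T ^^ n s) (g s) = Y s" for s
    by (simp add: g_def funpow_T_shift_right)
  have Tg_greater: "lp_norm p ((T ^^ n s) (g t)) \<le> (1/4) ^ Suc t" if "s < t" for s t
  proof -
    obtain t' where t': "t = Suc t'" "s \<le> t'" using \<open>s < t\<close> by (cases t) auto
    have "lp_norm p ((T ^^ n s) (g t)) \<le> L ^ n s * lp_norm p (g t)" by (rule funpow_T_bound [OF g(1)])
    also have "\<dots> \<le> L ^ n t' * lp_norm p (g t)"
      using L n_mono [OF t'(2)] by (intro mult_right_mono power_increasing) auto
    also have "\<dots> \<le> (1/4) ^ Suc t" using Lg [of t'] t' by simp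
    finally show ?thesis .
  qed
  \<comment> \<open>One factor 1/2 of each 1/4 makes the series over t converge; the other is saved
    to make its sum small for large s.\<close>
  have quarter: "(1/4::real) ^ Suc t \<le> (1/2) ^ s * (1/2) ^ Suc t" if "s \<le> Suc t" for s t
  proof -
    have "(1/4::real) ^ Suc t = (1/2) ^ Suc t * (1/2) ^ Suc t"
      by (subst power_mult_distrib [symmetric]) simp
    also have "\<dots> \<le> (1/2) ^ s * (1/2) ^ Suc t"
      by (intro mult_right_mono power_decreasing that) auto
    finally show ?thesis .
  qed
  have half_sum: "(\<lambda>t. (1/2::real) ^ Suc t) sums 1" by (rule power_half_series)
  define c where "c = (\<lambda>(x::nat \<Rightarrow> complex) s. x (j (\<iota> s)))"
  have c_le: "norm (c x s) \<le> lp_norm p x" if "x \<in> lp_seq p" for x s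
    using that by (simp add: c_def norm_le_lp_norm)
  \<comment> \<open>Used twice: for \<open>V\<close> with \<open>\<delta> = 1/2\<close>, and for the
    corrections still ahead at time \<open>n s\<close> with
    \<open>\<delta> = (1/2) ^ s\<close>.\<close>
  have series: "(\<forall>k. summable (\<lambda>t. c x t * h t k)) \<and> (\<lambda>k. \<Sum>t. c x t * h t k) \<in> lp_seq p \<and>
      lp_norm p (\<lambda>k. \<Sum>t. c x t * h t k) \<le> \<delta> * lp_norm p x"
    if x: "x \<in> lp_seq p" and h: "\<And>t. h t \<in> lp_seq p" "\<And>t. lp_norm p (h t) \<le> \<delta> * (1/2) ^ Suc t" for x h \<delta>
  proof -
    have u: "seq_scale (c x t) (h t) \<in> lp_seq p" for t by (intro lp_seq_scale h)
    have le: "lp_norm p (seq_scale (c x t) (h t)) \<le> (\<delta> * lp_norm p x) * (1/2) ^ Suc t" for t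
    proof -
      have "lp_norm p (seq_scale (c x t) (h t)) = norm (c x t) * lp_norm p (h t)"
        by (rule lp_norm_scale [OF h(1)])
      also have "\<dots> \<le> lp_norm p x * (\<delta> * (1/2) ^ Suc t)"
        by (intro mult_mono c_le x h) auto
      finally show ?thesis by (simp add: mult_ac)
    qed
    have dom: "(\<lambda>t. (\<delta> * lp_norm p x) * (1/2) ^ Suc t) sums (\<delta> * lp_norm p x)"
      using sums_mult [OF half_sum, of "\<delta> * lp_norm p x"] by simp
    have sm: "summable (\<lambda>t. lp_norm p (seq_scale (c x t) (h t)))"
      by (rule summable_comparison_test' [OF sums_summable [OF dom], of 0]) (use le in auto)
    have "(\<Sum>t. lp_norm p (seq_scale (c x t) (h t))) \<le> \<delta> * lp_norm p x"
      using suminf_le [OF le sm sums_summable [OF dom]] sums_unique [OF dom] by simp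
    with lp_seq_suminf [OF u sm] show ?thesis by (auto simp: seq_scale_def)
  qed
  define V where "V = (\<lambda>x k. \<Sum>s. c x s * g s k)"
  have g_le: "lp_norm p (g s) \<le> 1/2 * (1/2) ^ Suc s" for s
    using g(2) [of s] quarter [of 1 s] by simp
  have V: "\<And>k. summable (\<lambda>t. c x t * g t k)" "V x \<in> lp_seq p" "lp_norm p (V x) \<le> 1/2 * lp_norm p x"
    if "x \<in> lp_seq p" for x
    using series [OF that g(1) g_le] unfolding V_def by blast+
  have V_add: "V (x + y) = V x + V y" if "x \<in> lp_seq p" "y \<in> lp_seq p" for x y
  proof
    fix k
    have "(\<lambda>s. c (x + y) s * g s k) = (\<lambda>s. c x s * g s k + c y s * g s k)"
      by (auto simp: c_def algebra_simps)
    then show "V (x + y) k = (V x + V y) k"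
      using suminf_add [OF V(1) [OF that(1)] V(1) [OF that(2)], of k k] by (simp add: V_def)
  qed
  have V_scale: "V (seq_scale z x) = seq_scale z (V x)" if "x \<in> lp_seq p" for z x
  proof
    fix k
    have "(\<lambda>s. c (seq_scale z x) s * g s k) = (\<lambda>s. z * (c x s * g s k))"
      by (auto simp: c_def algebra_simps)
    then show "V (seq_scale z x) k = seq_scale z (V x) k"
      using suminf_mult [OF V(1) [OF that], of z k] by (simp add: V_def)
  qed
  \<comment> \<open>As \<open>V\<close> has norm at most 1/2, A is bounded below. This gives
    injectivity and, later, the closedness of the image of \<open>X\<close>.\<close>
  define A where "A = (\<lambda>x. x + V x)"
  have A_in: "A x \<in> lp_seq p" if "x \<in> lp_seq p" for x
    unfolding A_def by (intro lp_seq_add that V)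
  have A_add: "A (x + y) = A x + A y" if "x \<in> lp_seq p" "y \<in> lp_seq p" for x y
    unfolding A_def V_add [OF that] by (simp only: ac_simps)
  have A_scale: "A (seq_scale z x) = seq_scale z (A x)" if "x \<in> lp_seq p" for z x
    unfolding A_def V_scale [OF that] by (simp only: V.scale_right_distrib)
  have A_diff: "A (x - y) = A x - A y" if "x \<in> lp_seq p" "y \<in> lp_seq p" for x y
    using A_add [of "x - y" y] that lp_seq_diff(1) [OF that] by (simp only: diff_add_cancel eq_diff_eq)
  have A_lower: "lp_norm p x \<le> 2 * lp_norm p (A x)" and A_upper: "lp_norm p (A x) \<le> 2 * lp_norm p x"
    if x: "x \<in> lp_seq p" for x
  proof -
    have "lp_norm p x - lp_norm p (V x) \<le> lp_norm p (A x)"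
      using lp_norm_triangle_rev [OF x, of "- V x"] V(2) [OF x] by (simp add: A_def)
    then show "lp_norm p x \<le> 2 * lp_norm p (A x)" using V(3) [OF x] by simp
    have "lp_norm p (A x) \<le> lp_norm p x + lp_norm p (V x)"
      unfolding A_def by (intro lp_seq_add V x)
    then show "lp_norm p (A x) \<le> 2 * lp_norm p x" using V(3) [OF x] lp_norm_nonneg [of x] by linarith
  qed
  define X where "X = {x \<in> lp_seq p. \<forall>k. k \<notin> range j \<longrightarrow> x k = 0}"
  have X_lp: "x \<in> lp_seq p" if "x \<in> X" for x using that by (simp add: X_def)
  have X_supp: "\<exists>t. k = j t" if "x \<in> X" "x k \<noteq> 0" for x k
    using that unfolding X_def by blast
  have X_sub: "V.subspace X"
    by (rule V.subspaceI) (simp_all add: X_def lp_seq_add lp_seq_scale del: plus_fun_apply seq_scale_apply, simp_all)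
  have A_inj: "inj_on A X"
  proof (rule inj_onI)
    fix x y assume xy: "x \<in> X" "y \<in> X" "A x = A y"
    then have "A (x - y) = 0" using A_diff [OF X_lp X_lp, of x y] by simp
    then have "lp_norm p (x - y) \<le> 0" using A_lower [of "x - y"] xy by (simp add: lp_seq_diff X_lp)
    then have "lp_norm p (x - y) = 0" using lp_norm_nonneg [of "x - y"] by linarith
    then have "x - y = 0"
      using lp_norm_eq_0_iff [OF lp_seq_diff(1) [OF X_lp X_lp]] xy by blast
    then show "x = y" by (simp only: right_minus_eq)
  qed
  have orbit: "\<exists>n. lp_norm p (y - (T ^^ n) (A x)) < e"
    if x: "x \<in> X" "A x \<noteq> 0" and y: "y \<in> lp_seq p" and e: "0 < e" for x y e
  proof -
    have "x \<noteq> 0"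
    proof
      assume "x = 0"
      moreover have "V 0 = 0" using V_scale [of 0 0] by (simp only: lp_seq_zero(1) V.scale_zero_left)
      ultimately have "A x = 0" unfolding A_def by (simp only: add_0_left)
      with x(2) show False ..
    qed
    then obtain k where "x k \<noteq> 0" by (auto simp: fun_eq_iff)
    then obtain i0 where i0: "x (j i0) \<noteq> 0" using X_supp [OF x(1)] by blast
    define z where "z = x (j i0)"
    \<comment> \<open>The orbit reaches multiples of \<open>D i\<close> by the fixed scalar z, so
      \<open>D i\<close> has to approximate y / z.\<close>
    obtain i where i: "lp_norm p (seq_scale (1 / z) y - D i) < e / (2 * norm z)"
      using D [of "seq_scale (1 / z) y" "e / (2 * norm z)"] y e i0 by (auto simp: lp_seq_scale z_def)
    have D_lp: "D i \<in> lp_seq p" by (rule lp_norm_le_sum(1) [OF D0])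
    have near: "lp_norm p (y - seq_scale z (D i)) < e / 2"
    proof -
      have "y - seq_scale z (D i) = seq_scale z (seq_scale (1 / z) y - D i)"
        using i0 by (simp add: fun_eq_iff z_def algebra_simps)
      then have "lp_norm p (y - seq_scale z (D i)) = norm z * lp_norm p (seq_scale (1 / z) y - D i)"
        using lp_norm_scale [OF lp_seq_diff(1) [OF lp_seq_scale [OF y] D_lp]] by simp
      also have "\<dots> < norm z * (e / (2 * norm z))"
        using i i0 by (intro mult_strict_left_mono) (auto simp: z_def)
      also have "\<dots> = e / 2" using i0 by (simp add: z_def)
      finally show ?thesis .
    qed
    \<comment> \<open>Error budget: e/2 from \<open>near\<close>, three times e/16 from the tail of
      x, and e/4 from the corrections still ahead, in total less than e.\<close>
    obtain N1 where N1: "\<And>m. N1 \<le> m \<Longrightarrow> lp_norm p (\<lambda>k. if k < m then 0 else x k) \<le> e / 16"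
      using lp_norm_truncate [OF X_lp [OF x(1)], of "e / 16"] e by auto
    obtain N2 where N2: "(1/2) ^ N2 < e / (4 * (lp_norm p x + 1))"
      using real_arch_pow_inv [of "e / (4 * (lp_norm p x + 1))" "1/2"] e lp_norm_nonneg [of x] by auto
    \<comment> \<open>Putting \<open>N1 + N2\<close> in the free entry makes s at least that large
      without changing \<open>\<iota> s\<close> and \<open>\<tau> s\<close>.\<close>
    define s where "s = prod_encode (i0, prod_encode (i, N1 + N2))"
    have s: "\<iota> s = i0" "\<tau> s = i" by (simp_all add: s_def \<iota>_def \<tau>_def)
    have s_ge: "N1 + N2 \<le> s"
      unfolding s_def using le_prod_encode_2 order_trans by blast
    define Tn where "Tn = T ^^ n s"
    have x_lp: "x \<in> lp_seq p" by (rule X_lp [OF x(1)])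
    define hd where "hd = (\<lambda>k. if k < n s then x k else 0)"
    define tl where "tl = (\<lambda>k. if k < n s then 0 else x k)"
    have tl_lp: "tl \<in> lp_seq p"
      unfolding tl_def by (rule lp_seq_dominated(1) [OF x_lp, of 1]) auto
    have x_split: "x = hd + tl" by (auto simp: hd_def tl_def fun_eq_iff)
    \<comment> \<open>An index of \<open>range j\<close> below \<open>n s\<close> is at most
      \<open>j s\<close>, hence at most \<open>n s - 2\<close>, which leaves room for the extra
      degree of its basis function.\<close>
    have "Tn hd = 0"
      unfolding Tn_def
    proof (rule funpow_T_eq_0 [of "n s - 1"])
      fix k assume k: "n s - 1 \<le> k"
      show "hd k = 0"
      proof (rule ccontr)
        assume "hd k \<noteq> 0"
        then have "k < n s" "x k \<noteq> 0" by (auto simp: hd_def split: if_splits)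
        then obtain t where t: "k = j t" using X_supp [OF x(1)] by blast
        then have "t \<le> s" using n_less_j [of s t] \<open>k < n s\<close> by (cases "s < t") auto
        then have "j t \<le> j s" using strict_mono_less_eq [OF j_mono] by simp
        then show False using jn [of s] k t by simp
      qed
    qed (use jn [of s] in simp)
    moreover have tl_small: "lp_norm p (Tn tl) \<le> 3 * (e / 16)"
    proof -
      have "lp_norm p (Tn tl) \<le> 3 * lp_norm p tl"
        unfolding Tn_def
      proof (rule good_bound [OF tl_lp])
        fix k assume "tl k \<noteq> 0"
        then have k: "n s \<le> k" "x k \<noteq> 0" by (auto simp: tl_def split: if_splits)
        then obtain t where t: "k = j t" using X_supp [OF x(1)] by blast
        have "s < t"
        proof (rule ccontr)
          assume "\<not> s < t"
          then have "j t \<le> j s" using strict_mono_less_eq [OF j_mono] by simp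
          then show False using jn [of s] k t by simp
        qed
        then obtain t' where t': "t = Suc t'" "s \<le> t'" by (cases t) auto
        show "k \<in> good (n s)" unfolding t t' by (rule good [OF n_mono [OF t'(2)]])
      qed
      also have "lp_norm p tl \<le> e / 16"
        unfolding tl_def using n_ge [of s] s_ge by (intro N1) simp
      finally show ?thesis by simp
    qed
    ultimately have Tx: "Tn x = Tn tl"
      unfolding x_split Tn_def funpow_T_add by (simp only: add_0_left)
    define h where "h = (\<lambda>t. if t \<le> s then 0 else Tn (g t))"
    have h: "h t \<in> lp_seq p" "lp_norm p (h t) \<le> (1/2) ^ s * (1/2) ^ Suc t" for t
    proof -
      show "h t \<in> lp_seq p" by (simp add: h_def Tn_def funpow_T_in g(1))
      show "lp_norm p (h t) \<le> (1/2) ^ s * (1/2) ^ Suc t"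
        using order_trans [OF Tg_greater [of s t] quarter [of s t]] by (simp add: h_def Tn_def)
    qed
    define H where "H = (\<lambda>k. \<Sum>t. c x t * h t k)"
    have H: "summable (\<lambda>t. c x t * h t k)" "H \<in> lp_seq p" "lp_norm p H \<le> (1/2) ^ s * lp_norm p x" for k
      using series [OF x_lp h] unfolding H_def by blast+
    have TV: "Tn (V x) = seq_scale z (D i) + H"
    proof
      fix k
      have Vsums: "(\<lambda>t. seq_scale (c x t) (g t) k') sums V x k'" for k'
        using summable_sums [OF V(1) [OF x_lp, of k']] by (simp add: V_def)
      have 1: "(\<lambda>t. c x t * Tn (g t) k) sums Tn (V x) k"
        using funpow_T_sums [of "\<lambda>t. seq_scale (c x t) (g t)" "V x" "n s" k, OF Vsums]
        by (simp only: funpow_T_scale seq_scale_apply Tn_def)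
      have 2: "(\<lambda>t. if t = s then z * D i k else 0) sums (z * D i k)"
        using sums_single [of s "\<lambda>t. z * D i k"] by simp
      have 3: "(\<lambda>t. c x t * h t k) sums H k"
        unfolding H_def by (rule summable_sums [OF H(1)])
      have "(\<lambda>t. c x t * Tn (g t) k) = (\<lambda>t. (if t = s then z * D i k else 0) + c x t * h t k)"
      proof
        fix t
        consider "t < s" | "t = s" | "s < t" by linarith
        then show "c x t * Tn (g t) k = (if t = s then z * D i k else 0) + c x t * h t k"
        proof cases
          case 1
          then show ?thesis using Tg_less [of t s] by (simp add: Tn_def h_def)
        next
          case 2
          then show ?thesis by (simp add: Tn_def Tg_eq h_def c_def s z_def Y_def)
        qed (simp add: h_def)
      qed
      with 1 sums_add [OF 2 3] show "Tn (V x) k = (seq_scale z (D i) + H) k"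
        using sums_unique2 by fastforce
    qed
    have "y - Tn (A x) = (y - seq_scale z (D i)) - (Tn tl + H)"
      unfolding A_def using TV Tx funpow_T_add [of "n s" x "V x"] by (simp add: Tn_def algebra_simps)
    then have "lp_norm p (y - Tn (A x)) \<le> lp_norm p (y - seq_scale z (D i)) + lp_norm p (Tn tl + H)"
      using lp_seq_diff(2) [of "y - seq_scale z (D i)" "Tn tl + H"] y D_lp tl_lp H(2)
      by (simp only: lp_seq_diff lp_seq_add lp_seq_scale funpow_T_in Tn_def)
    also have "\<dots> \<le> lp_norm p (y - seq_scale z (D i)) + (lp_norm p (Tn tl) + lp_norm p H)"
      using tl_lp H(2) by (intro add_left_mono lp_seq_add(2)) (simp_all add: Tn_def funpow_T_in)
    also have "lp_norm p H \<le> e / 4"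
    proof -
      note H(3)
      also have "(1/2) ^ s * lp_norm p x \<le> (1/2) ^ N2 * lp_norm p x"
        using s_ge by (intro mult_right_mono power_decreasing) auto
      also have "\<dots> \<le> e / (4 * (lp_norm p x + 1)) * lp_norm p x"
        using N2 by (intro mult_right_mono) auto
      also have "\<dots> = e / 4 * (lp_norm p x / (lp_norm p x + 1))" by simp
      also have "\<dots> \<le> e / 4 * 1"
        using e lp_norm_nonneg [of x] by (intro mult_left_mono) (simp_all add: divide_le_eq_1 del: lp_norm_nonneg)
      finally show ?thesis by simp
    qed
    finally have "lp_norm p (y - Tn (A x)) < e"
      using near tl_small e by linarith
    then show ?thesis unfolding Tn_def ..
  qed
  \<comment> \<open>Since A is bounded below, approximants of y pull back to a Cauchy sequence in
    \<open>X\<close>; its limit stays in \<open>X\<close> coordinatewise and is mapped to y.\<close>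
  have closed: "y \<in> A ` X" if y: "y \<in> lp_seq p" and lim: "\<forall>e>0. \<exists>m\<in>A ` X. lp_norm p (y - m) < e" for y
  proof -
    have "\<forall>l. \<exists>u\<in>X. lp_norm p (y - A u) < inverse (real (Suc l))"
      using lim by (metis imageE inverse_positive_iff_positive of_nat_0_less_iff zero_less_Suc)
    then obtain u where u: "\<And>l. u l \<in> X" "\<And>l. lp_norm p (y - A (u l)) < inverse (real (Suc l))" by metis
    have u_lp: "u l \<in> lp_seq p" for l by (rule X_lp [OF u(1)])
    have cauchy: "\<exists>N. \<forall>k\<ge>N. \<forall>l\<ge>N. lp_norm p (u k - u l) \<le> e" if e: "0 < e" for e
    proof -
      obtain N where N: "inverse (real (Suc N)) < e / 4"
        using reals_Archimedean [of "e / 4"] e by auto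
      have small: "lp_norm p (y - A (u l)) < e / 4" if "N \<le> l" for l
      proof -
        have "inverse (real (Suc l)) \<le> inverse (real (Suc N))"
          using that by (intro le_imp_inverse_le) auto
        with u(2) [of l] N show ?thesis by linarith
      qed
      have "lp_norm p (u k - u l) \<le> e" if "N \<le> k" "N \<le> l" for k l
      proof -
        have "lp_norm p (u k - u l) \<le> 2 * lp_norm p (A (u k) - A (u l))"
          using A_lower [OF lp_seq_diff(1) [OF u_lp u_lp]] by (simp only: A_diff [OF u_lp u_lp])
        also have "lp_norm p (A (u k) - A (u l)) \<le> lp_norm p (A (u k) - y) + lp_norm p (y - A (u l))"
          by (intro lp_norm_triangle_diff A_in u_lp y)
        also have "\<dots> \<le> e / 4 + e / 4"
          using small [OF that(1)] small [OF that(2)] lp_norm_minus_commute [of y "A (u k)"] by simp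
        finally show ?thesis by simp
      qed
      then show ?thesis by blast
    qed
    obtain x where x: "x \<in> lp_seq p" "\<And>i. (\<lambda>l. u l i) \<longlonglongrightarrow> x i" "(\<lambda>l. lp_norm p (u l - x)) \<longlonglongrightarrow> 0"
      using lp_seq_complete [of u, OF u_lp cauchy] by blast
    have "x \<in> X"
      unfolding X_def
    proof (intro CollectI conjI allI impI x(1))
      fix k assume "k \<notin> range j"
      then have "(\<lambda>l. u l k) = (\<lambda>l. 0)" using u(1) by (auto simp: X_def)
      then show "x k = 0" using x(2) [of k] LIMSEQ_unique [OF tendsto_const] by metis
    qed
    have "lp_norm p (y - A x) \<le> 0"
    proof (rule LIMSEQ_le_const)
      show "(\<lambda>l. inverse (real (Suc l)) + 2 * lp_norm p (u l - x)) \<longlonglongrightarrow> 0"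
        using tendsto_add [OF LIMSEQ_inverse_real_of_nat tendsto_mult_left [OF x(3), of 2]] by simp
      have "lp_norm p (y - A x) \<le> inverse (real (Suc l)) + 2 * lp_norm p (u l - x)" for l
      proof -
        have "lp_norm p (y - A x) \<le> lp_norm p (y - A (u l)) + lp_norm p (A (u l) - A x)"
          by (intro lp_norm_triangle_diff A_in u_lp y x(1))
        also have "lp_norm p (A (u l) - A x) \<le> 2 * lp_norm p (u l - x)"
          using A_upper [OF lp_seq_diff(1) [OF u_lp x(1)]] by (simp only: A_diff [OF u_lp x(1)])
        finally show ?thesis using u(2) [of l] by linarith
      qed
      then show "\<exists>N. \<forall>l\<ge>N. lp_norm p (y - A x) \<le> inverse (real (Suc l)) + 2 * lp_norm p (u l - x)" by blast
    qed
    then have "lp_norm p (y - A x) = 0" using lp_norm_nonneg [of "y - A x"] by linarith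
    then have "y - A x = 0"
      using lp_norm_eq_0_iff [OF lp_seq_diff(1) [OF y A_in [OF x(1)]]] by blast
    then have "y = A x" by (simp only: right_minus_eq)
    with \<open>x \<in> X\<close> show ?thesis by blast
  qed
  have inf_X: "\<not> finite_dimensional seq_scale X"
  proof (rule infinite_dimensional_seq)
    show "infinite (range j)" using strict_mono_imp_inj_on [OF j_mono] by (rule range_inj_infinite)
    fix k assume "k \<in> range j"
    moreover have "(\<lambda>i. if i = k then 1 else 0) \<in> lp_seq p"
      by (rule lp_norm_le_sum(1) [of "Suc k"]) auto
    ultimately show "(\<lambda>i. if i = k then 1 else 0) \<in> X" by (auto simp: X_def)
  qed
  have inf: "\<not> finite_dimensional seq_scale (A ` X)"
  proof
    assume fin: "finite_dimensional seq_scale (A ` X)"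
    have "finite_dimensional seq_scale X"
    proof (rule finite_dimensional_linear_image [where X = X and \<Phi> = A and s' = seq_scale])
      show "A (x + y) = A x + A y" if "x \<in> X" "y \<in> X" for x y
        using that by (intro A_add X_lp)
      show "A (seq_scale z x) = seq_scale z (A x)" if "x \<in> X" for z x
        using that by (intro A_scale X_lp)
    qed (fact vector_space_seq_scale X_sub order_refl A_inj fin)+
    with inf_X show False ..
  qed
  have sub: "V.subspace (A ` X)"
  proof (rule V.subspaceI)
    have "A (seq_scale 0 0) = seq_scale 0 (A 0)" by (rule A_scale) simp
    then have "A 0 = 0" by (simp only: V.scale_zero_left V.scale_zero_right)
    then show "0 \<in> A ` X" using V.subspace_0 [OF X_sub] by (metis imageI)
  next
    fix x' y' assume "x' \<in> A ` X" "y' \<in> A ` X"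
    then obtain x y where xy: "x \<in> X" "y \<in> X" "x' = A x" "y' = A y" by blast
    then have "x' + y' = A (x + y)" by (simp only: A_add X_lp)
    then show "x' + y' \<in> A ` X" using V.subspace_add [OF X_sub xy(1,2)] by blast
  next
    fix z x' assume "x' \<in> A ` X"
    then obtain x where x: "x \<in> X" "x' = A x" by blast
    then have "seq_scale z x' = A (seq_scale z x)" by (simp only: A_scale X_lp)
    then show "seq_scale z x' \<in> A ` X" using V.subspace_scale [OF X_sub x(1)] by blast
  qed
  have "hypercyclic_subspace_in seq_scale (lp_seq p) (lp_norm p) T (A ` X)"
    unfolding hypercyclic_subspace_in_def
  proof (intro conjI ballI allI impI)
    show "A ` X \<subseteq> lp_seq p" using A_in X_lp by blast
  qed (use sub closed inf orbit in blast)+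
  then show ?thesis ..
qed

end

section \<open>Transfer to the function space\<close>

lemma vector_space_fun_scale: "vector_space fun_scale"
  by unfold_locales (auto simp: fun_scale_def fun_eq_iff algebra_simps)

lemma has_fps_expansion_power_series:
  fixes f :: "complex \<Rightarrow> complex"
  assumes "0 < r" and sums: "\<And>z. norm z < r \<Longrightarrow> (\<lambda>n. c n * z ^ n) sums f z"
  shows "f has_fps_expansion Abs_fps c"
proof -
  have "(\<lambda>n. c n * complex_of_real (r / 2) ^ n) sums f (complex_of_real (r / 2))"
    using assms(1) by (intro sums) simp
  from conv_radius_geI [OF sums_summable [OF this]]
  have "ereal (r / 2) \<le> fps_conv_radius (Abs_fps c)"
    using assms(1) by (simp add: fps_conv_radius_def)
  moreover have "0 < ereal (r / 2)" using assms(1) by simp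
  ultimately have "0 < fps_conv_radius (Abs_fps c)" by (rule order.strict_trans2 [rotated])
  moreover have "\<forall>\<^sub>F z in nhds 0. z \<in> ball 0 r"
    using assms(1) by (intro eventually_nhds_in_open) auto
  then have "\<forall>\<^sub>F z in nhds 0. eval_fps (Abs_fps c) z = f z"
    by eventually_elim (use sums_unique [OF sums] in \<open>simp add: eval_fps_def\<close>)
  ultimately show ?thesis by (simp add: has_fps_expansion_def)
qed

locale lp_ab_space = shift_operator +
  assumes summable_disc: "\<And>z::complex. norm z < 1 \<Longrightarrow> summable (\<lambda>n. (norm (a n) + norm (b n)) * norm z ^ n)"
begin

definition \<Phi> :: "(nat \<Rightarrow> complex) \<Rightarrow> complex \<Rightarrow> complex" where
  "\<Phi> x z = (if z \<in> ball 0 1 then (\<Sum>n. x n * basis_fun a b n z) else 0)"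

text \<open>Coordinates of \<open>x\<close> are bounded by its norm, so the contributions of
  \<open>a\<close> and \<open>b\<close> converge absolutely and separately. Delaying the second by
  one index turns the expansion into a power series.\<close>

lemma expansion_sums:
  assumes x: "x \<in> lp_seq p" and z: "norm z < 1"
  shows "(\<lambda>n. x n * basis_fun a b n z) sums \<Phi> x z" "(\<lambda>n. taylor x n * z ^ n) sums \<Phi> x z"
proof -
  have dom: "summable (\<lambda>n. lp_norm p x * ((norm (a n) + norm (b n)) * norm z ^ n))"
    by (rule summable_mult [OF summable_disc [OF z]])
  have A: "summable (\<lambda>n. x n * a n * z ^ n)"
  proof (rule summable_comparison_test' [OF dom, of 0])
    fix n
    have "norm (x n * a n * z ^ n) = norm (x n) * (norm (a n) * norm z ^ n)"
      by (simp add: norm_mult norm_power)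
    also have "\<dots> \<le> lp_norm p x * ((norm (a n) + norm (b n)) * norm z ^ n)"
      by (intro mult_mono norm_le_lp_norm x) auto
    finally show "norm (x n * a n * z ^ n) \<le> lp_norm p x * ((norm (a n) + norm (b n)) * norm z ^ n)" .
  qed
  have B: "summable (\<lambda>n. b n * x n * z ^ Suc n)"
  proof (rule summable_comparison_test' [OF dom, of 0])
    fix n
    have "norm (b n * x n * z ^ Suc n) = norm (x n) * (norm (b n) * norm z ^ n) * norm z"
      by (simp add: norm_mult norm_power mult_ac)
    also have "\<dots> \<le> norm (x n) * (norm (b n) * norm z ^ n) * 1"
      using z by (intro mult_left_mono) auto
    also have "\<dots> \<le> lp_norm p x * ((norm (a n) + norm (b n)) * norm z ^ n)"
      unfolding mult_1_right by (intro mult_mono norm_le_lp_norm x) auto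
    finally show "norm (b n * x n * z ^ Suc n) \<le> lp_norm p x * ((norm (a n) + norm (b n)) * norm z ^ n)" .
  qed
  have split: "x n * basis_fun a b n z = x n * a n * z ^ n + b n * x n * z ^ Suc n" for n
    by (simp add: basis_fun_def algebra_simps)
  have "summable (\<lambda>n. x n * basis_fun a b n z)"
    unfolding split by (intro summable_add A B)
  from summable_sums [OF this] show sums: "(\<lambda>n. x n * basis_fun a b n z) sums \<Phi> x z"
    using z by (simp add: \<Phi>_def)
  define c where "c = (\<lambda>n. case n of 0 \<Rightarrow> 0 | Suc j \<Rightarrow> b j * x j * z ^ Suc j)"
  have "c sums (\<Sum>n. b n * x n * z ^ Suc n)"
  proof -
    have "(\<lambda>n. c (Suc n)) sums (\<Sum>n. b n * x n * z ^ Suc n)"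
      unfolding c_def nat.case by (rule summable_sums [OF B])
    from sums_Suc [OF this] show ?thesis unfolding c_def nat.case add_0_right .
  qed
  from sums_add [OF summable_sums [OF A] this]
  have "(\<lambda>n. x n * a n * z ^ n + c n) sums ((\<Sum>n. x n * a n * z ^ n) + (\<Sum>n. b n * x n * z ^ Suc n))" .
  moreover have "(\<lambda>n. x n * a n * z ^ n + c n) = (\<lambda>n. taylor x n * z ^ n)"
  proof
    show "x n * a n * z ^ n + c n = taylor x n * z ^ n" for n
      by (cases n) (simp_all add: c_def taylor_def algebra_simps)
  qed
  moreover have "(\<Sum>n. x n * a n * z ^ n) + (\<Sum>n. b n * x n * z ^ Suc n) = \<Phi> x z"
    using sums_unique2 [OF sums sums_add [OF summable_sums [OF A] summable_sums [OF B], folded split]] by simp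
  ultimately show "(\<lambda>n. taylor x n * z ^ n) sums \<Phi> x z" by simp
qed

lemma expansion_\<Phi>: "x \<in> lp_seq p \<Longrightarrow> lp_expansion p a b (\<Phi> x) x"
  using expansion_sums(1) by (simp add: lp_expansion_def lp_seq_def)

lemma expansion_imp_\<Phi>:
  assumes "lp_expansion p a b f x"
  shows "x \<in> lp_seq p" "norm z < 1 \<Longrightarrow> f z = \<Phi> x z"
proof -
  show x: "x \<in> lp_seq p" using assms by (simp add: lp_expansion_def lp_seq_def)
  show "f z = \<Phi> x z" if "norm z < 1"
  proof (rule sums_unique2)
    show "(\<lambda>n. x n * basis_fun a b n z) sums f z"
      using assms that by (simp add: lp_expansion_def)
  qed (rule expansion_sums(1) [OF x that])
qed

lemma fps_expansion_\<Phi>: "x \<in> lp_seq p \<Longrightarrow> fps_expansion (\<Phi> x) 0 = Abs_fps (taylor x)"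
  by (intro fps_expansion_eqI has_fps_expansion_power_series [of 1] expansion_sums) simp_all

text \<open>A power series determines its coefficients, and \<open>taylor\<close> is injective. This
  gives the definite description in \<open>lp_ab_norm\<close> its intended value.\<close>

lemma expansion_unique:
  assumes "lp_expansion p a b f x" "lp_expansion p a b f y"
  shows "x = y"
proof -
  note x = expansion_imp_\<Phi> [OF assms(1)] and y = expansion_imp_\<Phi> [OF assms(2)]
  have "\<Phi> x z = \<Phi> y z" for z
    using x(2) [of z] y(2) [of z] by (cases "norm z < 1") (simp_all add: \<Phi>_def)
  then have "\<Phi> x = \<Phi> y" by (rule ext)
  then have "Abs_fps (taylor x) = Abs_fps (taylor y)"
    using fps_expansion_\<Phi> [OF x(1)] fps_expansion_\<Phi> [OF y(1)] by simp
  then have "taylor x n = taylor y n" for n by (metis fps_nth_Abs_fps)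
  then have "taylor x = taylor y" by (rule ext)
  then show ?thesis by (simp only: taylor_inject)
qed

lemma the_expansion: "lp_expansion p a b f x \<Longrightarrow> (THE l. lp_expansion p a b f l) = x"
  using expansion_unique by (intro the_equality)

lemma lp_ab_norm_expansion: "lp_expansion p a b f x \<Longrightarrow> lp_ab_norm p a b f = lp_norm p x"
  unfolding lp_ab_norm_def lp_norm_def by (simp only: the_expansion)

lemma lp_ab_norm_\<Phi>: "x \<in> lp_seq p \<Longrightarrow> lp_ab_norm p a b (\<Phi> x) = lp_norm p x"
  by (intro lp_ab_norm_expansion expansion_\<Phi>)

lemma \<Phi>_in: "x \<in> lp_seq p \<Longrightarrow> \<Phi> x \<in> lp_ab p a b"
proof -
  assume x: "x \<in> lp_seq p"
  have "\<Phi> x analytic_on ball 0 1"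
    by (rule power_series_analytic [where a = "taylor x"]) (use expansion_sums(2) [OF x] in auto)
  then show ?thesis
    using expansion_\<Phi> [OF x] by (auto simp: lp_ab_def \<Phi>_def)
qed

lemma lp_ab_eq: "lp_ab p a b = \<Phi> ` lp_seq p"
proof (intro equalityI subsetI)
  fix f assume f: "f \<in> lp_ab p a b"
  then obtain x where x: "lp_expansion p a b f x" by (auto simp: lp_ab_def)
  have "f z = \<Phi> x z" for z
  proof (cases "norm z < 1")
    case True
    then show ?thesis by (rule expansion_imp_\<Phi>(2) [OF x])
  next
    case False
    then show ?thesis using f by (simp add: lp_ab_def \<Phi>_def)
  qed
  then have "f = \<Phi> x" by (rule ext)
  with expansion_imp_\<Phi>(1) [OF x] show "f \<in> \<Phi> ` lp_seq p" by blast
qed (auto simp: \<Phi>_in)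

lemma \<Phi>_add:
  assumes "x \<in> lp_seq p" "y \<in> lp_seq p"
  shows "\<Phi> (x + y) = \<Phi> x + \<Phi> y"
proof
  fix z
  show "\<Phi> (x + y) z = (\<Phi> x + \<Phi> y) z"
  proof (cases "norm z < 1")
    case True
    from sums_add [OF expansion_sums(1) [OF assms(1) True] expansion_sums(1) [OF assms(2) True]]
    have "(\<lambda>n. (x + y) n * basis_fun a b n z) sums (\<Phi> x z + \<Phi> y z)"
      by (simp add: distrib_right)
    from sums_unique2 [OF expansion_sums(1) [OF lp_seq_add(1) [OF assms] True] this]
    show ?thesis by simp
  qed (simp add: \<Phi>_def)
qed

lemma \<Phi>_scale:
  assumes "x \<in> lp_seq p"
  shows "\<Phi> (seq_scale c x) = fun_scale c (\<Phi> x)"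
proof
  fix z
  show "\<Phi> (seq_scale c x) z = fun_scale c (\<Phi> x) z"
  proof (cases "norm z < 1")
    case True
    from sums_mult [OF expansion_sums(1) [OF assms True], of c]
    have "(\<lambda>n. seq_scale c x n * basis_fun a b n z) sums (c * \<Phi> x z)"
      by (simp add: mult.assoc)
    from sums_unique2 [OF expansion_sums(1) [OF lp_seq_scale [OF assms] True] this]
    show ?thesis by (simp add: fun_scale_def)
  qed (simp add: \<Phi>_def fun_scale_def)
qed

lemma shift_\<Phi>:
  assumes x: "x \<in> lp_seq p"
  shows "weighted_backward_shift w (\<Phi> x) = \<Phi> (T x)"
proof
  fix z
  show "weighted_backward_shift w (\<Phi> x) z = \<Phi> (T x) z"
  proof (cases "norm z < 1")
    case True
    have "taylor (T x) n = w (Suc n) * taylor x (Suc n)" for n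
      by (simp add: T_def)
    then show ?thesis
      using sums_unique [OF expansion_sums(2) [OF T_in [OF x] True]] True
      by (simp add: weighted_backward_shift_def fps_expansion_\<Phi> [OF x])
  qed (simp add: weighted_backward_shift_def \<Phi>_def)
qed

text \<open>Stated for every \<open>f\<close>, since \<open>Metric_space\<close> demands a symmetric
  distance outside the carrier too. If \<open>f\<close> has no expansion, neither has
  \<open>- f\<close>, and both descriptions are of the same empty predicate.\<close>

lemma lp_ab_norm_uminus: "lp_ab_norm p a b (- f) = lp_ab_norm p a b f"
proof -
  have neg: "lp_expansion p a b (- g) (- x)" if "lp_expansion p a b g x" for g x
    using that sums_minus unfolding lp_expansion_def by fastforce
  show ?thesis
  proof (cases "\<exists>x. lp_expansion p a b f x")
    case True
    then obtain x where x: "lp_expansion p a b f x" ..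
    show ?thesis
      unfolding lp_ab_norm_expansion [OF x] lp_ab_norm_expansion [OF neg [OF x]] by (rule lp_norm_uminus)
  next
    case False
    then have "\<not> lp_expansion p a b (- f) x" for x
      using neg [of "- f" x] by auto
    with False have "lp_expansion p a b (- f) = lp_expansion p a b f" by auto
    then show ?thesis by (simp add: lp_ab_norm_def)
  qed
qed

sublocale iso: linear_isometry seq_scale "lp_seq p" "lp_norm p" T
  fun_scale "lp_ab p a b" "lp_ab_norm p a b" "weighted_backward_shift w" \<Phi>
proof (rule linear_isometry.intro)
  interpret V: vector_space seq_scale by (rule vector_space_seq_scale)
  interpret V': vector_space fun_scale by (rule vector_space_fun_scale)
  show "V'.subspace (lp_ab p a b)"
    unfolding lp_ab_eq
  proof (rule V'.subspaceI)
    have "0 = \<Phi> 0" by (simp add: \<Phi>_def fun_eq_iff)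
    then show "0 \<in> \<Phi> ` lp_seq p" using lp_seq_zero(1) by (rule image_eqI)
  next
    fix f g assume "f \<in> \<Phi> ` lp_seq p" "g \<in> \<Phi> ` lp_seq p"
    then obtain x y where xy: "x \<in> lp_seq p" "y \<in> lp_seq p" "f = \<Phi> x" "g = \<Phi> y" by blast
    then have "f + g = \<Phi> (x + y)" by (simp only: \<Phi>_add)
    then show "f + g \<in> \<Phi> ` lp_seq p" using lp_seq_add(1) [OF xy(1,2)] by (rule image_eqI)
  next
    fix c f assume "f \<in> \<Phi> ` lp_seq p"
    then obtain x where x: "x \<in> lp_seq p" "f = \<Phi> x" by blast
    then have "fun_scale c f = \<Phi> (seq_scale c x)" by (simp only: \<Phi>_scale)
    then show "fun_scale c f \<in> \<Phi> ` lp_seq p" using lp_seq_scale [OF x(1)] by (rule image_eqI)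
  qed
  show "bij_betw \<Phi> (lp_seq p) (lp_ab p a b)"
    unfolding bij_betw_def lp_ab_eq
  proof (intro conjI inj_onI refl)
    fix x y assume "x \<in> lp_seq p" "y \<in> lp_seq p" "\<Phi> x = \<Phi> y"
    then show "x = y" using expansion_unique expansion_\<Phi> by metis
  qed
qed (fact vector_space_seq_scale vector_space_fun_scale subspace_lp_seq \<Phi>_add \<Phi>_scale lp_ab_norm_\<Phi> T_in shift_\<Phi>)+

lemma Metric_space_lp_ab: "Metric_space (lp_ab p a b) (\<lambda>f g. lp_ab_norm p a b (f - g))"
proof
  show "0 \<le> lp_ab_norm p a b (f - g)" for f g by (simp add: lp_ab_norm_def)
  show "lp_ab_norm p a b (f - g) = lp_ab_norm p a b (g - f)" for f g
    using lp_ab_norm_uminus [of "f - g"] by simp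
  fix f g assume "f \<in> lp_ab p a b" "g \<in> lp_ab p a b"
  then obtain x y where xy: "x \<in> lp_seq p" "y \<in> lp_seq p" "f = \<Phi> x" "g = \<Phi> y"
    unfolding lp_ab_eq by blast
  then have "lp_ab_norm p a b (f - g) = 0 \<longleftrightarrow> x - y = 0"
    by (simp only: iso.norm_diff lp_norm_eq_0_iff lp_seq_diff)
  also have "\<dots> \<longleftrightarrow> f = g"
    using xy iso.inj by (simp only: right_minus_eq inj_on_eq_iff)
  finally show "lp_ab_norm p a b (f - g) = 0 \<longleftrightarrow> f = g" .
next
  fix f g h assume "f \<in> lp_ab p a b" "g \<in> lp_ab p a b" "h \<in> lp_ab p a b"
  then obtain x y z where xyz: "x \<in> lp_seq p" "y \<in> lp_seq p" "z \<in> lp_seq p" "f = \<Phi> x" "g = \<Phi> y" "h = \<Phi> z"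
    unfolding lp_ab_eq by blast
  then show "lp_ab_norm p a b (f - h) \<le> lp_ab_norm p a b (f - g) + lp_ab_norm p a b (g - h)"
    by (simp only: iso.norm_diff lp_norm_triangle_diff)
qed

lemma has_hypercyclic_subspace_weighted_shift_iff:
  "has_hypercyclic_subspace fun_scale (lp_ab p a b) (lp_ab_norm p a b) (weighted_backward_shift w) \<longleftrightarrow>
    (\<forall>B. \<exists>n. B < norm (W n * a n)) \<and>
    (\<forall>n\<ge>1. (INF k\<in>{1..}. norm (\<Prod>i=k..<k+n. \<omega> i)) \<le> 1)"
proof -
  have "(\<forall>B. \<exists>n. B < norm (W n * a n)) \<and> (\<forall>n\<ge>1. (INF k\<in>{1..}. norm (\<Prod>i=k..<k+n. \<omega> i)) \<le> 1)"
    if H: "hypercyclic_subspace_in seq_scale (lp_seq p) (lp_norm p) T M" for M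
  proof (intro conjI allI impI)
    fix B
    have M: "M \<subseteq> lp_seq p" "\<not> finite_dimensional seq_scale M"
      and dense: "\<And>x y e. x \<in> M \<Longrightarrow> x \<noteq> 0 \<Longrightarrow> y \<in> lp_seq p \<Longrightarrow> 0 < e \<Longrightarrow> \<exists>n. lp_norm p (y - (T ^^ n) x) < e"
      using H by (simp_all add: hypercyclic_subspace_in_def)
    have "\<not> M \<subseteq> iso.V.span {}"
      using M(2) unfolding finite_dimensional_def by blast
    then obtain x where x: "x \<in> M" "x \<noteq> 0" unfolding iso.V.span_empty by blast
    show "\<exists>n. B < norm (W n * a n)"
    proof (rule dense_orbit_imp_weights_unbounded)
      show "x \<in> lp_seq p" using x M by blast
    qed (rule dense [OF x])
  next
    fix n :: nat assume n: "1 \<le> n"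
    show "(INF k\<in>{1..}. norm (\<Prod>i=k..<k+n. \<omega> i)) \<le> 1"
    proof (rule ccontr)
      assume I: "\<not> ?thesis"
      \<comment> \<open>The infimum itself serves as \<open>\<rho>\<close>.\<close>
      have "(INF k\<in>{1..}. norm (\<Prod>i=k..<k+n. \<omega> i)) \<le> norm (\<Prod>i=k..<k+n. \<omega> i)" if "1 \<le> k" for k
        using that by (intro cINF_lower bdd_belowI [of _ 0]) auto
      from no_hypercyclic_subspace [OF this n] I H show False by simp
    qed
  qed
  moreover have "\<exists>M. hypercyclic_subspace_in seq_scale (lp_seq p) (lp_norm p) T M"
    if "\<forall>B. \<exists>n. B < norm (W n * a n)" "\<forall>n\<ge>1. (INF k\<in>{1..}. norm (\<Prod>i=k..<k+n. \<omega> i)) \<le> 1"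
    using that by (intro hypercyclic_subspace_exists) auto
  ultimately show ?thesis
    unfolding iso.has_hypercyclic_subspace_transfer [OF Metric_space_lp_ab] using bounded_operator_T by blast
qed

lemma prod_w: "(\<Prod>i=k+1..k+n. w i) * (a (k + n) / a k) = (\<Prod>i=k..<k+n. \<omega> i)"
proof -
  have "(\<Prod>i=k+1..k+n. w i) * W k = W (k + n)"
    by (induction n) (simp_all add: W_Suc mult_ac)
  then have "(\<Prod>i=k+1..k+n. w i) = W (k + n) / W k"
    by (simp add: field_simps)
  then show ?thesis by (simp add: prod_\<omega>)
qed

end

section \<open>Extended-real suprema and the final equivalence\<close>

lemma SUP_ereal_eq_infinity_iff:
  fixes f :: "nat \<Rightarrow> real"
  shows "(SUP n. ereal (f n)) = \<infinity> \<longleftrightarrow> (\<forall>B. \<exists>n. B < f n)"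
proof
  assume sup: "(SUP n. ereal (f n)) = \<infinity>"
  show "\<forall>B. \<exists>n. B < f n"
  proof (rule ccontr)
    assume "\<not> ?thesis"
    then obtain B where "\<And>n. f n \<le> B" by (auto simp: not_less)
    then have "(SUP n. ereal (f n)) \<le> ereal B" by (intro SUP_least) simp
    with sup show False by simp
  qed
next
  assume unbounded: "\<forall>B. \<exists>n. B < f n"
  show "(SUP n. ereal (f n)) = \<infinity>"
  proof (rule SUP_PInfty)
    fix m :: nat
    obtain n where "real m < f n" using unbounded by blast
    then show "\<exists>n\<in>UNIV. ereal (real m) \<le> ereal (f n)" by (auto intro: less_imp_le)
  qed
qed

theorem corollary4p8:
  fixes p q :: real and a b w :: "nat \<Rightarrow> complex"
  assumes p: "1 < p" and q: "1 / p + 1 / q = 1"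
    and a_nonzero: "\<And>n. a n \<noteq> 0"
    and w_nonzero: "\<And>n. w n \<noteq> 0"
    and domain_q: "{z::complex. summable (\<lambda>n. ((norm (a n) + norm (b n)) * norm z ^ n) powr q)} = ball 0 1"
    and domain_sup: "{z::complex. (SUP n. ereal ((norm (a n) + norm (b n)) * norm z ^ n)) < \<infinity>} = ball 0 1"
    and domain_sum: "{z::complex. summable (\<lambda>n. (norm (a n) + norm (b n)) * norm z ^ n)} = ball 0 1"
    and sup_finite: "(SUP n. ereal (norm (w (Suc n) * (a (Suc n) / a n)))) < \<infinity>"
    and limsup_less: "limsup (\<lambda>n. ereal (norm (b n / a (Suc n)))) < 1"
    and lim_zero: "(\<lambda>n. norm (w (Suc (Suc n)) * (b (Suc n) / a (Suc n)) - w (Suc n) * (b n / a n))) \<longlonglongrightarrow> 0"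
  shows "has_hypercyclic_subspace fun_scale (lp_ab p a b) (lp_ab_norm p a b) (weighted_backward_shift w)
    \<longleftrightarrow> (SUP n. ereal (norm ((\<Prod>i=1..n. w i) * a n))) = \<infinity> \<and>
        (SUP n\<in>{1..}. ereal (root n (INF k\<in>{1..}. norm ((\<Prod>i=k+1..k+n. w i) * (a (k + n) / a k))))) \<le> 1"
proof -
  obtain B where B: "\<And>n. norm (w (Suc n) * (a (Suc n) / a n)) \<le> B"
    using sup_finite SUP_ereal_eq_infinity_iff [of "\<lambda>n. norm (w (Suc n) * (a (Suc n) / a n))"]
    by (metis less_irrefl not_le)
  \<comment> \<open>Any value strictly between the limes superior and 1 bounds the ratios from some
    \<open>N0\<close> on. It exceeds a norm and is below 1, hence is a positive real.\<close>
  obtain r' where r': "limsup (\<lambda>n. ereal (norm (b n / a (Suc n)))) < r'" "r' < 1"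
    using dense [OF limsup_less] by blast
  obtain N0 where N0: "\<And>n. N0 \<le> n \<Longrightarrow> ereal (norm (b n / a (Suc n))) < r'"
    using Limsup_lessD [OF r'(1)] unfolding eventually_sequentially by blast
  have "0 < r'" using N0 [of N0] by (rule order.strict_trans1 [rotated]) simp_all
  with r'(2) obtain r where r: "r' = ereal r" "0 < r" "r < 1" by (cases r') auto
  interpret lp_ab_space p a b w "max 1 B" r N0
  proof
    show "1 \<le> p" using p by simp
    show "norm (w (Suc n) * (a (Suc n) / a n)) \<le> max 1 B" for n
      using B [of n] by simp
    show "norm (b n / a (Suc n)) \<le> r" if "N0 \<le> n" for n
      using N0 [OF that] r(1) by simp
    show "summable (\<lambda>n. (norm (a n) + norm (b n)) * norm z ^ n)" if "norm z < 1" for z :: complex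
    proof -
      have "z \<in> ball 0 1" using that by simp
      then show ?thesis unfolding domain_sum [symmetric] by simp
    qed
  qed (use a_nonzero w_nonzero r lim_zero in simp_all)
  \<comment> \<open>Taking n-th roots does not affect the comparison with 1, so the supremum
    condition says that every infimum is at most 1.\<close>
  have "(SUP n\<in>{1..}. ereal (root n (INF k\<in>{1..}. norm ((\<Prod>i=k+1..k+n. w i) * (a (k + n) / a k))))) \<le> 1
      \<longleftrightarrow> (\<forall>n\<ge>1. (INF k\<in>{1..}. norm (\<Prod>i=k..<k+n. \<omega> i)) \<le> 1)"
    unfolding SUP_le_iff prod_w by auto
  then show ?thesis
    unfolding has_hypercyclic_subspace_weighted_shift_iff SUP_ereal_eq_infinity_iff W_def by simp
qed

end
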